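(* Let $\mathscr C$ be a symmetric monoidal category tensored over $\mathrm{Set}$ and let $\varphi\colon G\to C_2$ be a group homomorphism. Then there is an isomorphism of categories $$\mathrm{Alg}_{\mathrm{Assoc}^\varphi}(\mathscr C)\xrightarrow{\ \cong\ }\mathrm{Mon}^\varphi(\mathscr C)$$ between algebras over the operad $\mathrm{Assoc}^\varphi$ in $\mathscr C$ and monoids with twisted $G$-action in $\mathscr C$.
   Context: $C_2=\{1,-1\}$; $g\in G$ is even if $\varphi(g)=1$, odd if $\varphi(g)=-1$. \textbf{Monoids with twisted $G$-action.} For a category $\mathscr D$ with $C_2$-action, $C_2\rtimes\mathscr D$ has the same objects as $\mathscr D$, morphisms $C_0\to C_1$ are pairs $(f,g)$ with $g\in C_2$ and $f\colon gC_0\to C_1$ in $\mathscr D$, with composition $(f_1,g_1)\circ(f_2,g_2)=(f_1\circ g_1(f_2),g_1g_2)$; it maps to $BC_2$. Let $\mathrm{Mon}_{\mathscr C}$ be the category of (associative unital) monoids in $\mathscr C$, with $C_2$-action $M\mapsto M^{\mathrm{op}}$ (opposite multiplication). $\mathrm{Mon}^\varphi(\mathscr C)$ is the category of monoids with twisted $G$-action, i.e. functors $BG\to C_2\rtimes\mathrm{Mon}_{\mathscr C}$ over $BC_2$ (where $BG\to BC_2$ is $B\varphi$). Concretely: a monoid $M$ with an action of $G$ on the underlying object of $\mathscr C$, even elements acting by monoid homomorphisms and odd elements by anti-homomorphisms. \textbf{The operad.} $\mathrm{Assoc}$ is the operad in sets with $\mathrm{Assoc}(n)=\Sigma_n$,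 viewed as the set of linear orders on $\{1,\dots,n\}$ (composition: lexicographic substitution of orders). $C_2$ acts on the operad $\mathrm{Assoc}$ by reversing linear orders, and $G$ acts through $\varphi$. $\mathrm{Assoc}^\varphi=\mathrm{Assoc}\rtimes G$ is the operad with $(\mathrm{Assoc}\rtimes G)(k)=\mathrm{Assoc}(k)\times G^k$, $\Sigma_k$ acting diagonally, and structure map $$\big((\phi,\underline g),(\psi_1,\underline h^1),\dots,(\psi_k,\underline h^k)\big)\mapsto\big(\gamma_{\mathrm{Assoc}}(\phi;g_1\psi_1,\dots,g_k\psi_k),g_1\underline h^1,\dots,g_k\underline h^k\big),$$ where $\underline g=(g_1,\dots,g_k)$ and $g_i\underline h^i=(g_ih^i_1,\dots,g_ih^i_{n_i})$; the unit is formed by the units of $\mathrm{Assoc}$ and $G$. Algebras in $\mathscr C$ over an operad in sets are formed using the tensoring of $\mathscr C$ over $\mathrm{Set}$. *)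

theory Defs
  imports "HOL-Algebra.Group" "HOL-Combinatorics.Transposition"
begin

record ('o, 'm) cat =
  Obj :: "'o set"
  Arr :: "'m set"
  Dom :: "'m \<Rightarrow> 'o"
  Cod :: "'m \<Rightarrow> 'o"
  Ide :: "'o \<Rightarrow> 'm"
  Comp :: "'m \<Rightarrow> 'm \<Rightarrow> 'm"  (infixl "\<cdot>\<index>" 70)

definition Hom :: "('o, 'm, 'z) cat_scheme \<Rightarrow> 'o \<Rightarrow> 'o \<Rightarrow> 'm set" where
  "Hom C A B = {f \<in> Arr C. Dom C f = A \<and> Cod C f = B}"

locale category =
  fixes C :: "('o, 'm, 'z) cat_scheme" (structure)
  assumes Dom_in: "f \<in> Arr C \<Longrightarrow> Dom C f \<in> Obj C"
    and Cod_in: "f \<in> Arr C \<Longrightarrow> Cod C f \<in> Obj C"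
    and Ide_in: "A \<in> Obj C \<Longrightarrow> Ide C A \<in> Hom C A A"
    and Comp_in: "f \<in> Hom C A B \<Longrightarrow> g \<in> Hom C B D \<Longrightarrow> g \<cdot> f \<in> Hom C A D"
    and Ide_left: "f \<in> Hom C A B \<Longrightarrow> Ide C B \<cdot> f = f"
    and Ide_right: "f \<in> Hom C A B \<Longrightarrow> f \<cdot> Ide C A = f"
    and Comp_assoc: "f \<in> Hom C A B \<Longrightarrow> g \<in> Hom C B D \<Longrightarrow> h \<in> Hom C D E \<Longrightarrow>
          (h \<cdot> g) \<cdot> f = h \<cdot> (g \<cdot> f)"

definition inverse_arrows :: "('o, 'm, 'z) cat_scheme \<Rightarrow> 'm \<Rightarrow> 'm \<Rightarrow> bool" where
  "inverse_arrows C f g \<longleftrightarrow> f \<in> Arr C \<and> g \<in> Hom C (Cod C f) (Dom C f) \<and>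
     g \<cdot>\<^bsub>C\<^esub> f = Ide C (Dom C f) \<and> f \<cdot>\<^bsub>C\<^esub> g = Ide C (Cod C f)"

definition iso_arr :: "('o, 'm, 'z) cat_scheme \<Rightarrow> 'm \<Rightarrow> bool" where
  "iso_arr C f \<longleftrightarrow> (\<exists>g. inverse_arrows C f g)"

definition inv_arr :: "('o, 'm, 'z) cat_scheme \<Rightarrow> 'm \<Rightarrow> 'm" where
  "inv_arr C f = (THE g. inverse_arrows C f g)"

record ('o1, 'm1, 'o2, 'm2) func =
  fob :: "'o1 \<Rightarrow> 'o2"
  far :: "'m1 \<Rightarrow> 'm2"

text \<open>Functors are extensional (\<open>undefined\<close> outside the source category), so that equality
  of functors is equality of records.\<close>

definition is_functor ::
  "('o1, 'm1, 'z1) cat_scheme \<Rightarrow> ('o2, 'm2, 'z2) cat_scheme \<Rightarrow> ('o1, 'm1, 'o2, 'm2) func \<Rightarrow> bool"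
  where
  "is_functor A B F \<longleftrightarrow>
     fob F \<in> Obj A \<rightarrow>\<^sub>E Obj B \<and>
     far F \<in> extensional (Arr A) \<and>
     (\<forall>f\<in>Arr A. far F f \<in> Hom B (fob F (Dom A f)) (fob F (Cod A f))) \<and>
     (\<forall>X\<in>Obj A. far F (Ide A X) = Ide B (fob F X)) \<and>
     (\<forall>f\<in>Arr A. \<forall>g\<in>Arr A. Cod A f = Dom A g \<longrightarrow>
        far F (g \<cdot>\<^bsub>A\<^esub> f) = far F g \<cdot>\<^bsub>B\<^esub> far F f)"

definition isomorphic_categories ::
  "('o1, 'm1, 'z1) cat_scheme \<Rightarrow> ('o2, 'm2, 'z2) cat_scheme \<Rightarrow> bool" where
  "isomorphic_categories A B \<longleftrightarrow> category A \<and> category B \<and>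
     (\<exists>F G. is_functor A B F \<and> is_functor B A G \<and>
        (\<forall>X\<in>Obj A. fob G (fob F X) = X) \<and> (\<forall>f\<in>Arr A. far G (far F f) = f) \<and>
        (\<forall>Y\<in>Obj B. fob F (fob G Y) = Y) \<and> (\<forall>g\<in>Arr B. far F (far G g) = g))"

text \<open>For \<open>p : A \<rightarrow> E\<close> and \<open>q : B \<rightarrow> E\<close>, the category of functors \<open>F : A \<rightarrow> B\<close> with
  \<open>q \<circ> F = p\<close>; its morphisms are the natural transformations over \<open>E\<close>, i.e. those whose
  components are sent to identities by \<open>q\<close>.\<close>

definition functors_over ::
  "('o1, 'm1, 'z1) cat_scheme \<Rightarrow> ('o2, 'm2, 'z2) cat_scheme \<Rightarrow> ('o3, 'm3, 'z3) cat_scheme \<Rightarrow>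
   ('o1, 'm1, 'o3, 'm3) func \<Rightarrow> ('o2, 'm2, 'o3, 'm3) func \<Rightarrow> ('o1, 'm1, 'o2, 'm2) func set"
  where
  "functors_over A B E p q = {F. is_functor A B F \<and>
     (\<forall>X\<in>Obj A. fob q (fob F X) = fob p X) \<and> (\<forall>f\<in>Arr A. far q (far F f) = far p f)}"

definition nat_trans_over ::
  "('o1, 'm1, 'z1) cat_scheme \<Rightarrow> ('o2, 'm2, 'z2) cat_scheme \<Rightarrow> ('o3, 'm3, 'z3) cat_scheme \<Rightarrow>
   ('o1, 'm1, 'o3, 'm3) func \<Rightarrow> ('o2, 'm2, 'o3, 'm3) func \<Rightarrow>
   ('o1, 'm1, 'o2, 'm2) func \<Rightarrow> ('o1, 'm1, 'o2, 'm2) func \<Rightarrow> ('o1 \<Rightarrow> 'm2) set"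
  where
  "nat_trans_over A B E p q F F' = {\<tau>. \<tau> \<in> extensional (Obj A) \<and>
     (\<forall>X\<in>Obj A. \<tau> X \<in> Hom B (fob F X) (fob F' X) \<and> far q (\<tau> X) = Ide E (fob p X)) \<and>
     (\<forall>f\<in>Arr A. \<tau> (Cod A f) \<cdot>\<^bsub>B\<^esub> far F f = far F' f \<cdot>\<^bsub>B\<^esub> \<tau> (Dom A f))}"

definition functor_category_over ::
  "('o1, 'm1, 'z1) cat_scheme \<Rightarrow> ('o2, 'm2, 'z2) cat_scheme \<Rightarrow> ('o3, 'm3, 'z3) cat_scheme \<Rightarrow>
   ('o1, 'm1, 'o3, 'm3) func \<Rightarrow> ('o2, 'm2, 'o3, 'm3) func \<Rightarrow>
   (('o1, 'm1, 'o2, 'm2) func,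
    ('o1, 'm1, 'o2, 'm2) func \<times> ('o1, 'm1, 'o2, 'm2) func \<times> ('o1 \<Rightarrow> 'm2)) cat"
  where
  "functor_category_over A B E p q = \<lparr>
     Obj = functors_over A B E p q,
     Arr = {(F, F', \<tau>). F \<in> functors_over A B E p q \<and> F' \<in> functors_over A B E p q \<and>
              \<tau> \<in> nat_trans_over A B E p q F F'},
     Dom = (\<lambda>(F, F', \<tau>). F),
     Cod = (\<lambda>(F, F', \<tau>). F'),
     Ide = (\<lambda>F. (F, F, \<lambda>X\<in>Obj A. Ide B (fob F X))),
     Comp = (\<lambda>(F1, F1', \<tau>1) (F2, F2', \<tau>2). (F2, F1', \<lambda>X\<in>Obj A. \<tau>1 X \<cdot>\<^bsub>B\<^esub> \<tau>2 X)) \<rparr>"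

record ('o, 'm) smc = "('o, 'm) cat" +
  tens_obj :: "'o \<Rightarrow> 'o \<Rightarrow> 'o"  (infixr "\<odot>\<index>" 75)
  tens_arr :: "'m \<Rightarrow> 'm \<Rightarrow> 'm"  (infixr "\<star>\<index>" 75)
  unit_obj :: "'o"
  associator :: "'o \<Rightarrow> 'o \<Rightarrow> 'o \<Rightarrow> 'm"
  lunitor :: "'o \<Rightarrow> 'm"
  runitor :: "'o \<Rightarrow> 'm"
  symmetry :: "'o \<Rightarrow> 'o \<Rightarrow> 'm"

locale symmetric_monoidal_category = category C
  for C :: "('o, 'm, 'z) smc_scheme" (structure) +
  assumes unit_in: "unit_obj C \<in> Obj C"
    and tens_obj_in: "A \<in> Obj C \<Longrightarrow> B \<in> Obj C \<Longrightarrow> A \<odot> B \<in> Obj C"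
    and tens_arr_in: "f \<in> Hom C A A' \<Longrightarrow> g \<in> Hom C B B' \<Longrightarrow> f \<star> g \<in> Hom C (A \<odot> B) (A' \<odot> B')"
    and tens_Ide: "A \<in> Obj C \<Longrightarrow> B \<in> Obj C \<Longrightarrow> Ide C A \<star> Ide C B = Ide C (A \<odot> B)"
    and tens_Comp: "f \<in> Hom C A A' \<Longrightarrow> f' \<in> Hom C A' A'' \<Longrightarrow> g \<in> Hom C B B' \<Longrightarrow> g' \<in> Hom C B' B'' \<Longrightarrow>
          (f' \<cdot> f) \<star> (g' \<cdot> g) = (f' \<star> g') \<cdot> (f \<star> g)"
    and associator_in: "A \<in> Obj C \<Longrightarrow> B \<in> Obj C \<Longrightarrow> D \<in> Obj C \<Longrightarrow>
          associator C A B D \<in> Hom C ((A \<odot> B) \<odot> D) (A \<odot> (B \<odot> D))"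
    and associator_iso: "A \<in> Obj C \<Longrightarrow> B \<in> Obj C \<Longrightarrow> D \<in> Obj C \<Longrightarrow> iso_arr C (associator C A B D)"
    and associator_nat: "f \<in> Hom C A A' \<Longrightarrow> g \<in> Hom C B B' \<Longrightarrow> h \<in> Hom C D D' \<Longrightarrow>
          associator C A' B' D' \<cdot> ((f \<star> g) \<star> h) = (f \<star> (g \<star> h)) \<cdot> associator C A B D"
    and lunitor_in: "A \<in> Obj C \<Longrightarrow> lunitor C A \<in> Hom C (unit_obj C \<odot> A) A"
    and lunitor_iso: "A \<in> Obj C \<Longrightarrow> iso_arr C (lunitor C A)"
    and lunitor_nat: "f \<in> Hom C A B \<Longrightarrow>
          lunitor C B \<cdot> (Ide C (unit_obj C) \<star> f) = f \<cdot> lunitor C A"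
    and runitor_in: "A \<in> Obj C \<Longrightarrow> runitor C A \<in> Hom C (A \<odot> unit_obj C) A"
    and runitor_iso: "A \<in> Obj C \<Longrightarrow> iso_arr C (runitor C A)"
    and runitor_nat: "f \<in> Hom C A B \<Longrightarrow>
          runitor C B \<cdot> (f \<star> Ide C (unit_obj C)) = f \<cdot> runitor C A"
    and pentagon: "A \<in> Obj C \<Longrightarrow> B \<in> Obj C \<Longrightarrow> D \<in> Obj C \<Longrightarrow> E \<in> Obj C \<Longrightarrow>
          (Ide C A \<star> associator C B D E) \<cdot> associator C A (B \<odot> D) E \<cdot> (associator C A B D \<star> Ide C E)
          = associator C A B (D \<odot> E) \<cdot> associator C (A \<odot> B) D E"
    and triangle: "A \<in> Obj C \<Longrightarrow> B \<in> Obj C \<Longrightarrow>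
          (Ide C A \<star> lunitor C B) \<cdot> associator C A (unit_obj C) B = runitor C A \<star> Ide C B"
    and symmetry_in: "A \<in> Obj C \<Longrightarrow> B \<in> Obj C \<Longrightarrow> symmetry C A B \<in> Hom C (A \<odot> B) (B \<odot> A)"
    and symmetry_nat: "f \<in> Hom C A A' \<Longrightarrow> g \<in> Hom C B B' \<Longrightarrow>
          symmetry C A' B' \<cdot> (f \<star> g) = (g \<star> f) \<cdot> symmetry C A B"
    and symmetry_inv: "A \<in> Obj C \<Longrightarrow> B \<in> Obj C \<Longrightarrow>
          symmetry C B A \<cdot> symmetry C A B = Ide C (A \<odot> B)"
    and hexagon: "A \<in> Obj C \<Longrightarrow> B \<in> Obj C \<Longrightarrow> D \<in> Obj C \<Longrightarrow>
          associator C B D A \<cdot> symmetry C A (B \<odot> D) \<cdot> associator C A B D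
          = (Ide C B \<star> symmetry C A D) \<cdot> associator C B A D \<cdot> (symmetry C A B \<star> Ide C D)"

text \<open>Iterated tensor products are bracketed to the right and end in the unit object.\<close>

fun tens_list :: "('o, 'm, 'z) smc_scheme \<Rightarrow> 'o list \<Rightarrow> 'o" where
  "tens_list C [] = unit_obj C"
| "tens_list C (A # As) = A \<odot>\<^bsub>C\<^esub> tens_list C As"

fun tens_arr_list :: "('o, 'm, 'z) smc_scheme \<Rightarrow> 'm list \<Rightarrow> 'm" where
  "tens_arr_list C [] = Ide C (unit_obj C)"
| "tens_arr_list C (f # fs) = f \<star>\<^bsub>C\<^esub> tens_arr_list C fs"

abbreviation tens_pow :: "('o, 'm, 'z) smc_scheme \<Rightarrow> 'o \<Rightarrow> nat \<Rightarrow> 'o" where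
  "tens_pow C A n \<equiv> tens_list C (replicate n A)"

fun tens_append :: "('o, 'm, 'z) smc_scheme \<Rightarrow> 'o list \<Rightarrow> 'o list \<Rightarrow> 'm" where
  "tens_append C [] Bs = lunitor C (tens_list C Bs)"
| "tens_append C (A # As) Bs =
     (Ide C A \<star>\<^bsub>C\<^esub> tens_append C As Bs) \<cdot>\<^bsub>C\<^esub> associator C A (tens_list C As) (tens_list C Bs)"

text \<open>The canonical isomorphism from \<open>tens_list C (map (tens_list C) Ass)\<close> to
  \<open>tens_list C (concat Ass)\<close>.\<close>

fun tens_concat :: "('o, 'm, 'z) smc_scheme \<Rightarrow> 'o list list \<Rightarrow> 'm" where
  "tens_concat C [] = Ide C (unit_obj C)"
| "tens_concat C (As # Ass) =
     tens_append C As (concat Ass) \<cdot>\<^bsub>C\<^esub> (Ide C (tens_list C As) \<star>\<^bsub>C\<^esub> tens_concat C Ass)"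

text \<open>The symmetry exchanging the factors in positions \<open>i\<close> and \<open>i + 1\<close> of a tensor power
  (used only for \<open>i + 1 < n\<close>).\<close>

fun swap_at :: "('o, 'm, 'z) smc_scheme \<Rightarrow> 'o \<Rightarrow> nat \<Rightarrow> nat \<Rightarrow> 'm" where
  "swap_at C A (Suc (Suc n)) 0 = associator C A A (tens_pow C A n) \<cdot>\<^bsub>C\<^esub>
     (symmetry C A A \<star>\<^bsub>C\<^esub> Ide C (tens_pow C A n)) \<cdot>\<^bsub>C\<^esub>
     inv_arr C (associator C A A (tens_pow C A n))"
| "swap_at C A (Suc n) (Suc i) = Ide C A \<star>\<^bsub>C\<^esub> swap_at C A n i"
| "swap_at C A n i = Ide C (tens_pow C A n)"

text \<open>\<open>perm_arr C A n \<sigma> f\<close>: \<open>f\<close> is the automorphism of the \<open>n\<close>-th tensor power of \<open>A\<close> moving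
  the factor in position \<open>i\<close> to position \<open>\<sigma> i\<close>, presented as a composite of adjacent
  symmetries. Every permutation of \<open>{..<n}\<close> has such a presentation, and by coherence \<open>f\<close> does
  not depend on it.\<close>

inductive perm_arr :: "('o, 'm, 'z) smc_scheme \<Rightarrow> 'o \<Rightarrow> nat \<Rightarrow> (nat \<Rightarrow> nat) \<Rightarrow> 'm \<Rightarrow> bool"
  for C A n where
  perm_arr_id: "perm_arr C A n id (Ide C (tens_pow C A n))"
| perm_arr_swap: "perm_arr C A n \<sigma> f \<Longrightarrow> Suc i < n \<Longrightarrow>
     perm_arr C A n (transpose i (Suc i) \<circ> \<sigma>) (swap_at C A n i \<cdot>\<^bsub>C\<^esub> f)"

text \<open>The tensor of a set \<open>X\<close> with an object \<open>A\<close> is an object representing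
  \<open>B \<mapsto> Set(X, C(A, B))\<close>; the representing bijection is given by the image of the identity,
  i.e. by maps \<open>A \<rightarrow> X \<otimes> A\<close> indexed by \<open>x \<in> X\<close>. Sets are the subsets of an arbitrary
  type \<open>'s\<close>.\<close>

record ('s, 'o, 'm) tensoring =
  set_tens :: "'s set \<Rightarrow> 'o \<Rightarrow> 'o"
  set_incl :: "'s set \<Rightarrow> 'o \<Rightarrow> 's \<Rightarrow> 'm"

locale tensored_over_Set = category C
  for C :: "('o, 'm, 'z) cat_scheme" (structure) +
  fixes T :: "('s, 'o, 'm) tensoring"
  assumes set_tens_in: "A \<in> Obj C \<Longrightarrow> set_tens T X A \<in> Obj C"
    and set_incl_in: "A \<in> Obj C \<Longrightarrow> x \<in> X \<Longrightarrow> set_incl T X A x \<in> Hom C A (set_tens T X A)"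
    and set_tens_universal: "A \<in> Obj C \<Longrightarrow> B \<in> Obj C \<Longrightarrow>
          bij_betw (\<lambda>h. \<lambda>x\<in>X. h \<cdot> set_incl T X A x)
            (Hom C (set_tens T X A) B) (X \<rightarrow>\<^sub>E Hom C A B)"

text \<open>Since the sets \<open>op_set P n\<close> need not be disjoint, the composition
  \<open>op_comp P ns x ys\<close> of \<open>x \<in> P(k)\<close> with \<open>ys ! i \<in> P(ns ! i)\<close> is told the arities \<open>ns\<close>,
  and \<open>k = length ns\<close>. The right action of \<open>\<sigma> \<in> \<Sigma>\<^sub>n\<close> on \<open>x \<in> P(n)\<close> is \<open>op_perm P n x \<sigma>\<close>, where
  \<open>\<Sigma>\<^sub>n\<close> acts on \<open>{..<n}\<close>.\<close>

record 's operad =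
  op_set :: "nat \<Rightarrow> 's set"
  op_unit :: "'s"
  op_comp :: "nat list \<Rightarrow> 's \<Rightarrow> 's list \<Rightarrow> 's"
  op_perm :: "nat \<Rightarrow> 's \<Rightarrow> (nat \<Rightarrow> nat) \<Rightarrow> 's"

text \<open>The operation \<open>A\<^sup>n \<rightarrow> A\<close> (tensor power) determined by \<open>x \<in> P(n)\<close> and the structure map
  \<open>\<theta> n : P(n) \<otimes> A\<^sup>n \<rightarrow> A\<close>.\<close>

definition op_act :: "('o, 'm, 'z) smc_scheme \<Rightarrow> ('s, 'o, 'm) tensoring \<Rightarrow> 's operad \<Rightarrow>
    'o \<Rightarrow> (nat \<Rightarrow> 'm) \<Rightarrow> nat \<Rightarrow> 's \<Rightarrow> 'm" where
  "op_act C T P A \<theta> n x = \<theta> n \<cdot>\<^bsub>C\<^esub> set_incl T (op_set P n) (tens_pow C A n) x"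

text \<open>All maps in the unit, associativity and equivariance diagrams of an algebra start from a
  tensor with a set, such as \<open>P(k) \<times> P(n\<^sub>1) \<times> \<dots> \<times> P(n\<^sub>k)\<close>. By the universal property
  it commutes iff it commutes after the inclusion of each element of that set, and it is stated
  in that form. The interchange of set tensors with the monoidal product used in the associativity
  diagram is the map sending the inclusion of \<open>(y\<^sub>1, \<dots>, y\<^sub>k)\<close> to the monoidal product of the
  inclusions of the \<open>y\<^sub>i\<close>; it need not be invertible.\<close>

definition is_algebra :: "('o, 'm, 'z) smc_scheme \<Rightarrow> ('s, 'o, 'm) tensoring \<Rightarrow> 's operad \<Rightarrow>
    'o \<times> (nat \<Rightarrow> 'm) \<Rightarrow> bool" where
  "is_algebra C T P = (\<lambda>(A, \<theta>). A \<in> Obj C \<and>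
     (\<forall>n. \<theta> n \<in> Hom C (set_tens T (op_set P n) (tens_pow C A n)) A) \<and>
     op_act C T P A \<theta> 1 (op_unit P) = runitor C A \<and>
     (\<forall>ns x ys. x \<in> op_set P (length ns) \<longrightarrow> list_all2 (\<lambda>n y. y \<in> op_set P n) ns ys \<longrightarrow>
        op_act C T P A \<theta> (sum_list ns) (op_comp P ns x ys) \<cdot>\<^bsub>C\<^esub>
            tens_concat C (map (\<lambda>n. replicate n A) ns)
        = op_act C T P A \<theta> (length ns) x \<cdot>\<^bsub>C\<^esub>
            tens_arr_list C (map2 (op_act C T P A \<theta>) ns ys)) \<and>
     (\<forall>n x \<sigma> f. x \<in> op_set P n \<longrightarrow> perm_arr C A n \<sigma> f \<longrightarrow>
        op_act C T P A \<theta> n (op_perm P n x \<sigma>) = op_act C T P A \<theta> n x \<cdot>\<^bsub>C\<^esub> f))"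

definition is_algebra_hom :: "('o, 'm, 'z) smc_scheme \<Rightarrow> ('s, 'o, 'm) tensoring \<Rightarrow> 's operad \<Rightarrow>
    'o \<times> (nat \<Rightarrow> 'm) \<Rightarrow> 'o \<times> (nat \<Rightarrow> 'm) \<Rightarrow> 'm \<Rightarrow> bool" where
  "is_algebra_hom C T P = (\<lambda>(A, \<theta>) (B, \<theta>') f. f \<in> Hom C A B \<and>
     (\<forall>n. \<forall>x\<in>op_set P n. f \<cdot>\<^bsub>C\<^esub> op_act C T P A \<theta> n x
        = op_act C T P B \<theta>' n x \<cdot>\<^bsub>C\<^esub> tens_arr_list C (replicate n f)))"

definition Alg :: "('o, 'm, 'z) smc_scheme \<Rightarrow> ('s, 'o, 'm) tensoring \<Rightarrow> 's operad \<Rightarrow>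
    ('o \<times> (nat \<Rightarrow> 'm), ('o \<times> (nat \<Rightarrow> 'm)) \<times> ('o \<times> (nat \<Rightarrow> 'm)) \<times> 'm) cat" where
  "Alg C T P = \<lparr>
     Obj = {X. is_algebra C T P X},
     Arr = {(X, Y, f). is_algebra C T P X \<and> is_algebra C T P Y \<and> is_algebra_hom C T P X Y f},
     Dom = (\<lambda>(X, Y, f). X),
     Cod = (\<lambda>(X, Y, f). Y),
     Ide = (\<lambda>X. (X, X, Ide C (fst X))),
     Comp = (\<lambda>(X1, Y1, f1) (X2, Y2, f2). (X2, Y1, f1 \<cdot>\<^bsub>C\<^esub> f2)) \<rparr>"

definition C2 :: "int monoid" where
  "C2 = \<lparr>carrier = {1, -1}, mult = (*), one = 1\<rparr>"

text \<open>\<open>(a, b) \<in> r\<close> means that \<open>a\<close> precedes or equals \<open>b\<close>. In the composition, the element in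
  position \<open>j\<close> of the \<open>i\<close>-th block \<open>{..<ns ! i}\<close> is numbered
  \<open>sum_list (take i ns) + j\<close>.\<close>

definition Assoc :: "(nat \<times> nat) set operad" where
  "Assoc = \<lparr>
     op_set = (\<lambda>n. {r. linear_order_on {..<n} r}),
     op_unit = {(0, 0)},
     op_comp = (\<lambda>ns r rs.
       {(sum_list (take i ns) + j, sum_list (take i' ns) + j') | i j i' j'.
          i < length ns \<and> j < ns ! i \<and> i' < length ns \<and> j' < ns ! i' \<and>
          (i \<noteq> i' \<and> (i, i') \<in> r \<or> i = i' \<and> (j, j') \<in> rs ! i)}),
     op_perm = (\<lambda>n r \<sigma>. {(a, b). a < n \<and> b < n \<and> (\<sigma> a, \<sigma> b) \<in> r}) \<rparr>"

definition reversal :: "int \<Rightarrow> (nat \<times> nat) set \<Rightarrow> (nat \<times> nat) set" where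
  "reversal c r = (if c = 1 then r else r\<inverse>)"

text \<open>\<open>G\<^sup>k\<close> is the set of lists of length \<open>k\<close> over \<open>carrier G\<close>; \<open>act\<close> is the action
  of \<open>G\<close> on \<open>P\<close>.\<close>

definition semidirect_operad :: "'s operad \<Rightarrow> ('g, 'y) monoid_scheme \<Rightarrow> ('g \<Rightarrow> 's \<Rightarrow> 's) \<Rightarrow>
    ('s \<times> 'g list) operad" where
  "semidirect_operad P G act = \<lparr>
     op_set = (\<lambda>k. op_set P k \<times> {gs. length gs = k \<and> set gs \<subseteq> carrier G}),
     op_unit = (op_unit P, [\<one>\<^bsub>G\<^esub>]),
     op_comp = (\<lambda>ns (x, gs) yhs.
       (op_comp P ns x (map2 (\<lambda>g (y, hs). act g y) gs yhs),
        concat (map2 (\<lambda>g (y, hs). map (\<lambda>h. g \<otimes>\<^bsub>G\<^esub> h) hs) gs yhs))),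
     op_perm = (\<lambda>k (x, gs) \<sigma>. (op_perm P k x \<sigma>, map (\<lambda>i. gs ! \<sigma> i) [0..<k])) \<rparr>"

definition Assoc_tw :: "('g, 'y) monoid_scheme \<Rightarrow> ('g \<Rightarrow> int) \<Rightarrow> ((nat \<times> nat) set \<times> 'g list) operad"
  where
  "Assoc_tw G \<phi> = semidirect_operad Assoc G (\<lambda>g. reversal (\<phi> g))"

text \<open>A monoid is a triple \<open>(M, \<mu>, \<eta>)\<close> of an object, a multiplication and a unit.\<close>

definition is_monoid :: "('o, 'm, 'z) smc_scheme \<Rightarrow> 'o \<times> 'm \<times> 'm \<Rightarrow> bool" where
  "is_monoid C = (\<lambda>(M, \<mu>, \<eta>). M \<in> Obj C \<and>
     \<mu> \<in> Hom C (M \<odot>\<^bsub>C\<^esub> M) M \<and> \<eta> \<in> Hom C (unit_obj C) M \<and>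
     \<mu> \<cdot>\<^bsub>C\<^esub> (\<mu> \<star>\<^bsub>C\<^esub> Ide C M) = \<mu> \<cdot>\<^bsub>C\<^esub> (Ide C M \<star>\<^bsub>C\<^esub> \<mu>) \<cdot>\<^bsub>C\<^esub> associator C M M M \<and>
     \<mu> \<cdot>\<^bsub>C\<^esub> (\<eta> \<star>\<^bsub>C\<^esub> Ide C M) = lunitor C M \<and>
     \<mu> \<cdot>\<^bsub>C\<^esub> (Ide C M \<star>\<^bsub>C\<^esub> \<eta>) = runitor C M)"

definition is_monoid_hom :: "('o, 'm, 'z) smc_scheme \<Rightarrow> 'o \<times> 'm \<times> 'm \<Rightarrow> 'o \<times> 'm \<times> 'm \<Rightarrow> 'm \<Rightarrow> bool"
  where
  "is_monoid_hom C = (\<lambda>(M, \<mu>, \<eta>) (M', \<mu>', \<eta>') f. f \<in> Hom C M M' \<and>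
     f \<cdot>\<^bsub>C\<^esub> \<mu> = \<mu>' \<cdot>\<^bsub>C\<^esub> (f \<star>\<^bsub>C\<^esub> f) \<and> f \<cdot>\<^bsub>C\<^esub> \<eta> = \<eta>')"

definition Mon :: "('o, 'm, 'z) smc_scheme \<Rightarrow>
    ('o \<times> 'm \<times> 'm, ('o \<times> 'm \<times> 'm) \<times> ('o \<times> 'm \<times> 'm) \<times> 'm) cat" where
  "Mon C = \<lparr>
     Obj = {M. is_monoid C M},
     Arr = {(M, N, f). is_monoid C M \<and> is_monoid C N \<and> is_monoid_hom C M N f},
     Dom = (\<lambda>(M, N, f). M),
     Cod = (\<lambda>(M, N, f). N),
     Ide = (\<lambda>M. (M, M, Ide C (fst M))),
     Comp = (\<lambda>(M1, N1, f1) (M2, N2, f2). (M2, N1, f1 \<cdot>\<^bsub>C\<^esub> f2)) \<rparr>"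

definition op_monoid :: "('o, 'm, 'z) smc_scheme \<Rightarrow> 'o \<times> 'm \<times> 'm \<Rightarrow> 'o \<times> 'm \<times> 'm" where
  "op_monoid C = (\<lambda>(M, \<mu>, \<eta>). (M, \<mu> \<cdot>\<^bsub>C\<^esub> symmetry C M M, \<eta>))"

definition Mon_C2_action :: "('o, 'm, 'z) smc_scheme \<Rightarrow> int \<Rightarrow>
    ('o \<times> 'm \<times> 'm, ('o \<times> 'm \<times> 'm) \<times> ('o \<times> 'm \<times> 'm) \<times> 'm,
     'o \<times> 'm \<times> 'm, ('o \<times> 'm \<times> 'm) \<times> ('o \<times> 'm \<times> 'm) \<times> 'm) func" where
  "Mon_C2_action C c = \<lparr>
     fob = (\<lambda>M\<in>Obj (Mon C). if c = 1 then M else op_monoid C M),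
     far = (\<lambda>(M, N, f)\<in>Arr (Mon C). if c = 1 then (M, N, f) else (op_monoid C M, op_monoid C N, f)) \<rparr>"

text \<open>A morphism \<open>(f, g)\<close> from \<open>C\<^sub>0\<close> to \<open>C\<^sub>1\<close> has \<open>f : g C\<^sub>0 \<rightarrow> C\<^sub>1\<close>, so \<open>C\<^sub>0\<close> is recovered by
  applying the inverse of \<open>g\<close> to the domain of \<open>f\<close>.\<close>

definition semidirect_C2 :: "('o, 'm, 'z) cat_scheme \<Rightarrow> (int \<Rightarrow> ('o, 'm, 'o, 'm) func) \<Rightarrow>
    ('o, 'm \<times> int) cat" where
  "semidirect_C2 D act = \<lparr>
     Obj = Obj D,
     Arr = Arr D \<times> carrier C2,
     Dom = (\<lambda>(f, g). fob (act (inv\<^bsub>C2\<^esub> g)) (Dom D f)),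
     Cod = (\<lambda>(f, g). Cod D f),
     Ide = (\<lambda>X. (Ide D X, \<one>\<^bsub>C2\<^esub>)),
     Comp = (\<lambda>(f1, g1) (f2, g2). (f1 \<cdot>\<^bsub>D\<^esub> far (act g1) f2, g1 \<otimes>\<^bsub>C2\<^esub> g2)) \<rparr>"

definition deloop :: "('g, 'y) monoid_scheme \<Rightarrow> (unit, 'g) cat" where
  "deloop G = \<lparr> Obj = {()}, Arr = carrier G, Dom = (\<lambda>_. ()), Cod = (\<lambda>_. ()),
     Ide = (\<lambda>_. \<one>\<^bsub>G\<^esub>), Comp = (\<lambda>g h. g \<otimes>\<^bsub>G\<^esub> h) \<rparr>"

definition deloop_hom :: "('g, 'y) monoid_scheme \<Rightarrow> ('g \<Rightarrow> 'h) \<Rightarrow> (unit, 'g, unit, 'h) func" where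
  "deloop_hom G \<phi> = \<lparr> fob = (\<lambda>_\<in>{()}. ()), far = restrict \<phi> (carrier G) \<rparr>"

definition semidirect_proj :: "('o, 'm, 'z) cat_scheme \<Rightarrow> (int \<Rightarrow> ('o, 'm, 'o, 'm) func) \<Rightarrow>
    ('o, 'm \<times> int, unit, int) func" where
  "semidirect_proj D act = \<lparr>
     fob = (\<lambda>_\<in>Obj (semidirect_C2 D act). ()),
     far = restrict snd (Arr (semidirect_C2 D act)) \<rparr>"

definition Mon_tw :: "('o, 'm, 'z) smc_scheme \<Rightarrow> ('g, 'y) monoid_scheme \<Rightarrow> ('g \<Rightarrow> int) \<Rightarrow>
    ((unit, 'g, 'o \<times> 'm \<times> 'm, (('o \<times> 'm \<times> 'm) \<times> ('o \<times> 'm \<times> 'm) \<times> 'm) \<times> int) func,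
     (unit, 'g, 'o \<times> 'm \<times> 'm, (('o \<times> 'm \<times> 'm) \<times> ('o \<times> 'm \<times> 'm) \<times> 'm) \<times> int) func \<times>
     (unit, 'g, 'o \<times> 'm \<times> 'm, (('o \<times> 'm \<times> 'm) \<times> ('o \<times> 'm \<times> 'm) \<times> 'm) \<times> int) func \<times>
     (unit \<Rightarrow> (('o \<times> 'm \<times> 'm) \<times> ('o \<times> 'm \<times> 'm) \<times> 'm) \<times> int)) cat" where
  "Mon_tw C G \<phi> = functor_category_over
     (deloop G) (semidirect_C2 (Mon C) (Mon_C2_action C)) (deloop C2)
     (deloop_hom G \<phi>) (semidirect_proj (Mon C) (Mon_C2_action C))"

end

theory Submission
  imports Defs
begin

text \<open>
  By the universal property of the set tensors, an algebra over \<open>Assoc\<^sup>\<phi>\<close> is an object \<open>A\<close> with an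
  operation \<open>A\<^sup>n \<rightarrow> A\<close> for each linear order on \<open>n\<close> letters decorated with elements of \<open>G\<close>. A
  monoid with twisted action gives such operations: let the decorations act on the factors, permute the
  factors into the given order and multiply. This is equivariant because the symmetries of a tensor
  power depend only on the underlying permutation, and compatible with operadic composition because
  permuting blocks is natural in the operations applied to the blocks; an odd element reverses the order
  of multiplication, just as it reverses the orders in \<open>Assoc\<^sup>\<phi>\<close>. Conversely, \<open>Assoc\<^sup>\<phi>\<close> is generated by
  its nullary operation, the standard binary order, and the unary operations \<open>G\<close>, so an algebra is
  determined by the multiplication, the unit and the action that it restricts to.

  Coherence is proved in the following form. The factors of \<open>A\<^sup>n\<close> carry distinct labels, and the
  arrow \<open>can A xs ys\<close> rearranges them from the order \<open>xs\<close> to the order \<open>ys\<close> by insertion. Since the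
  symmetries satisfy the Yang--Baxter equation, composing with an adjacent transposition changes
  \<open>can A xs ys\<close> as it should, and all other properties follow by writing a permutation as a product
  of adjacent transpositions.
\<close>

section \<open>Categories and symmetric monoidal categories\<close>

text \<open>All factors of a tensor power are the same object, so an arrow between tensor powers
  does not show which permutation it realises. Labels supply that, and \<open>can\<close> is
  unchanged when they are renamed. Hence the factors of a composite operation can carry global
  labels \<open>0..<N\<close>, with block \<open>i\<close> an interval of them.

  Two conventions leave traces everywhere. Iterated tensor products end in the unit object, so a
  unary operation starts at \<open>A \<odot> \<I>\<close>, and multiplication and action are read
  off an algebra after composing with inverse right unitors. Products of tensor powers are
  rebracketed by \<open>tens_concat\<close>; since this is invertible, the associativity axiom can
  be rewritten with \<open>blocks\<close>, which starts at the flat tensor power, and the main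
  computation is free of rebracketing.

  The categories are isomorphic and not merely equivalent because a structure map is determined by
  its values on the elements of the operad, while the functor keeps underlying objects and arrows;
  bijectivity on objects and on arrows is then enough.\<close>

context category
begin

lemma mem_Hom: "f \<in> Hom C A B \<longleftrightarrow> f \<in> Arr C \<and> Dom C f = A \<and> Cod C f = B"
  by (simp add: Hom_def)

lemma Dom_Obj [simp]: "f \<in> Arr C \<Longrightarrow> Dom C f \<in> Obj C"
  by (rule Dom_in)

lemma Cod_Obj [simp]: "f \<in> Arr C \<Longrightarrow> Cod C f \<in> Obj C"
  by (rule Cod_in)

lemma Ide_simps [simp]:
  "A \<in> Obj C \<Longrightarrow> Ide C A \<in> Arr C"
  "A \<in> Obj C \<Longrightarrow> Dom C (Ide C A) = A"
  "A \<in> Obj C \<Longrightarrow> Cod C (Ide C A) = A"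
  using Ide_in[of A] by (simp_all add: mem_Hom)

lemma Comp_simps [simp]:
  assumes "f \<in> Arr C" "g \<in> Arr C" "Dom C g = Cod C f"
  shows "g \<cdot> f \<in> Arr C" "Dom C (g \<cdot> f) = Dom C f" "Cod C (g \<cdot> f) = Cod C g"
  using Comp_in[of f "Dom C f" "Cod C f" g "Cod C g"] assms by (simp_all add: mem_Hom)

lemma Comp_Ide_left [simp]: "f \<in> Arr C \<Longrightarrow> Cod C f = A \<Longrightarrow> Ide C A \<cdot> f = f"
  using Ide_left[of f "Dom C f" A] by (simp add: mem_Hom)

lemma Comp_Ide_right [simp]: "f \<in> Arr C \<Longrightarrow> Dom C f = A \<Longrightarrow> f \<cdot> Ide C A = f"
  using Ide_right[of f A "Cod C f"] by (simp add: mem_Hom)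

lemma Comp_assoc_right [simp]:
  "f \<in> Arr C \<Longrightarrow> g \<in> Arr C \<Longrightarrow> h \<in> Arr C \<Longrightarrow> Dom C g = Cod C f \<Longrightarrow> Dom C h = Cod C g \<Longrightarrow>
     (h \<cdot> g) \<cdot> f = h \<cdot> (g \<cdot> f)"
  using Comp_assoc[of f "Dom C f" "Cod C f" g "Cod C g" h "Cod C h"] by (simp add: mem_Hom)

lemma inverse_arrows_unique:
  assumes "inverse_arrows C f g" "inverse_arrows C f h"
  shows "g = h"
proof -
  have *: "f \<in> Arr C" "g \<in> Arr C" "h \<in> Arr C" "Dom C g = Cod C f" "Cod C g = Dom C f"
    "Dom C h = Cod C f" "Cod C h = Dom C f" "g \<cdot> f = Ide C (Dom C f)" "f \<cdot> h = Ide C (Cod C f)"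
    using assms by (auto simp: inverse_arrows_def mem_Hom)
  have "g = g \<cdot> (f \<cdot> h)" using * by simp
  also have "\<dots> = (g \<cdot> f) \<cdot> h" using *(1-7) by simp
  also have "\<dots> = h" using * by simp
  finally show ?thesis .
qed

lemma inverse_arrows_inv_arr: "iso_arr C f \<Longrightarrow> inverse_arrows C f (inv_arr C f)"
  unfolding iso_arr_def inv_arr_def using inverse_arrows_unique by (metis theI)

lemma iso_arr_Arr [simp]: "iso_arr C f \<Longrightarrow> f \<in> Arr C"
  by (auto simp: iso_arr_def inverse_arrows_def)

lemma inv_arr_simps [simp]:
  assumes "iso_arr C f"
  shows "inv_arr C f \<in> Arr C" "Dom C (inv_arr C f) = Cod C f" "Cod C (inv_arr C f) = Dom C f"
    "inv_arr C f \<cdot> f = Ide C (Dom C f)" "f \<cdot> inv_arr C f = Ide C (Cod C f)"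
  using inverse_arrows_inv_arr[OF assms] by (auto simp: inverse_arrows_def mem_Hom)

lemma inv_arr_cancel [simp]:
  assumes "iso_arr C f" "g \<in> Arr C"
  shows "Cod C g = Dom C f \<Longrightarrow> inv_arr C f \<cdot> (f \<cdot> g) = g"
    "Cod C g = Cod C f \<Longrightarrow> f \<cdot> (inv_arr C f \<cdot> g) = g"
  using assms by (simp_all flip: Comp_assoc_right)

lemma iso_arrI:
  assumes "f \<in> Arr C" "g \<in> Arr C" "Dom C g = Cod C f" "Cod C g = Dom C f"
    "g \<cdot> f = Ide C (Dom C f)" "f \<cdot> g = Ide C (Cod C f)"
  shows "iso_arr C f" "inv_arr C f = g"
proof -
  have *: "inverse_arrows C f g" using assms by (auto simp: inverse_arrows_def mem_Hom)
  then show "iso_arr C f" by (auto simp: iso_arr_def)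
  then show "inv_arr C f = g" using * inverse_arrows_unique inverse_arrows_inv_arr by blast
qed

lemma iso_arr_inv_arr [simp]: "iso_arr C f \<Longrightarrow> iso_arr C (inv_arr C f)"
  by (rule iso_arrI(1)[of _ f]) simp_all

lemma iso_arr_Ide [simp]: "A \<in> Obj C \<Longrightarrow> iso_arr C (Ide C A)"
  by (rule iso_arrI(1)[of _ "Ide C A"]) simp_all

lemma iso_arr_Comp [simp]:
  "iso_arr C f \<Longrightarrow> iso_arr C g \<Longrightarrow> Dom C g = Cod C f \<Longrightarrow> iso_arr C (g \<cdot> f)"
  by (rule iso_arrI(1)[of _ "inv_arr C f \<cdot> inv_arr C g"]) simp_all

text \<open>Naturality and the coherence axioms apply to composites with associators and unitors.
  Two arrows are therefore compared below after composing with such an isomorphism, which is then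
  cancelled.\<close>

lemma cancel_epi:
  assumes "iso_arr C f" "g \<cdot> f = h \<cdot> f" "g \<in> Arr C" "h \<in> Arr C" "Dom C g = Cod C f"
    "Dom C h = Cod C f"
  shows "g = h"
proof -
  have "g = (g \<cdot> f) \<cdot> inv_arr C f" using assms(1,3,5) by simp
  also have "\<dots> = (h \<cdot> f) \<cdot> inv_arr C f" by (simp only: assms(2))
  also have "\<dots> = h" using assms(1,4,6) by simp
  finally show ?thesis .
qed

lemma cancel_mono:
  assumes "iso_arr C f" "f \<cdot> g = f \<cdot> h" "g \<in> Arr C" "h \<in> Arr C" "Dom C f = Cod C g"
    "Dom C f = Cod C h"
  shows "g = h"
proof -
  have "g = inv_arr C f \<cdot> (f \<cdot> g)" using assms(1,3,5) by simp
  also have "\<dots> = inv_arr C f \<cdot> (f \<cdot> h)" by (simp only: assms(2))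
  also have "\<dots> = h" using assms(1,4,6) by simp
  finally show ?thesis .
qed

text \<open>Composites are normalised to be bracketed to the right, so an equation for
  \<open>g \<cdot> f\<close> has to be carried to the head of a longer composite before it can be
  applied there.\<close>

lemma Comp2_ext:
  assumes "g \<cdot> f = r" "f \<in> Arr C" "g \<in> Arr C" "x \<in> Arr C" "Dom C g = Cod C f" "Dom C f = Cod C x"
  shows "g \<cdot> (f \<cdot> x) = r \<cdot> x"
  using assms(2-) by (simp flip: assms(1))

lemma Comp3_ext:
  assumes "g \<cdot> (f \<cdot> e) = r" "e \<in> Arr C" "f \<in> Arr C" "g \<in> Arr C" "x \<in> Arr C"
    "Dom C g = Cod C f" "Dom C f = Cod C e" "Dom C e = Cod C x"
  shows "g \<cdot> (f \<cdot> (e \<cdot> x)) = r \<cdot> x"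
  using assms(2-) by (simp flip: assms(1))

end

context symmetric_monoidal_category
begin

abbreviation unit_object ("\<I>") where "\<I> \<equiv> unit_obj C"
abbreviation ide where "ide \<equiv> Ide C"
abbreviation \<alpha> where "\<alpha> \<equiv> associator C"
abbreviation \<alpha>' where "\<alpha>' A B D \<equiv> inv_arr C (associator C A B D)"
abbreviation lun where "lun \<equiv> lunitor C"
abbreviation run where "run \<equiv> runitor C"
abbreviation sym where "sym \<equiv> symmetry C"

lemma unit_Obj [simp]: "\<I> \<in> Obj C"
  by (rule unit_in)

lemma tens_Obj [simp]: "A \<in> Obj C \<Longrightarrow> B \<in> Obj C \<Longrightarrow> A \<odot> B \<in> Obj C"
  by (rule tens_obj_in)

lemma tens_simps [simp]:
  assumes "f \<in> Arr C" "g \<in> Arr C"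
  shows "f \<star> g \<in> Arr C" "Dom C (f \<star> g) = Dom C f \<odot> Dom C g" "Cod C (f \<star> g) = Cod C f \<odot> Cod C g"
  using tens_arr_in[of f "Dom C f" "Cod C f" g "Dom C g" "Cod C g"] assms by (simp_all add: mem_Hom)

lemma tens_Ide_Ide [simp]: "A \<in> Obj C \<Longrightarrow> B \<in> Obj C \<Longrightarrow> ide A \<star> ide B = ide (A \<odot> B)"
  by (rule tens_Ide)

lemma interchange:
  assumes "f \<in> Arr C" "f' \<in> Arr C" "g \<in> Arr C" "g' \<in> Arr C" "Dom C f' = Cod C f"
    "Dom C g' = Cod C g"
  shows "(f' \<star> g') \<cdot> (f \<star> g) = (f' \<cdot> f) \<star> (g' \<cdot> g)"
  using tens_Comp[of f "Dom C f" "Cod C f" f' "Cod C f'" g "Dom C g" "Cod C g" g' "Cod C g'"] assms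
  by (simp add: mem_Hom)

lemma whisker_Comp [simp]:
  assumes "A \<in> Obj C" "f \<in> Arr C" "f' \<in> Arr C" "Dom C f' = Cod C f"
  shows "ide A \<star> (f' \<cdot> f) = (ide A \<star> f') \<cdot> (ide A \<star> f)"
    "(f' \<cdot> f) \<star> ide A = (f' \<star> ide A) \<cdot> (f \<star> ide A)"
  using assms by (simp_all add: interchange)

lemma tens_split:
  assumes "f \<in> Arr C" "g \<in> Arr C" "A = Cod C f" "B = Dom C g"
  shows "(ide A \<star> g) \<cdot> (f \<star> ide B) = f \<star> g"
  using assms by (simp add: interchange)

lemma whisker_commute:
  assumes "f \<in> Arr C" "g \<in> Arr C" "A = Dom C f" "B = Cod C g" "A' = Cod C f" "B' = Dom C g"
  shows "(f \<star> ide B) \<cdot> (ide A \<star> g) = (ide A' \<star> g) \<cdot> (f \<star> ide B')"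
  using assms by (simp add: interchange)

lemma iso_arr_tens [simp]:
  "iso_arr C f \<Longrightarrow> iso_arr C g \<Longrightarrow> iso_arr C (f \<star> g)"
  by (rule iso_arrI(1)[of _ "inv_arr C f \<star> inv_arr C g"]) (simp_all add: interchange)

lemma associator_simps [simp]:
  assumes "A \<in> Obj C" "B \<in> Obj C" "D \<in> Obj C"
  shows "\<alpha> A B D \<in> Arr C" "Dom C (\<alpha> A B D) = (A \<odot> B) \<odot> D" "Cod C (\<alpha> A B D) = A \<odot> (B \<odot> D)"
    "iso_arr C (\<alpha> A B D)"
  using associator_in[OF assms] associator_iso[OF assms] by (simp_all add: mem_Hom)

lemma unitor_simps [simp]:
  assumes "A \<in> Obj C"
  shows "lun A \<in> Arr C" "Dom C (lun A) = \<I> \<odot> A" "Cod C (lun A) = A" "iso_arr C (lun A)"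
    "run A \<in> Arr C" "Dom C (run A) = A \<odot> \<I>" "Cod C (run A) = A" "iso_arr C (run A)"
  using lunitor_in[OF assms] lunitor_iso[OF assms] runitor_in[OF assms] runitor_iso[OF assms]
  by (simp_all add: mem_Hom)

lemma symmetry_simps [simp]:
  assumes "A \<in> Obj C" "B \<in> Obj C"
  shows "sym A B \<in> Arr C" "Dom C (sym A B) = A \<odot> B" "Cod C (sym A B) = B \<odot> A"
    "sym B A \<cdot> sym A B = ide (A \<odot> B)" "iso_arr C (sym A B)" "inv_arr C (sym A B) = sym B A"
proof -
  show *: "sym A B \<in> Arr C" "Dom C (sym A B) = A \<odot> B" "Cod C (sym A B) = B \<odot> A"
    using symmetry_in[OF assms] by (simp_all add: mem_Hom)
  have **: "sym B A \<in> Arr C" "Dom C (sym B A) = B \<odot> A" "Cod C (sym B A) = A \<odot> B"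
    using symmetry_in[OF assms(2,1)] by (simp_all add: mem_Hom)
  show s: "sym B A \<cdot> sym A B = ide (A \<odot> B)" using symmetry_inv[OF assms] .
  have s': "sym A B \<cdot> sym B A = ide (B \<odot> A)" using symmetry_inv[OF assms(2,1)] .
  show "iso_arr C (sym A B)" "inv_arr C (sym A B) = sym B A"
    by (rule iso_arrI[of _ "sym B A"]; use * ** s s' in simp)+
qed

lemma associator_natural:
  assumes "f \<in> Arr C" "g \<in> Arr C" "h \<in> Arr C"
  shows "\<alpha> (Cod C f) (Cod C g) (Cod C h) \<cdot> ((f \<star> g) \<star> h)
    = (f \<star> (g \<star> h)) \<cdot> \<alpha> (Dom C f) (Dom C g) (Dom C h)"
  using associator_nat[of f "Dom C f" "Cod C f" g "Dom C g" "Cod C g" h "Dom C h" "Cod C h"] assms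
  by (simp add: mem_Hom)

lemma lunitor_natural: "f \<in> Arr C \<Longrightarrow> lun (Cod C f) \<cdot> (ide \<I> \<star> f) = f \<cdot> lun (Dom C f)"
  using lunitor_nat[of f "Dom C f" "Cod C f"] by (simp add: mem_Hom)

lemma runitor_natural: "f \<in> Arr C \<Longrightarrow> run (Cod C f) \<cdot> (f \<star> ide \<I>) = f \<cdot> run (Dom C f)"
  using runitor_nat[of f "Dom C f" "Cod C f"] by (simp add: mem_Hom)

lemma symmetry_natural:
  "f \<in> Arr C \<Longrightarrow> g \<in> Arr C \<Longrightarrow>
    sym (Cod C f) (Cod C g) \<cdot> (f \<star> g) = (g \<star> f) \<cdot> sym (Dom C f) (Dom C g)"
  using symmetry_nat[of f "Dom C f" "Cod C f" g "Dom C g" "Cod C g"] by (simp add: mem_Hom)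

section \<open>Coherence of the unit object\<close>

lemma unit_tens_faithful:
  assumes "ide \<I> \<star> f = ide \<I> \<star> g" "f \<in> Arr C" "g \<in> Arr C" "Dom C f = Dom C g" "Cod C f = Cod C g"
  shows "f = g"
proof (rule cancel_epi)
  show "f \<cdot> lun (Dom C f) = g \<cdot> lun (Dom C f)"
    using lunitor_natural[of f] lunitor_natural[of g] assms by simp
qed (use assms in simp_all)

lemma tens_unit_faithful:
  assumes "f \<star> ide \<I> = g \<star> ide \<I>" "f \<in> Arr C" "g \<in> Arr C" "Dom C f = Dom C g" "Cod C f = Cod C g"
  shows "f = g"
proof (rule cancel_epi)
  show "f \<cdot> run (Dom C f) = g \<cdot> run (Dom C f)"
    using runitor_natural[of f] runitor_natural[of g] assms by simp
qed (use assms in simp_all)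

lemma pentagon':
  assumes "A \<in> Obj C" "B \<in> Obj C" "D \<in> Obj C" "E \<in> Obj C"
  shows "(ide A \<star> \<alpha> B D E) \<cdot> (\<alpha> A (B \<odot> D) E \<cdot> (\<alpha> A B D \<star> ide E)) = \<alpha> A B (D \<odot> E) \<cdot> \<alpha> (A \<odot> B) D E"
  using pentagon[OF assms] assms by simp

text \<open>Tensoring with the unit is faithful, so the identity may be checked after tensoring with
  \<open>\<I>\<close> on the left. There it follows from the pentagon for \<open>\<I>\<close>,
  \<open>\<I>\<close>, \<open>X\<close>, \<open>Y\<close> and two triangles.\<close>

lemma lunitor_tens:
  assumes X: "X \<in> Obj C" and Y: "Y \<in> Obj C"
  shows "lun (X \<odot> Y) \<cdot> \<alpha> \<I> X Y = lun X \<star> ide Y"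
proof (rule unit_tens_faithful)
  note [simp] = X Y
  let ?e = "\<alpha> \<I> (\<I> \<odot> X) Y \<cdot> (\<alpha> \<I> \<I> X \<star> ide Y)"
  have "(ide \<I> \<star> (lun (X \<odot> Y) \<cdot> \<alpha> \<I> X Y)) \<cdot> ?e
      = (ide \<I> \<star> lun (X \<odot> Y)) \<cdot> (\<alpha> \<I> \<I> (X \<odot> Y) \<cdot> \<alpha> (\<I> \<odot> \<I>) X Y)"
    using pentagon'[of \<I> \<I> X Y] by simp
  also have "\<dots> = (run \<I> \<star> ide (X \<odot> Y)) \<cdot> \<alpha> (\<I> \<odot> \<I>) X Y"
    using Comp2_ext[OF triangle[of \<I> "X \<odot> Y"]] by simp
  also have "\<dots> = \<alpha> \<I> X Y \<cdot> ((run \<I> \<star> ide X) \<star> ide Y)"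
    using associator_natural[of "run \<I>" "ide X" "ide Y"] by simp
  also have "\<dots> = \<alpha> \<I> X Y \<cdot> (((ide \<I> \<star> lun X) \<star> ide Y) \<cdot> (\<alpha> \<I> \<I> X \<star> ide Y))"
    using triangle[of \<I> X] by (simp flip: whisker_Comp)
  also have "\<dots> = (ide \<I> \<star> (lun X \<star> ide Y)) \<cdot> ?e"
    using Comp2_ext[OF associator_natural[of "ide \<I>" "lun X" "ide Y"]] by simp
  finally show "ide \<I> \<star> (lun (X \<odot> Y) \<cdot> \<alpha> \<I> X Y) = ide \<I> \<star> (lun X \<star> ide Y)"
    by (rule cancel_epi[rotated]) simp_all
qed (use assms in simp_all)

text \<open>The mirror image: tensor with \<open>\<I>\<close> on the right and use the pentagon for
  \<open>X\<close>, \<open>Y\<close>, \<open>\<I>\<close>, \<open>\<I>\<close> with the triangles at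
  \<open>Y\<close> and at \<open>X \<odot> Y\<close>.\<close>

lemma runitor_tens:
  assumes X: "X \<in> Obj C" and Y: "Y \<in> Obj C"
  shows "(ide X \<star> run Y) \<cdot> \<alpha> X Y \<I> = run (X \<odot> Y)"
proof (rule tens_unit_faithful)
  note [simp] = X Y
  have "\<alpha> X Y \<I> \<cdot> (((ide X \<star> run Y) \<cdot> \<alpha> X Y \<I>) \<star> ide \<I>)
      = (ide X \<star> (run Y \<star> ide \<I>)) \<cdot> (\<alpha> X (Y \<odot> \<I>) \<I> \<cdot> (\<alpha> X Y \<I> \<star> ide \<I>))"
    using Comp2_ext[OF associator_natural[of "ide X" "run Y" "ide \<I>"]] by simp
  also have "\<dots> = (ide X \<star> (ide Y \<star> lun \<I>))
      \<cdot> ((ide X \<star> \<alpha> Y \<I> \<I>) \<cdot> (\<alpha> X (Y \<odot> \<I>) \<I> \<cdot> (\<alpha> X Y \<I> \<star> ide \<I>)))"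
    by (simp flip: triangle)
  also have "\<dots> = (ide X \<star> (ide Y \<star> lun \<I>)) \<cdot> (\<alpha> X Y (\<I> \<odot> \<I>) \<cdot> \<alpha> (X \<odot> Y) \<I> \<I>)"
    using pentagon'[of X Y \<I> \<I>] by simp
  also have "\<dots> = \<alpha> X Y \<I> \<cdot> ((ide (X \<odot> Y) \<star> lun \<I>) \<cdot> \<alpha> (X \<odot> Y) \<I> \<I>)"
    using Comp2_ext[OF associator_natural[of "ide X" "ide Y" "lun \<I>", symmetric]] by simp
  also have "\<dots> = \<alpha> X Y \<I> \<cdot> (run (X \<odot> Y) \<star> ide \<I>)"
    using triangle[of "X \<odot> Y" \<I>] by simp
  finally show "((ide X \<star> run Y) \<cdot> \<alpha> X Y \<I>) \<star> ide \<I> = run (X \<odot> Y) \<star> ide \<I>"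
    by (rule cancel_mono[rotated]) simp_all
qed (use assms in simp_all)

text \<open>Naturality of \<open>lun\<close> at \<open>lun \<I>\<close> identifies
  \<open>ide \<I> \<star> lun \<I>\<close> with \<open>lun (\<I> \<odot> \<I>)\<close>. Then
  \<open>lunitor_tens\<close> and the triangle evaluate the same composite, once as each side
  tensored with the unit.\<close>

lemma lunitor_unit: "lun \<I> = run \<I>"
proof (rule tens_unit_faithful)
  have "lun \<I> \<cdot> (ide \<I> \<star> lun \<I>) = lun \<I> \<cdot> lun (\<I> \<odot> \<I>)"
    using lunitor_natural[of "lun \<I>"] by simp
  then have "ide \<I> \<star> lun \<I> = lun (\<I> \<odot> \<I>)"
    by (rule cancel_mono[rotated]) simp_all
  then show "lun \<I> \<star> ide \<I> = run \<I> \<star> ide \<I>"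
    using lunitor_tens[of \<I> \<I>] triangle[of \<I> \<I>] by simp
qed simp_all

lemma hexagon':
  assumes "A \<in> Obj C" "B \<in> Obj C" "D \<in> Obj C"
  shows "\<alpha> B D A \<cdot> (sym A (B \<odot> D) \<cdot> \<alpha> A B D)
    = (ide B \<star> sym A D) \<cdot> (\<alpha> B A D \<cdot> (sym A B \<star> ide D))"
  using hexagon[OF assms] assms by simp

text \<open>The hexagon for \<open>A\<close>, \<open>\<I>\<close>, \<open>\<I>\<close> with the
  units absorbed; the invertible \<open>sym A \<I>\<close> is carried along on the left and
  cancelled at the end.\<close>

lemma lunitor_symmetry:
  assumes A [simp]: "A \<in> Obj C"
  shows "lun A \<cdot> sym A \<I> = run A"
proof (rule tens_unit_faithful)
  have "sym A \<I> \<cdot> ((lun A \<cdot> sym A \<I>) \<star> ide \<I>)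
      = sym A \<I> \<cdot> (lun (A \<odot> \<I>) \<cdot> (\<alpha> \<I> A \<I> \<cdot> (sym A \<I> \<star> ide \<I>)))"
    using Comp2_ext[OF lunitor_tens[of A \<I>]] by simp
  also have "\<dots> = lun (\<I> \<odot> A) \<cdot> ((ide \<I> \<star> sym A \<I>) \<cdot> (\<alpha> \<I> A \<I> \<cdot> (sym A \<I> \<star> ide \<I>)))"
    using Comp2_ext[OF lunitor_natural[of "sym A \<I>"]] by simp
  also have "\<dots> = lun (\<I> \<odot> A) \<cdot> (\<alpha> \<I> \<I> A \<cdot> (sym A (\<I> \<odot> \<I>) \<cdot> \<alpha> A \<I> \<I>))"
    using hexagon'[of A \<I> \<I>] by simp
  also have "\<dots> = (lun \<I> \<star> ide A) \<cdot> (sym A (\<I> \<odot> \<I>) \<cdot> \<alpha> A \<I> \<I>)"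
    using Comp2_ext[OF lunitor_tens[of \<I> A]] by simp
  also have "\<dots> = sym A \<I> \<cdot> ((ide A \<star> lun \<I>) \<cdot> \<alpha> A \<I> \<I>)"
    using Comp2_ext[OF symmetry_natural[of "ide A" "lun \<I>"]] by simp
  also have "\<dots> = sym A \<I> \<cdot> (run A \<star> ide \<I>)"
    using triangle[of A \<I>] by simp
  finally show "(lun A \<cdot> sym A \<I>) \<star> ide \<I> = run A \<star> ide \<I>"
    by (rule cancel_mono[rotated]) simp_all
qed simp_all

section \<open>The symmetry on products bracketed to the right\<close>

definition sw :: "'o \<Rightarrow> 'o \<Rightarrow> 'o \<Rightarrow> 'm" where
  "sw A B X = \<alpha> B A X \<cdot> ((sym A B \<star> ide X) \<cdot> \<alpha>' A B X)"

context
  fixes A B X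
  assumes Obj [simp]: "A \<in> Obj C" "B \<in> Obj C" "X \<in> Obj C"
begin

lemma sw_simps [simp]:
  "sw A B X \<in> Arr C" "Dom C (sw A B X) = A \<odot> (B \<odot> X)" "Cod C (sw A B X) = B \<odot> (A \<odot> X)"
  "iso_arr C (sw A B X)"
  by (simp_all add: sw_def)

lemma sw_associator: "sw A B X \<cdot> \<alpha> A B X = \<alpha> B A X \<cdot> (sym A B \<star> ide X)"
  by (simp add: sw_def)

lemma sw_sw [simp]: "sw B A X \<cdot> sw A B X = ide (A \<odot> (B \<odot> X))"
proof -
  have "(sym B A \<star> ide X) \<cdot> (sym A B \<star> ide X) = ide ((A \<odot> B) \<odot> X)"
    by (simp flip: whisker_Comp)
  from Comp2_ext[OF this] show ?thesis by (simp add: sw_def)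
qed

end

lemma sw_natural:
  assumes [simp]: "f \<in> Arr C" "g \<in> Arr C" "h \<in> Arr C"
  shows "sw (Cod C f) (Cod C g) (Cod C h) \<cdot> (f \<star> (g \<star> h))
      = (g \<star> (f \<star> h)) \<cdot> sw (Dom C f) (Dom C g) (Dom C h)"
proof (rule cancel_epi)
  show "iso_arr C (\<alpha> (Dom C f) (Dom C g) (Dom C h))" by simp
  have "sw (Cod C f) (Cod C g) (Cod C h) \<cdot> ((f \<star> (g \<star> h)) \<cdot> \<alpha> (Dom C f) (Dom C g) (Dom C h))
      = sw (Cod C f) (Cod C g) (Cod C h) \<cdot> (\<alpha> (Cod C f) (Cod C g) (Cod C h) \<cdot> ((f \<star> g) \<star> h))"
    by (simp add: associator_natural)
  also have "\<dots> = \<alpha> (Cod C g) (Cod C f) (Cod C h)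
      \<cdot> ((sym (Cod C f) (Cod C g) \<star> ide (Cod C h)) \<cdot> ((f \<star> g) \<star> h))"
    by (simp add: Comp2_ext[OF sw_associator])
  also have "\<dots> = \<alpha> (Cod C g) (Cod C f) (Cod C h)
      \<cdot> (((g \<star> f) \<star> h) \<cdot> (sym (Dom C f) (Dom C g) \<star> ide (Dom C h)))"
    by (simp add: interchange symmetry_natural)
  also have "\<dots> = (g \<star> (f \<star> h))
      \<cdot> (sw (Dom C f) (Dom C g) (Dom C h) \<cdot> \<alpha> (Dom C f) (Dom C g) (Dom C h))"
    using Comp2_ext[OF associator_natural[of g f h]] by (simp add: sw_associator)
  finally show "(sw (Cod C f) (Cod C g) (Cod C h) \<cdot> (f \<star> (g \<star> h))) \<cdot> \<alpha> (Dom C f) (Dom C g) (Dom C h)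
     = ((g \<star> (f \<star> h)) \<cdot> sw (Dom C f) (Dom C g) (Dom C h)) \<cdot> \<alpha> (Dom C f) (Dom C g) (Dom C h)"
    by simp
qed simp_all

text \<open>This is the hexagon tensored with \<open>X\<close>, with pentagons moving the brackets
  to the right: carrying \<open>A\<close> past \<open>B \<odot> Y\<close> as one object is carrying
  it past \<open>B\<close> and then past \<open>Y\<close>.\<close>

lemma sw_hexagon:
  assumes [simp]: "A \<in> Obj C" "B \<in> Obj C" "Y \<in> Obj C" "X \<in> Obj C"
  shows "\<alpha> B Y (A \<odot> X) \<cdot> sw A (B \<odot> Y) X
    = (ide B \<star> sw A Y X) \<cdot> (sw A B (Y \<odot> X) \<cdot> (ide A \<star> \<alpha> B Y X))"
proof (rule cancel_epi)
  let ?e = "\<alpha> A (B \<odot> Y) X \<cdot> (\<alpha> A B Y \<star> ide X)"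
  show "iso_arr C ?e" by simp
  have hex: "(\<alpha> B Y A \<star> ide X) \<cdot> ((sym A (B \<odot> Y) \<star> ide X) \<cdot> (\<alpha> A B Y \<star> ide X))
      = ((ide B \<star> sym A Y) \<star> ide X) \<cdot> ((\<alpha> B A Y \<star> ide X) \<cdot> ((sym A B \<star> ide Y) \<star> ide X))"
    using arg_cong[OF hexagon'[of A B Y], of "\<lambda>f. f \<star> ide X"] by simp
  have "(\<alpha> B Y (A \<odot> X) \<cdot> sw A (B \<odot> Y) X) \<cdot> ?e
      = \<alpha> B Y (A \<odot> X) \<cdot> (\<alpha> (B \<odot> Y) A X \<cdot> ((sym A (B \<odot> Y) \<star> ide X) \<cdot> (\<alpha> A B Y \<star> ide X)))"
    by (simp add: Comp2_ext[OF sw_associator])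
  also have "\<dots> = (ide B \<star> \<alpha> Y A X) \<cdot> (\<alpha> B (Y \<odot> A) X \<cdot>
      ((\<alpha> B Y A \<star> ide X) \<cdot> ((sym A (B \<odot> Y) \<star> ide X) \<cdot> (\<alpha> A B Y \<star> ide X))))"
    using Comp2_ext[OF pentagon'[of B Y A X, symmetric]] by simp
  also have "\<dots> = (ide B \<star> \<alpha> Y A X) \<cdot> (\<alpha> B (Y \<odot> A) X \<cdot>
      (((ide B \<star> sym A Y) \<star> ide X) \<cdot> ((\<alpha> B A Y \<star> ide X) \<cdot> ((sym A B \<star> ide Y) \<star> ide X))))"
    by (simp only: hex)
  also have "\<dots> = (ide B \<star> (\<alpha> Y A X \<cdot> (sym A Y \<star> ide X))) \<cdot>
      (\<alpha> B (A \<odot> Y) X \<cdot> ((\<alpha> B A Y \<star> ide X) \<cdot> ((sym A B \<star> ide Y) \<star> ide X)))"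
    using Comp2_ext[OF associator_natural[of "ide B" "sym A Y" "ide X"]] by simp
  also have "\<dots> = (ide B \<star> sw A Y X) \<cdot> ((ide B \<star> \<alpha> A Y X) \<cdot>
      (\<alpha> B (A \<odot> Y) X \<cdot> ((\<alpha> B A Y \<star> ide X) \<cdot> ((sym A B \<star> ide Y) \<star> ide X))))"
    by (subst sw_associator[symmetric]) simp_all
  also have "\<dots> = (ide B \<star> sw A Y X)
      \<cdot> (\<alpha> B A (Y \<odot> X) \<cdot> (\<alpha> (B \<odot> A) Y X \<cdot> ((sym A B \<star> ide Y) \<star> ide X)))"
    using Comp3_ext[OF pentagon'[of B A Y X]] by simp
  also have "\<dots> = (ide B \<star> sw A Y X) \<cdot> (\<alpha> B A (Y \<odot> X) \<cdot> ((sym A B \<star> ide (Y \<odot> X)) \<cdot> \<alpha> (A \<odot> B) Y X))"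
    using associator_natural[of "sym A B" "ide Y" "ide X"] by simp
  also have "\<dots> = (ide B \<star> sw A Y X) \<cdot> (sw A B (Y \<odot> X) \<cdot> (\<alpha> A B (Y \<odot> X) \<cdot> \<alpha> (A \<odot> B) Y X))"
    by (simp add: Comp2_ext[OF sw_associator])
  also have "\<dots> = ((ide B \<star> sw A Y X) \<cdot> (sw A B (Y \<odot> X) \<cdot> (ide A \<star> \<alpha> B Y X))) \<cdot> ?e"
    using pentagon'[of A B Y X] by simp
  finally show "(\<alpha> B Y (A \<odot> X) \<cdot> sw A (B \<odot> Y) X) \<cdot> ?e
    = ((ide B \<star> sw A Y X) \<cdot> (sw A B (Y \<odot> X) \<cdot> (ide A \<star> \<alpha> B Y X))) \<cdot> ?e" .
qed simp_all

text \<open>The switch touches the first two factors, and by the pentagon a rebracketing of what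
  stands behind them slides past it. This is the base case of \<open>app_swap\<close>.\<close>

lemma sw_associator_right:
  assumes [simp]: "A \<in> Obj C" "B \<in> Obj C" "Y \<in> Obj C" "X \<in> Obj C"
  shows "sw A B (Y \<odot> X) \<cdot> ((ide A \<star> \<alpha> B Y X) \<cdot> \<alpha> A (B \<odot> Y) X)
    = (ide B \<star> \<alpha> A Y X) \<cdot> (\<alpha> B (A \<odot> Y) X \<cdot> (sw A B Y \<star> ide X))"
proof (rule cancel_epi)
  show "iso_arr C (\<alpha> A B Y \<star> ide X)" by simp
  have "(sw A B (Y \<odot> X) \<cdot> ((ide A \<star> \<alpha> B Y X) \<cdot> \<alpha> A (B \<odot> Y) X)) \<cdot> (\<alpha> A B Y \<star> ide X)
      = sw A B (Y \<odot> X) \<cdot> (\<alpha> A B (Y \<odot> X) \<cdot> \<alpha> (A \<odot> B) Y X)"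
    using pentagon'[of A B Y X] by simp
  also have "\<dots> = \<alpha> B A (Y \<odot> X) \<cdot> ((sym A B \<star> ide (Y \<odot> X)) \<cdot> \<alpha> (A \<odot> B) Y X)"
    by (simp add: Comp2_ext[OF sw_associator])
  also have "\<dots> = \<alpha> B A (Y \<odot> X) \<cdot> (\<alpha> (B \<odot> A) Y X \<cdot> ((sym A B \<star> ide Y) \<star> ide X))"
    using associator_natural[of "sym A B" "ide Y" "ide X"] by simp
  also have "\<dots> = (ide B \<star> \<alpha> A Y X) \<cdot> (\<alpha> B (A \<odot> Y) X \<cdot> ((\<alpha> B A Y \<cdot> (sym A B \<star> ide Y)) \<star> ide X))"
    using Comp2_ext[OF pentagon'[of B A Y X, symmetric]] by simp
  also have "\<dots> = ((ide B \<star> \<alpha> A Y X) \<cdot> (\<alpha> B (A \<odot> Y) X \<cdot> (sw A B Y \<star> ide X))) \<cdot> (\<alpha> A B Y \<star> ide X)"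
    by (subst sw_associator[symmetric]) simp_all
  finally show "(sw A B (Y \<odot> X) \<cdot> ((ide A \<star> \<alpha> B Y X) \<cdot> \<alpha> A (B \<odot> Y) X)) \<cdot> (\<alpha> A B Y \<star> ide X)
    = ((ide B \<star> \<alpha> A Y X) \<cdot> (\<alpha> B (A \<odot> Y) X \<cdot> (sw A B Y \<star> ide X))) \<cdot> (\<alpha> A B Y \<star> ide X)" .
qed simp_all

text \<open>By \<open>sw_hexagon\<close> either side carries \<open>A\<close> past \<open>B\<close>
  and \<open>D\<close> as one object, and naturality allows \<open>sym B D\<close> to be applied
  before or after that.\<close>

lemma yang_baxter:
  assumes [simp]: "A \<in> Obj C" "B \<in> Obj C" "D \<in> Obj C" "X \<in> Obj C"
  shows "sw B D (A \<odot> X) \<cdot> ((ide B \<star> sw A D X) \<cdot> sw A B (D \<odot> X))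
    = (ide D \<star> sw A B X) \<cdot> (sw A D (B \<odot> X) \<cdot> (ide A \<star> sw B D X))"
proof (rule cancel_epi)
  show "iso_arr C (ide A \<star> \<alpha> B D X)" by simp
  have "(sw B D (A \<odot> X) \<cdot> ((ide B \<star> sw A D X) \<cdot> sw A B (D \<odot> X))) \<cdot> (ide A \<star> \<alpha> B D X)
      = sw B D (A \<odot> X) \<cdot> (\<alpha> B D (A \<odot> X) \<cdot> sw A (B \<odot> D) X)"
    by (simp add: sw_hexagon)
  also have "\<dots> = \<alpha> D B (A \<odot> X) \<cdot> ((sym B D \<star> ide (A \<odot> X)) \<cdot> sw A (B \<odot> D) X)"
    by (simp add: Comp2_ext[OF sw_associator])
  also have "\<dots> = \<alpha> D B (A \<odot> X) \<cdot> (sw A (D \<odot> B) X \<cdot> (ide A \<star> (sym B D \<star> ide X)))"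
    using sw_natural[of "ide A" "sym B D" "ide X"] by simp
  also have "\<dots> = (ide D \<star> sw A B X) \<cdot> (sw A D (B \<odot> X) \<cdot> (ide A \<star> (\<alpha> D B X \<cdot> (sym B D \<star> ide X))))"
    by (simp add: Comp2_ext[OF sw_hexagon])
  also have "\<dots> = ((ide D \<star> sw A B X) \<cdot> (sw A D (B \<odot> X) \<cdot> (ide A \<star> sw B D X))) \<cdot> (ide A \<star> \<alpha> B D X)"
    by (subst sw_associator[symmetric]) simp_all
  finally show "(sw B D (A \<odot> X) \<cdot> ((ide B \<star> sw A D X) \<cdot> sw A B (D \<odot> X))) \<cdot> (ide A \<star> \<alpha> B D X)
    = ((ide D \<star> sw A B X) \<cdot> (sw A D (B \<odot> X) \<cdot> (ide A \<star> sw B D X))) \<cdot> (ide A \<star> \<alpha> B D X)" .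
qed simp_all

end

section \<open>Words and linear orders\<close>

inductive swaps :: "'l list \<Rightarrow> 'l list \<Rightarrow> bool" where
  swaps_refl: "swaps xs xs"
| swaps_step: "swaps xs (u @ a # b # v) \<Longrightarrow> swaps xs (u @ b # a # v)"

lemma swaps_trans: "swaps ys zs \<Longrightarrow> swaps xs ys \<Longrightarrow> swaps xs zs"
  by (induction rule: swaps.induct) (auto intro: swaps.intros)

lemma swaps_Cons: "swaps xs ys \<Longrightarrow> swaps (x # xs) (x # ys)"
proof (induction rule: swaps.induct)
  case (swaps_step xs u a b v)
  then show ?case using swaps.swaps_step[of "x # xs" "x # u" a b v] by simp
qed (rule swaps_refl)

lemma swaps_move: "swaps (y # u @ v) (u @ y # v)"
proof (induction u)
  case (Cons a u)
  have "swaps (y # a # u @ v) (a # y # u @ v)"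
    using swaps_step[of _ "[]"] swaps_refl by fastforce
  with swaps_Cons[OF Cons.IH, of a] show ?case by (auto intro: swaps_trans)
qed (simp add: swaps_refl)

text \<open>Distinct letters make a pair of words encode one definite bijection of positions,
  although all tensor factors are the same object.\<close>

definition perm_words :: "'l list \<Rightarrow> 'l list \<Rightarrow> bool" where
  "perm_words xs ys \<longleftrightarrow> distinct xs \<and> distinct ys \<and> set xs = set ys"

lemma perm_words_refl: "distinct xs \<Longrightarrow> perm_words xs xs"
  by (simp add: perm_words_def)

lemma perm_words_trans: "perm_words xs ys \<Longrightarrow> perm_words ys zs \<Longrightarrow> perm_words xs zs"
  by (simp add: perm_words_def)

lemma perm_words_length: "perm_words xs ys \<Longrightarrow> length xs = length ys"
  by (metis perm_words_def distinct_card)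

lemma perm_words_Nil [simp]: "perm_words [] ys \<longleftrightarrow> ys = []"
  by (auto simp: perm_words_def)

lemma perm_words_ConsE:
  assumes "perm_words (x # xs) ys"
  obtains u v where "ys = u @ x # v" "x \<notin> set u" "perm_words xs (u @ v)"
proof -
  from assms have "x \<in> set ys" by (auto simp: perm_words_def)
  then obtain u v where uv: "ys = u @ x # v" "x \<notin> set u" using split_list_first by metis
  have "perm_words xs (u @ v)" using assms uv by (auto simp: perm_words_def)
  with uv show ?thesis using that by blast
qed

lemma perm_words_swap: "perm_words xs (u @ a # b # v) \<Longrightarrow> perm_words xs (u @ b # a # v)"
  by (auto simp: perm_words_def)

lemma perm_words_map: "perm_words xs ys \<Longrightarrow> inj_on h (set xs) \<Longrightarrow> perm_words (map h xs) (map h ys)"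
  by (auto simp: perm_words_def distinct_map)

lemma perm_words_append:
  "perm_words xs ys \<Longrightarrow> perm_words xs' ys' \<Longrightarrow> set xs \<inter> set xs' = {} \<Longrightarrow> perm_words (xs @ xs') (ys @ ys')"
  by (auto simp: perm_words_def)

lemma swaps_perm_words: "swaps xs ys \<Longrightarrow> distinct xs \<Longrightarrow> perm_words xs ys"
  by (induction rule: swaps.induct) (auto simp: perm_words_def)

text \<open>Insertion sort: the tail is arranged recursively, and then the first letter is moved to
  its place by adjacent exchanges.\<close>

lemma perm_words_swaps: "perm_words xs ys \<Longrightarrow> swaps xs ys"
proof (induction xs arbitrary: ys)
  case (Cons x xs)
  then obtain u v where *: "ys = u @ x # v" "perm_words xs (u @ v)" by (elim perm_words_ConsE)
  show ?case using swaps_trans[OF swaps_move swaps_Cons[OF Cons.IH[OF *(2)]]] *(1) by simp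
qed (simp add: swaps_refl)

text \<open>Properties of \<open>can\<close> are proved by this induction: they hold for the trivial
  rearrangement and survive one more adjacent transposition of the target word.\<close>

lemma perm_words_induct [consumes 1, case_names refl swap]:
  assumes "perm_words xs ys" "P xs"
    and "\<And>u a b v. perm_words xs (u @ a # b # v) \<Longrightarrow> P (u @ a # b # v) \<Longrightarrow> P (u @ b # a # v)"
  shows "P ys"
proof -
  have "swaps xs ys" "distinct xs"
    using assms(1) perm_words_swaps by (auto simp: perm_words_def)
  then show ?thesis using assms(2,3)
    by (induction rule: swaps.induct) (auto dest: swaps_perm_words)
qed

lemma perm_words_concat:
  assumes "perm_words is js" "distinct (concat (map l is))"
  shows "perm_words (concat (map l is)) (concat (map l js))"
  using assms(1)
proof (induction rule: perm_words_induct)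
  case refl
  then show ?case using assms(2) by (rule perm_words_refl)
next
  case (swap u a b v)
  then show ?case by (auto simp: perm_words_def)
qed

lemma perm_words_concat_pointwise:
  assumes "distinct (concat (map l is))" "\<And>i. i \<in> set is \<Longrightarrow> perm_words (l i) (l' i)"
  shows "perm_words (concat (map l is)) (concat (map l' is))"
  using assms by (induction "is") (fastforce simp: perm_words_def)+

lemma upt_split_swap:
  assumes "Suc i < n"
  shows "[0..<n] = [0..<i] @ i # Suc i # [Suc (Suc i)..<n]"
  using assms
  by (metis le_add_same_cancel1 le0 less_imp_add_positive upt_add_eq_append upt_conv_Cons
      Suc_lessD add_0 le_simps(1))

lemma concat_replicate_sum_list: "concat (map (\<lambda>n. replicate n x) ns) = replicate (sum_list ns) x"
  by (induction ns) (simp_all add: replicate_add)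

section \<open>Linear orders as words\<close>

primrec ord_of :: "'l list \<Rightarrow> ('l \<times> 'l) set" where
  "ord_of [] = {}"
| "ord_of (x # xs) = {x} \<times> set (x # xs) \<union> ord_of xs"

definition word_of :: "('l \<times> 'l) set \<Rightarrow> 'l list" where
  "word_of r = (THE w. distinct w \<and> ord_of w = r)"

lemma ord_of_subset: "ord_of w \<subseteq> set w \<times> set w"
  by (induction w) auto

lemma ord_of_append: "ord_of (u @ v) = ord_of u \<union> ord_of v \<union> set u \<times> set v"
  by (induction u) auto

lemma ord_of_rev: "ord_of (rev w) = (ord_of w)\<inverse>"
  by (induction w) (auto simp: ord_of_append)

lemma ord_of_map: "ord_of (map h w) = map_prod h h ` ord_of w"
  by (induction w) auto

lemma ord_of_refl: "(x, x) \<in> ord_of w \<longleftrightarrow> x \<in> set w"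
  by (induction w) (use ord_of_subset in auto)

lemma linear_order_on_ord_of:
  assumes "distinct w"
  shows "linear_order_on (set w) (ord_of w)"
proof -
  have "refl_on (set w) (ord_of w)" by (simp add: refl_on_def ord_of_refl)
  moreover have "trans (ord_of w)"
    using assms
  proof (induction w)
    case (Cons x w)
    show ?case
    proof (rule transI)
      fix a b c assume "(a, b) \<in> ord_of (x # w)" "(b, c) \<in> ord_of (x # w)"
      then show "(a, c) \<in> ord_of (x # w)"
        using transD[of "ord_of w" a b c] Cons ord_of_subset[of w] by auto
    qed
  qed simp
  moreover have "antisym (ord_of w)"
    using assms
  proof (induction w)
    case (Cons x w)
    show ?case
    proof (rule antisymI)
      fix a b assume "(a, b) \<in> ord_of (x # w)" "(b, a) \<in> ord_of (x # w)"
      then show "a = b"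
        using antisymD[of "ord_of w" a b] Cons ord_of_subset[of w] by auto
    qed
  qed simp
  moreover have "total_on (set w) (ord_of w)"
    by (induction w) (auto simp: total_on_def)
  ultimately show ?thesis using ord_of_subset by (auto simp: order_on_defs)
qed

text \<open>The first letter is the least element, so the order determines it; deleting the pairs
  that start with it leaves the order of the tail.\<close>

lemma ord_of_inject: "distinct w \<Longrightarrow> distinct w' \<Longrightarrow> ord_of w = ord_of w' \<Longrightarrow> w = w'"
proof (induction w arbitrary: w')
  case Nil
  then show ?case by (cases w') auto
next
  case (Cons x w)
  have s: "set (x # w) = set w'" using Cons.prems(3) ord_of_refl by (metis subsetI subset_antisym)
  then obtain y v where w': "w' = y # v" by (cases w') auto
  have "x = y"
  proof (rule ccontr)
    assume "x \<noteq> y"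
    then have "x \<in> set v" "y \<in> set w" using s w' by auto
    then have "(y, x) \<in> ord_of w'" and "(y, x) \<notin> ord_of (x # w)"
      using w' Cons.prems(1) \<open>x \<noteq> y\<close> subsetD[OF ord_of_subset[of w]] by auto
    then show False unfolding Cons.prems(3) by blast
  qed
  moreover have "ord_of w = ord_of v"
  proof -
    have "ord_of w = ord_of (x # w) - {x} \<times> UNIV" using ord_of_subset[of w] Cons.prems(1) by auto
    also have "\<dots> = ord_of v" using ord_of_subset[of v] Cons.prems(2,3) w' \<open>x = y\<close> by auto
    finally show ?thesis .
  qed
  ultimately show ?case using Cons.IH[of v] Cons.prems w' by simp
qed

lemma word_of_ord_of [simp]: "distinct w \<Longrightarrow> word_of (ord_of w) = w"
  unfolding word_of_def by (rule the_equality) (auto intro: ord_of_inject)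

text \<open>Induction on the cardinality, splitting off the least element; the word lists the
  elements in increasing order.\<close>

lemma linear_order_on_word:
  assumes "finite A" "linear_order_on A r"
  shows "\<exists>w. distinct w \<and> set w = A \<and> ord_of w = r"
  using assms
proof (induction "card A" arbitrary: A r)
  case 0
  then show ?case by (auto simp: order_on_defs)
next
  case (Suc n)
  have r: "r \<subseteq> A \<times> A" "refl_on A r" "trans r" "antisym r" "total_on A r"
    using Suc.prems by (auto simp: order_on_defs)
  have "A \<noteq> {}" "finite A" using Suc by auto
  have "\<exists>x\<in>A. \<forall>y\<in>A. (x, y) \<in> r" if "finite B" "B \<noteq> {}" "B = A" for B
  proof -
    \<comment> \<open>The least element is found for every nonempty subset of \<open>A\<close>, so
      that the induction can add one element at a time.\<close>
    have "\<exists>x\<in>B. \<forall>y\<in>B. (x, y) \<in> r" if "finite B" "B \<noteq> {}" "B \<subseteq> A" for B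
      using that
    proof (induction rule: finite_ne_induct)
      case (singleton x)
      then show ?case using r(2) by (auto simp: refl_on_def)
    next
      case (insert x F)
      then obtain m where m: "m \<in> F" "\<forall>y\<in>F. (m, y) \<in> r" by auto
      then consider "(m, x) \<in> r" | "(x, m) \<in> r"
        using r(2,5) insert.prems unfolding total_on_def refl_on_def
        by (metis insert_subset subsetD)
      then show ?case
      proof cases
        case 1
        then show ?thesis using m by auto
      next
        case 2
        then have "\<forall>y\<in>F. (x, y) \<in> r" using m r(3) by (meson transD)
        moreover have "(x, x) \<in> r" using r(2) insert.prems by (auto simp: refl_on_def)
        ultimately show ?thesis by auto
      qed
    qed
    then show ?thesis using that by auto
  qed
  then obtain x where x: "x \<in> A" "\<forall>y\<in>A. (x, y) \<in> r" using \<open>A \<noteq> {}\<close> \<open>finite A\<close> by auto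
  let ?r = "r \<inter> (A - {x}) \<times> (A - {x})"
  have "refl_on (A - {x}) ?r" using r(2) by (auto simp: refl_on_def)
  moreover have "trans ?r" using r(3) by (auto intro!: transI dest: transD)
  moreover have "antisym ?r" using r(4) by (auto intro!: antisymI dest: antisymD)
  moreover have "total_on (A - {x}) ?r" using r(5) by (auto simp: total_on_def)
  ultimately have "linear_order_on (A - {x}) ?r" by (simp add: order_on_defs)
  then obtain w where w: "distinct w" "set w = A - {x}" "ord_of w = ?r"
    using Suc.hyps(1)[of "A - {x}" ?r] Suc.hyps(2) x(1) Suc.prems(1)
    by (metis card_Diff_singleton diff_Suc_1 finite_Diff)
  have "ord_of (x # w) = r"
    using w x r(1) antisymD[OF r(4)] by auto
  then show ?case using w x by (intro exI[of _ "x # w"]) auto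
qed

lemma perm_words_upt: "perm_words [0..<n] w \<longleftrightarrow> distinct w \<and> set w = {..<n}"
  by (auto simp: perm_words_def atLeast0LessThan)

lemma op_set_Assoc: "r \<in> op_set Assoc n \<longleftrightarrow> (\<exists>w. perm_words [0..<n] w \<and> r = ord_of w)"
proof
  assume "r \<in> op_set Assoc n"
  then have "linear_order_on {..<n} r" by (simp add: Assoc_def)
  from linear_order_on_word[OF _ this] show "\<exists>w. perm_words [0..<n] w \<and> r = ord_of w"
    by (auto simp: perm_words_upt)
next
  assume "\<exists>w. perm_words [0..<n] w \<and> r = ord_of w"
  then show "r \<in> op_set Assoc n"
    using linear_order_on_ord_of by (fastforce simp: Assoc_def perm_words_upt)
qed

text \<open>Letters of an earlier block precede those of a later one, and within a block its own
  word decides. This lexicographic description is what matches concatenation with the composition of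
  \<open>Assoc\<close>.\<close>

lemma mem_ord_of_concat:
  assumes "distinct w"
  shows "(a, b) \<in> ord_of (concat (map l w)) \<longleftrightarrow>
    (\<exists>i i'. (i, i') \<in> ord_of w \<and> i \<noteq> i' \<and> a \<in> set (l i) \<and> b \<in> set (l i')) \<or> (\<exists>i\<in>set w. (a, b)
        \<in> ord_of (l i))"
  using assms
proof (induction w)
  case (Cons x w)
  have "x \<notin> set w" using Cons.prems by simp
  have IH: "(a, b) \<in> ord_of (concat (map l w)) \<longleftrightarrow>
    (\<exists>i i'. (i, i') \<in> ord_of w \<and> i \<noteq> i' \<and> a \<in> set (l i) \<and> b \<in> set (l i')) \<or> (\<exists>i\<in>set w. (a, b)
        \<in> ord_of (l i))"
    using Cons by simp
  have "(a, b) \<in> ord_of (concat (map l (x # w))) \<longleftrightarrow>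
    (a, b) \<in> ord_of (l x) \<or> (a, b)
        \<in> ord_of (concat (map l w)) \<or> (a \<in> set (l x) \<and> (\<exists>i'\<in>set w. b \<in> set (l i')))"
    by (auto simp: ord_of_append)
  then show ?case unfolding IH using \<open>x \<notin> set w\<close> ord_of_subset[of w] by auto
qed simp

section \<open>The twisted associative operad in terms of words\<close>

definition shift :: "nat list \<Rightarrow> nat \<Rightarrow> nat list \<Rightarrow> nat list" where
  "shift ns i w = map ((+) (sum_list (take i ns))) w"

lemma mem_op_comp_Assoc: "(a, b) \<in> op_comp Assoc ns r rs \<longleftrightarrow>
    (\<exists>i j i' j'. a = sum_list (take i ns) + j \<and> b = sum_list (take i' ns) + j' \<and>
       i < length ns \<and> j < ns ! i \<and> i' < length ns \<and> j' < ns ! i' \<and>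
       (i \<noteq> i' \<and> (i, i') \<in> r \<or> i = i' \<and> (j, j') \<in> rs ! i))"
  by (auto simp: Assoc_def)

text \<open>Both sides are lexicographic: first by the place of the block in \<open>w\<close>, then
  by the word of the block. Substitution of orders becomes concatenation of words.\<close>

lemma op_comp_Assoc:
  assumes w: "perm_words [0..<length ns] w"
    and ws: "\<And>i. i < length ns \<Longrightarrow> perm_words [0..<ns ! i] (ws ! i)" "length ws = length ns"
  shows "op_comp Assoc ns (ord_of w) (map ord_of ws)
      = ord_of (concat (map (\<lambda>i. shift ns i (ws ! i)) w))"
proof -
  have w': "distinct w" "set w = {..<length ns}" using w by (auto simp: perm_words_upt)
  have ws': "set (ws ! i) = {..<ns ! i}" if "i < length ns" for i
    using ws(1)[OF that] by (simp add: perm_words_upt)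
  have sw: "(i, i') \<in> ord_of w \<Longrightarrow> i < length ns \<and> i' < length ns" for i i'
    using ord_of_subset[of w] w' by auto
  have sws: "(j, j') \<in> ord_of (ws ! i) \<Longrightarrow> i < length ns \<Longrightarrow> j < ns ! i \<and> j' < ns ! i" for i j j'
    using ord_of_subset[of "ws ! i"] ws' by blast
  show ?thesis
  proof (intro subset_antisym subsetI)
    fix p assume "p \<in> op_comp Assoc ns (ord_of w) (map ord_of ws)"
    then obtain i j i' j' where p: "p = (sum_list (take i ns) + j, sum_list (take i' ns) + j')"
      "i < length ns" "j < ns ! i" "i' < length ns" "j' < ns ! i'"
      "i \<noteq> i' \<and> (i, i') \<in> ord_of w \<or> i = i' \<and> (j, j') \<in> map ord_of ws ! i"
      by (cases p) (simp add: mem_op_comp_Assoc, blast)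
    have "sum_list (take i ns) + j \<in> set (shift ns i (ws ! i))"
      "sum_list (take i' ns) + j' \<in> set (shift ns i' (ws ! i'))"
      using p(2-5) ws' by (simp_all add: shift_def)
    moreover have "i = i' \<Longrightarrow> (j, j') \<in> map ord_of ws ! i \<Longrightarrow> p \<in> ord_of (shift ns i (ws ! i))"
      using p(1,2) ws(2) by (auto simp: shift_def ord_of_map)
    ultimately show "p \<in> ord_of (concat (map (\<lambda>i. shift ns i (ws ! i)) w))"
      using p(1,2,6) w' unfolding p(1) mem_ord_of_concat[OF w'(1)] by blast
  next
    fix p assume *: "p \<in> ord_of (concat (map (\<lambda>i. shift ns i (ws ! i)) w))"
    obtain a b where ab: "p = (a, b)" by fastforce
    from * consider (1) i i' where "(i, i') \<in> ord_of w" "i \<noteq> i'" "a \<in> set (shift ns i (ws ! i))"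
      "b \<in> set (shift ns i' (ws ! i'))"
      | (2) i where "i \<in> set w" "(a, b) \<in> ord_of (shift ns i (ws ! i))"
      unfolding ab mem_ord_of_concat[OF w'(1)] by blast
    then show "p \<in> op_comp Assoc ns (ord_of w) (map ord_of ws)"
    proof cases
      case 1
      then obtain j j' where j: "a = sum_list (take i ns) + j" "b = sum_list (take i' ns) + j'"
        "j \<in> set (ws ! i)" "j' \<in> set (ws ! i')"
        by (auto simp: shift_def)
      have "i < length ns" "i' < length ns" using sw[OF 1(1)] by simp_all
      with j ws' 1 show ?thesis unfolding ab mem_op_comp_Assoc by blast
    next
      case 2
      then obtain j j' where j: "a = sum_list (take i ns) + j" "b = sum_list (take i ns) + j'"
        "(j, j') \<in> ord_of (ws ! i)"
        by (auto simp: shift_def ord_of_map)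
      have i: "i < length ns" using 2 w' by simp
      then have "(j, j') \<in> map ord_of ws ! i" using j(3) ws(2) by simp
      with j i sws[OF j(3) i] show ?thesis unfolding ab mem_op_comp_Assoc by blast
    qed
  qed
qed

text \<open>\<open>op_perm\<close> pulls an order back along \<open>\<sigma>\<close>, and
  injectivity of \<open>\<sigma>\<close> makes this undo the letterwise image.\<close>

lemma op_perm_Assoc:
  assumes "bij_betw \<sigma> {..<n} {..<n}" "perm_words [0..<n] w"
  shows "op_perm Assoc n (ord_of (map \<sigma> w)) \<sigma> = ord_of w"
proof -
  have *: "inj_on \<sigma> {..<n}" "set w = {..<n}" using assms by (auto simp: bij_betw_def perm_words_upt)
  have "(a, b) \<in> op_perm Assoc n (ord_of (map \<sigma> w)) \<sigma> \<longleftrightarrow> (a, b) \<in> ord_of w" for a b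
  proof -
    have "(\<sigma> a, \<sigma> b) \<in> map_prod \<sigma> \<sigma> ` ord_of w \<longleftrightarrow> (a, b) \<in> ord_of w" if "a < n" "b < n"
    proof
      assume "(\<sigma> a, \<sigma> b) \<in> map_prod \<sigma> \<sigma> ` ord_of w"
      then obtain c d where cd: "(c, d) \<in> ord_of w" "\<sigma> a = \<sigma> c" "\<sigma> b = \<sigma> d" by auto
      then have "c < n" "d < n" using ord_of_subset[of w] *(2) by auto
      then show "(a, b) \<in> ord_of w" using cd *(1) that inj_onD[of \<sigma> "{..<n}"] by auto
    qed (auto intro: rev_image_eqI)
    moreover have "(a, b) \<in> ord_of w \<Longrightarrow> a < n \<and> b < n" using ord_of_subset[of w] *(2) by auto
    ultimately show ?thesis by (auto simp: Assoc_def ord_of_map)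
  qed
  then show ?thesis by auto
qed

lemma concat_shift_upt: "concat (map (\<lambda>i. shift ns i [0..<ns ! i]) [0..<length ns])
    = [0..<sum_list ns]"
proof (induction ns rule: rev_induct)
  case (snoc n ns)
  have "concat (map (\<lambda>i. shift (ns @ [n]) i [0..<(ns @ [n]) ! i]) [0..<length ns])
      = concat (map (\<lambda>i. shift ns i [0..<ns ! i]) [0..<length ns])"
    by (intro arg_cong[of _ _ concat] map_cong) (auto simp: shift_def nth_append)
  moreover have "map ((+) (sum_list ns)) [0..<n] = [sum_list ns..<sum_list ns + n]"
    using map_add_upt[of "sum_list ns" n] by (metis (no_types, lifting) ext add.commute)
  ultimately show ?case using snoc upt_add_eq_append[of 0 "sum_list ns" n] by (simp add: shift_def)
qed simp

text \<open>Used to find the decorations of block \<open>i\<close> inside the concatenated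
  decorations of a composite.\<close>

lemma nth_concat_shift:
  assumes "map length Ls = ns" "i < length ns"
  shows "map ((!) (concat Ls)) (shift ns i [0..<ns ! i]) = Ls ! i"
proof -
  have i: "i < length Ls" using assms by auto
  have c: "concat Ls = concat (take i Ls) @ Ls ! i @ concat (drop (Suc i) Ls)"
    using i by (metis append_take_drop_id concat.simps(2) concat_append Cons_nth_drop_Suc)
  have s: "sum_list (take i ns) = length (concat (take i Ls))"
    using assms by (auto simp: length_concat take_map)
  have "ns ! i = length (Ls ! i)" using assms i by auto
  then show ?thesis unfolding shift_def s c by (intro nth_equalityI) (auto simp: nth_append)
qed

lemma length_shift [simp]: "length (shift ns i w) = length w"
  by (simp add: shift_def)

lemma perm_words_shift: "perm_words v w \<Longrightarrow> perm_words (shift ns i v) (shift ns i w)"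
  unfolding shift_def by (rule perm_words_map) simp_all

lemma op_perm_Assoc_tw:
  assumes \<sigma>: "bij_betw \<sigma> {..<n} {..<n}" and v: "perm_words [0..<n] v"
  shows "\<exists>w. perm_words [0..<n] w \<and> map \<sigma> w = v \<and>
    op_perm (Assoc_tw G \<phi>) n (ord_of v, gs) \<sigma> = (ord_of w, map ((!) gs) (map \<sigma> [0..<n]))"
proof -
  \<comment> \<open>The order is pulled back along \<open>\<sigma>\<close>, so the letters of its
    word are moved by the inverse of \<open>\<sigma>\<close>.\<close>
  define w where "w = map (inv_into {..<n} \<sigma>) v"
  have "bij_betw (inv_into {..<n} \<sigma>) {..<n} {..<n}" using \<sigma> by (rule bij_betw_inv_into)
  then have w: "perm_words [0..<n] w" using v
    by (auto simp: w_def perm_words_upt distinct_map bij_betw_def)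
  moreover have \<sigma>w: "map \<sigma> w = v"
    using v \<sigma> unfolding w_def perm_words_upt bij_betw_def
    by (auto simp: f_inv_into_f intro!: map_idI)
  ultimately show ?thesis
    using op_perm_Assoc[OF \<sigma> w] by (auto simp: Assoc_tw_def semidirect_operad_def)
qed

lemma mem_op_set_Assoc_tw:
  "x \<in> op_set (Assoc_tw G \<phi>) n \<longleftrightarrow>
    (\<exists>w gs. x = (ord_of w, gs) \<and> perm_words [0..<n] w \<and> length gs = n \<and> set gs \<subseteq> carrier G)"
proof -
  have "x \<in> op_set (Assoc_tw G \<phi>) n \<longleftrightarrow> fst x \<in> op_set Assoc n \<and> length (snd x)
      = n \<and> set (snd x) \<subseteq> carrier G"
    by (cases x) (auto simp: Assoc_tw_def semidirect_operad_def)
  then show ?thesis unfolding op_set_Assoc by (cases x) auto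
qed

text \<open>An odd outer decoration reverses the inner order, and reversing an order reverses its
  word. The decorations stay in the positional order of the blocks and are not rearranged by
  \<open>w\<close>.\<close>

lemma op_comp_Assoc_tw:
  assumes w: "perm_words [0..<length ns] w"
    and W: "\<And>i. i < length ns \<Longrightarrow> perm_words [0..<ns ! i] (W i)"
    and ys: "length ys = length ns" "\<And>i. i < length ns \<Longrightarrow> ys ! i = (ord_of (W i), H i)"
    and gs: "length gs = length ns"
  shows "op_comp (Assoc_tw G \<phi>) ns (ord_of w, gs) ys =
    (ord_of (concat (map (\<lambda>i. shift ns i (if \<phi> (gs ! i) = 1 then W i else rev (W i))) w)),
     concat (map (\<lambda>i. map ((\<otimes>\<^bsub>G\<^esub>) (gs ! i)) (H i)) [0..<length ns]))"
proof -
  let ?k = "length ns"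
  let ?W = "\<lambda>i. if \<phi> (gs ! i) = 1 then W i else rev (W i)"
  have 1: "map2 (\<lambda>g (y, hs). reversal (\<phi> g) y) gs ys = map ord_of (map ?W [0..<?k])"
    using ys gs by (intro nth_equalityI) (auto simp: reversal_def ord_of_rev)
  have 2: "map2 (\<lambda>g (y, hs). map (\<lambda>h. g \<otimes>\<^bsub>G\<^esub> h) hs) gs ys
      = map (\<lambda>i. map ((\<otimes>\<^bsub>G\<^esub>) (gs ! i)) (H i)) [0..<?k]"
    using ys gs by (intro nth_equalityI) auto
  have 3: "op_comp Assoc ns (ord_of w) (map ord_of (map ?W [0..<?k]))
      = ord_of (concat (map (\<lambda>i. shift ns i (map ?W [0..<?k] ! i)) w))"
    by (rule op_comp_Assoc[OF w]) (use W in \<open>auto simp: perm_words_def\<close>)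
  have 4: "map (\<lambda>i. shift ns i (map ?W [0..<?k] ! i)) w = map (\<lambda>i. shift ns i (?W i)) w"
    using w by (auto simp: perm_words_upt)
  show ?thesis
    unfolding Assoc_tw_def semidirect_operad_def
    by (simp add: 1[unfolded map_map] 2 3[unfolded map_map] 4)
qed

text \<open>Words and decorations of the inner operations are chosen as functions of the index, the
  form in which they later index blocks.\<close>

lemma Assoc_tw_words:
  assumes "list_all2 (\<lambda>n y. y \<in> op_set (Assoc_tw G \<phi>) n) ns ys"
  shows "\<exists>W H. length ys
      = length ns \<and> (\<forall>i<length ns. ys ! i = (ord_of (W i), H i) \<and> perm_words [0..<ns ! i] (W i) \<and>
      length (H i) = ns ! i \<and> set (H i) \<subseteq> carrier G)"
proof (intro exI conjI allI impI)
  fix i assume "i < length ns"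
  then have "ys ! i \<in> op_set (Assoc_tw G \<phi>) (ns ! i)" using assms
    by (simp add: list_all2_conv_all_nth)
  then obtain v hs where *: "ys ! i = (ord_of v, hs)" "perm_words [0..<ns ! i] v"
    "length hs = ns ! i" "set hs \<subseteq> carrier G"
    by (auto simp: mem_op_set_Assoc_tw)
  moreover from this have "word_of (fst (ys ! i)) = v" "snd (ys ! i) = hs"
    by (auto simp: perm_words_def)
  ultimately show "ys ! i = (ord_of (word_of (fst (ys ! i))), snd (ys ! i))"
    "perm_words [0..<ns ! i] (word_of (fst (ys ! i)))"
    "length (snd (ys ! i)) = ns ! i" "set (snd (ys ! i)) \<subseteq> carrier G"
    by simp_all
qed (use assms in \<open>simp add: list_all2_lengthD\<close>)

lemma perm_words_upt_Suc: "perm_words [0] [0::nat]" "perm_words [0, Suc 0] [0, Suc 0]"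
  "perm_words [0, Suc 0] [Suc 0, 0]"
  by (auto simp: perm_words_def)

lemma shift_zero [simp]: "shift ns 0 w = w"
  by (simp add: shift_def map_idI)

text \<open>The operation named by a composite has a known source and target once the composite is
  known to lie in the operad; \<open>is_algebra_iff\<close> relies on this.\<close>

lemma (in group) op_comp_closed:
  assumes x: "x \<in> op_set (Assoc_tw G \<phi>) (length ns)"
    and ys: "list_all2 (\<lambda>n y. y \<in> op_set (Assoc_tw G \<phi>) n) ns ys"
  shows "op_comp (Assoc_tw G \<phi>) ns x ys \<in> op_set (Assoc_tw G \<phi>) (sum_list ns)"
proof -
  let ?K = "[0..<length ns]"
  obtain w gs where x': "x = (ord_of w, gs)" "perm_words ?K w" "length gs = length ns"
    "set gs \<subseteq> carrier G"
    using x by (auto simp: mem_op_set_Assoc_tw)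
  obtain W H where y: "\<And>i. i < length ns \<Longrightarrow> ys ! i
      = (ord_of (W i), H i) \<and> perm_words [0..<ns ! i] (W i) \<and>
      length (H i) = ns ! i \<and> set (H i) \<subseteq> carrier G" and len: "length ys = length ns"
    using Assoc_tw_words[OF ys] by metis
  let ?W = "\<lambda>i. if \<phi> (gs ! i) = 1 then W i else rev (W i)"
  have eq: "op_comp (Assoc_tw G \<phi>) ns x ys =
    (ord_of (concat (map (\<lambda>i. shift ns i (?W i)) w)), concat (map (\<lambda>i. map ((\<otimes>\<^bsub>G\<^esub>) (gs ! i)) (H i)) ?K))"
    unfolding x'(1) by (rule op_comp_Assoc_tw) (use x' y len in auto)
  have W: "perm_words (shift ns i [0..<ns ! i]) (shift ns i (?W i))" if "i \<in> set ?K" for i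
    using y[of i] that by (intro perm_words_shift) (auto simp: perm_words_def)
  \<comment> \<open>The words inside the blocks are changed first and the blocks are permuted by
    \<open>w\<close> afterwards; both steps only permute the letters.\<close>
  have "perm_words [0..<sum_list ns] (concat (map (\<lambda>i. shift ns i (?W i)) ?K))"
    by (rule perm_words_concat_pointwise[of "\<lambda>i. shift ns i [0..<ns ! i]" ?K, unfolded concat_shift_upt]) (use W in simp_all)
  moreover from this have
    "perm_words (concat (map (\<lambda>i. shift ns i (?W i)) ?K)) (concat (map (\<lambda>i. shift ns i (?W i)) w))"
    by (intro perm_words_concat[OF x'(2)]) (simp add: perm_words_def)
  moreover have "length (concat (map (\<lambda>i. map ((\<otimes>\<^bsub>G\<^esub>) (gs ! i)) (H i)) ?K)) = sum_list ns"
  proof -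
    have "map (length \<circ> (\<lambda>i. map ((\<otimes>\<^bsub>G\<^esub>) (gs ! i)) (H i))) ?K = ns"
      using y by (intro nth_equalityI) auto
    then show ?thesis by (simp add: length_concat)
  qed
  moreover have "set (concat (map (\<lambda>i. map ((\<otimes>\<^bsub>G\<^esub>) (gs ! i)) (H i)) ?K)) \<subseteq> carrier G"
    using y x'(3,4) by (auto simp: subset_iff)
  ultimately show ?thesis unfolding eq mem_op_set_Assoc_tw using perm_words_trans by blast
qed

section \<open>Permutations of tensor powers\<close>

context symmetric_monoidal_category
begin

text \<open>\<open>opow A n X\<close> is \<open>A \<otimes> (A \<otimes> \<dots> (A \<otimes> X))\<close>, so that \<open>opow A n \<I>\<close> is the tensor power;
  \<open>app\<close> joins a tensor power to \<open>X\<close>, and \<open>ins\<close> moves the first factor behind the next \<open>n\<close> ones.\<close>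

primrec opow :: "'o \<Rightarrow> nat \<Rightarrow> 'o \<Rightarrow> 'o" where
  "opow A 0 X = X"
| "opow A (Suc n) X = A \<odot> opow A n X"

primrec lpow :: "'o \<Rightarrow> nat \<Rightarrow> 'm \<Rightarrow> 'm" where
  "lpow A 0 f = f"
| "lpow A (Suc n) f = ide A \<star> lpow A n f"

primrec app :: "'o \<Rightarrow> nat \<Rightarrow> 'o \<Rightarrow> 'm" where
  "app A 0 X = lun X"
| "app A (Suc n) X = (ide A \<star> app A n X) \<cdot> \<alpha> A (opow A n \<I>) X"

primrec ins :: "'o \<Rightarrow> nat \<Rightarrow> 'o \<Rightarrow> 'm" where
  "ins A 0 X = ide (A \<odot> X)"
| "ins A (Suc n) X = (ide A \<star> ins A n X) \<cdot> sw A A (opow A n X)"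

text \<open>The tail \<open>xs\<close> is rearranged first and \<open>x\<close> is inserted last.
  The word before \<open>x\<close> in \<open>ys\<close> counts the factors that \<open>x\<close>
  crosses, and the word after it counts those that remain behind.\<close>

primrec can :: "'o \<Rightarrow> 'l list \<Rightarrow> 'l list \<Rightarrow> 'm" where
  "can A [] ys = ide \<I>"
| "can A (x # xs) ys =
     ins A (length (takeWhile (\<lambda>y. y \<noteq> x) ys)) (opow A (length (tl (dropWhile (\<lambda>y. y \<noteq> x) ys))) \<I>)
     \<cdot> (ide A \<star> can A xs (remove1 x ys))"

lemma tens_pow_opow: "tens_pow C A n = opow A n \<I>"
  by (induction n) simp_all

lemma opow_opow [simp]: "opow A m (opow A n X) = opow A (m + n) X"
  by (induction m) simp_all

lemma opow_tens [simp]: "opow A m (A \<odot> X) = A \<odot> opow A m X"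
  by (induction m) simp_all

lemma lpow_lpow [simp]: "lpow A m (lpow A n f) = lpow A (m + n) f"
  by (induction m) simp_all

lemma lpow_whisker [simp]: "lpow A m (ide A \<star> f) = ide A \<star> lpow A m f"
  by (induction m) simp_all

context
  fixes A
  assumes A [simp]: "A \<in> Obj C"
begin

lemma opow_Obj [simp]: "X \<in> Obj C \<Longrightarrow> opow A n X \<in> Obj C"
  by (induction n) simp_all

lemma lpow_simps [simp]:
  assumes "f \<in> Arr C"
  shows "lpow A n f \<in> Arr C" "Dom C (lpow A n f) = opow A n (Dom C f)"
    "Cod C (lpow A n f) = opow A n (Cod C f)"
proof -
  have "lpow A n f \<in> Arr C \<and> Dom C (lpow A n f) = opow A n (Dom C f) \<and> Cod C (lpow A n f)
      = opow A n (Cod C f)"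
    using assms by (induction n) simp_all
  then show "lpow A n f \<in> Arr C" "Dom C (lpow A n f) = opow A n (Dom C f)"
    "Cod C (lpow A n f) = opow A n (Cod C f)"
    by simp_all
qed

lemma lpow_Ide [simp]: "X \<in> Obj C \<Longrightarrow> lpow A n (ide X) = ide (opow A n X)"
  by (induction n) simp_all

lemma lpow_Comp [simp]:
  "f \<in> Arr C \<Longrightarrow> g \<in> Arr C \<Longrightarrow> Dom C g = Cod C f \<Longrightarrow> lpow A n (g \<cdot> f) = lpow A n g \<cdot> lpow A n f"
  by (induction n) simp_all

lemma iso_arr_lpow [simp]: "iso_arr C f \<Longrightarrow> iso_arr C (lpow A n f)"
  by (induction n) simp_all

lemma app_simps [simp]:
  assumes "X \<in> Obj C"
  shows "app A n X \<in> Arr C" "Dom C (app A n X) = opow A n \<I> \<odot> X" "Cod C (app A n X) = opow A n X"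
    "iso_arr C (app A n X)"
proof -
  have "iso_arr C (app A n X) \<and> Dom C (app A n X) = opow A n \<I> \<odot> X \<and> Cod C (app A n X) = opow A n X"
    using assms by (induction n) simp_all
  then show "app A n X \<in> Arr C" "Dom C (app A n X) = opow A n \<I> \<odot> X"
    "Cod C (app A n X) = opow A n X"
    "iso_arr C (app A n X)"
    by simp_all
qed

lemma ins_simps [simp]:
  assumes "X \<in> Obj C"
  shows "ins A n X \<in> Arr C" "Dom C (ins A n X) = A \<odot> opow A n X"
    "Cod C (ins A n X) = A \<odot> opow A n X"
proof -
  have "ins A n X \<in> Arr C \<and> Dom C (ins A n X) = A \<odot> opow A n X \<and> Cod C (ins A n X) = A \<odot> opow A n X"
    using assms by (induction n) simp_all
  then show "ins A n X \<in> Arr C" "Dom C (ins A n X) = A \<odot> opow A n X"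
    "Cod C (ins A n X) = A \<odot> opow A n X"
    by simp_all
qed

lemma lpow_commute_swap:
  "f \<in> Arr C \<Longrightarrow> sw A A (Cod C f) \<cdot> (ide A \<star> (ide A \<star> f)) = (ide A \<star> (ide A \<star> f)) \<cdot> sw A A (Dom C f)"
  using sw_natural[of "ide A" "ide A" f] by simp

lemma app_natural:
  "f \<in> Arr C \<Longrightarrow> app A n (Cod C f) \<cdot> (ide (opow A n \<I>) \<star> f) = lpow A n f \<cdot> app A n (Dom C f)"
proof (induction n)
  case 0
  then show ?case by (simp add: lunitor_natural)
next
  case (Suc n)
  have "app A (Suc n) (Cod C f) \<cdot> (ide (opow A (Suc n) \<I>) \<star> f)
      = (ide A \<star> (app A n (Cod C f) \<cdot> (ide (opow A n \<I>) \<star> f))) \<cdot> \<alpha> A (opow A n \<I>) (Dom C f)"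
    using Suc.prems associator_natural[of "ide A" "ide (opow A n \<I>)" f] by simp
  also have "\<dots> = lpow A (Suc n) f \<cdot> app A (Suc n) (Dom C f)"
    using Suc by simp
  finally show ?case .
qed

lemma ins_natural:
  "f \<in> Arr C \<Longrightarrow> ins A n (Cod C f) \<cdot> (ide A \<star> lpow A n f) = lpow A n (ide A \<star> f) \<cdot> ins A n (Dom C f)"
proof (induction n)
  case (Suc n)
  have "ins A (Suc n) (Cod C f) \<cdot> (ide A \<star> lpow A (Suc n) f)
      = (ide A \<star> (ins A n (Cod C f) \<cdot> (ide A \<star> lpow A n f))) \<cdot> sw A A (opow A n (Dom C f))"
    using Suc.prems lpow_commute_swap[of "lpow A n f"] by simp
  also have "\<dots> = lpow A (Suc n) (ide A \<star> f) \<cdot> ins A (Suc n) (Dom C f)"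
    using Suc by simp
  finally show ?case .
qed simp

lemma ins_add: "X \<in> Obj C \<Longrightarrow> ins A (p + q) X = lpow A p (ins A q X) \<cdot> ins A p (opow A q X)"
  by (induction p) simp_all

text \<open>The inserted factor crosses both exchanged ones, so on the first three factors this is
  the Yang--Baxter equation.\<close>

lemma ins_sw:
  assumes [simp]: "X \<in> Obj C"
  shows "ins A (Suc (Suc q)) X \<cdot> (ide A \<star> sw A A (opow A q X))
      = sw A A (A \<odot> opow A q X) \<cdot> ins A (Suc (Suc q)) X"
proof -
  have "ins A (Suc (Suc q)) X \<cdot> (ide A \<star> sw A A (opow A q X))
     = (ide A \<star> (ide A \<star> ins A q X)) \<cdot> ((ide A \<star> sw A A (opow A q X)) \<cdot>
        (sw A A (A \<odot> opow A q X) \<cdot> (ide A \<star> sw A A (opow A q X))))"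
    by simp
  also have "\<dots> = (ide A \<star> (ide A \<star> ins A q X)) \<cdot> (sw A A (A \<odot> opow A q X) \<cdot>
      ((ide A \<star> sw A A (opow A q X)) \<cdot> sw A A (A \<odot> opow A q X)))"
    by (simp flip: yang_baxter)
  also have "\<dots> = sw A A (A \<odot> opow A q X) \<cdot> ins A (Suc (Suc q)) X"
    using Comp2_ext[OF lpow_commute_swap[of "ins A q X", symmetric]] by simp
  finally show ?thesis .
qed

lemma can_Cons:
  assumes "x \<notin> set u"
  shows "can A (x # xs) (u @ x # v)
      = ins A (length u) (opow A (length v) \<I>) \<cdot> (ide A \<star> can A xs (u @ v))"
proof -
  have "takeWhile (\<lambda>y. y \<noteq> x) (u @ x # v) = u" "dropWhile (\<lambda>y. y \<noteq> x) (u @ x # v) = x # v"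
    using assms by (induction u) auto
  moreover have "remove1 x (u @ x # v) = u @ v" using assms by (simp add: remove1_append)
  ultimately show ?thesis by simp
qed

lemma can_simps [simp]:
  assumes "perm_words xs ys"
  shows "can A xs ys \<in> Arr C" "Dom C (can A xs ys) = opow A (length xs) \<I>"
    "Cod C (can A xs ys) = opow A (length xs) \<I>"
proof -
  have "can A xs ys \<in> Arr C \<and> Dom C (can A xs ys) = opow A (length xs) \<I> \<and> Cod C (can A xs ys)
      = opow A (length xs) \<I>"
    using assms
  proof (induction xs arbitrary: ys)
    case (Cons x xs)
    then obtain u v where *: "ys = u @ x # v" "x \<notin> set u" "perm_words xs (u @ v)"
      by (elim perm_words_ConsE)
    then show ?case using Cons.IH[OF *(3)] perm_words_length[OF *(3)]
      by (simp del: can.simps add: can_Cons)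
  qed simp
  then show "can A xs ys \<in> Arr C" "Dom C (can A xs ys) = opow A (length xs) \<I>"
    "Cod C (can A xs ys) = opow A (length xs) \<I>"
    by simp_all
qed

lemma can_Cons_Cons [simp]: "perm_words xs ys \<Longrightarrow> can A (x # xs) (x # ys) = ide A \<star> can A xs ys"
  using can_Cons[of x "[]" xs ys] perm_words_length[of xs ys] by (simp del: can.simps)

lemma can_self: "distinct xs \<Longrightarrow> can A xs xs = ide (opow A (length xs) \<I>)"
  by (induction xs) (simp_all del: can.simps(2) add: perm_words_refl)

lemma can_append_left:
  "distinct zs \<Longrightarrow> perm_words xs ys \<Longrightarrow> set zs \<inter> set xs = {} \<Longrightarrow> can A (zs @ xs) (zs @ ys)
      = lpow A (length zs) (can A xs ys)"
  by (induction zs) (simp_all del: can.simps(2) add: perm_words_append perm_words_refl)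

text \<open>The place of the first letter \<open>x\<close> of \<open>xs\<close> decides. If
  \<open>x\<close> lies in \<open>u\<close>, the swap happens behind the insertion point and
  \<open>ins_natural\<close> applies. If \<open>x\<close> is \<open>a\<close> or \<open>b\<close>,
  the swap is one further step of the insertion, by \<open>ins_add\<close>. If \<open>x\<close> lies
  in \<open>v\<close>, it crosses both exchanged factors and \<open>ins_sw\<close> applies.\<close>

lemma can_swap:
  "perm_words xs (u @ a # b # v) \<Longrightarrow>
    can A xs (u @ b # a # v)
        = lpow A (length u) (sw A A (opow A (length v) \<I>)) \<cdot> can A xs (u @ a # b # v)"
proof (induction xs arbitrary: u v)
  case (Cons x xs)
  note [simp del] = can.simps
  from Cons.prems have d: "distinct (x # xs)" "distinct (u @ a # b # v)"
    "set (x # xs) = set (u @ a # b # v)"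
    by (auto simp: perm_words_def)
  then consider (u) "x \<in> set u" | (a) "x = a" | (b) "x = b" | (v) "x \<in> set v" by auto
  then show ?case
  proof cases
    case u
    then obtain u1 u2 where u: "u = u1 @ x # u2" by (auto simp: in_set_conv_decomp)
    then have p: "perm_words xs (u1 @ u2 @ a # b # v)"
      using Cons.prems by (auto simp: perm_words_def)
    have x: "x \<notin> set u1" using d u by auto
    define h where "h = lpow A (length u2) (sw A A (opow A (length v) \<I>))"
    have [simp]: "h \<in> Arr C" "Dom C h = A \<odot> (A \<odot> opow A (length u2 + length v) \<I>)"
      "Cod C h = A \<odot> (A \<odot> opow A (length u2 + length v) \<I>)"
      unfolding h_def by (simp_all)
    have IH: "can A xs (u1 @ u2 @ b # a # v)
        = lpow A (length u1) h \<cdot> can A xs (u1 @ u2 @ a # b # v)"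
      using Cons.IH[of "u1 @ u2" v] p by (simp add: h_def)
    have "can A (x # xs) (u @ b # a # v)
        = ins A (length u1) (Cod C h) \<cdot> (ide A \<star> can A xs (u1 @ u2 @ b # a # v))"
      using can_Cons[OF x, of xs "u2 @ b # a # v"] by (simp add: u)
    also have "\<dots> = (ins A (length u1) (Cod C h) \<cdot> (ide A \<star> lpow A (length u1) h))
        \<cdot> (ide A \<star> can A xs (u1 @ u2 @ a # b # v))"
      using p perm_words_length[OF p] by (simp add: IH)
    also have "\<dots> = lpow A (length u1) (ide A \<star> h)
        \<cdot> (ins A (length u1) (Dom C h) \<cdot> (ide A \<star> can A xs (u1 @ u2 @ a # b # v)))"
      using p perm_words_length[OF p] by (subst ins_natural[of h]) simp_all
    also have "\<dots> = lpow A (length u1) (ide A \<star> h) \<cdot> can A (x # xs) (u @ a # b # v)"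
      using can_Cons[OF x, of xs "u2 @ a # b # v"] by (simp add: u)
    finally show ?thesis by (simp add: u h_def)
  next
    case a
    then have p: "perm_words xs (u @ b # v)"
      using Cons.prems by (auto simp: perm_words_def)
    have x: "a \<notin> set (u @ [b])" "a \<notin> set u" using d by auto
    have "can A (x # xs) (u @ b # a # v)
        = ins A (Suc (length u)) (opow A (length v) \<I>) \<cdot> (ide A \<star> can A xs (u @ b # v))"
      using can_Cons[OF x(1), of xs v] by (simp add: a)
    also have "ins A (Suc (length u)) (opow A (length v) \<I>)
      = lpow A (length u) (sw A A (opow A (length v) \<I>))
          \<cdot> ins A (length u) (A \<odot> opow A (length v) \<I>)"
      using ins_add[of "opow A (length v) \<I>" "length u" 1] by simp
    finally show ?thesis
      using can_Cons[OF x(2), of xs "b # v"] p perm_words_length[OF p] by (simp add: a)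
  next
    case b
    then have p: "perm_words xs (u @ a # v)"
      using Cons.prems by (auto simp: perm_words_def)
    have x: "b \<notin> set (u @ [a])" "b \<notin> set u" using d by auto
    let ?s = "lpow A (length u) (sw A A (opow A (length v) \<I>))"
    \<comment> \<open>Inserting \<open>b\<close> behind \<open>a\<close> takes the extra step here,
      so the equation is obtained with the two words exchanged and is then inverted, the swap being
      an involution.\<close>
    have s: "?s \<cdot> ?s = ide (opow A (length u + Suc (Suc (length v))) \<I>)"
      by (simp flip: lpow_Comp)
    have "can A (x # xs) (u @ a # b # v)
        = ins A (Suc (length u)) (opow A (length v) \<I>) \<cdot> (ide A \<star> can A xs (u @ a # v))"
      using can_Cons[OF x(1), of xs v] by (simp add: b)
    also have "ins A (Suc (length u)) (opow A (length v) \<I>)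
      = ?s \<cdot> ins A (length u) (A \<odot> opow A (length v) \<I>)"
      using ins_add[of "opow A (length v) \<I>" "length u" 1] by simp
    finally have "can A (x # xs) (u @ a # b # v) = ?s \<cdot> can A (x # xs) (u @ b # a # v)"
      using can_Cons[OF x(2), of xs "a # v"] p perm_words_length[OF p] by (simp add: b)
    then show ?thesis
      using Comp2_ext[OF s, of "can A (x # xs) (u @ b # a # v)"] perm_words_length[OF Cons.prems]
        perm_words_swap[OF Cons.prems]
      by simp
  next
    case v
    then obtain v1 v2 where v: "v = v1 @ x # v2" by (auto simp: in_set_conv_decomp)
    then have p: "perm_words xs (u @ a # b # v1 @ v2)"
      using Cons.prems by (auto simp: perm_words_def)
    have x: "x \<notin> set (u @ a # b # v1)" "x \<notin> set (u @ b # a # v1)" using d v by auto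
    let ?X = "opow A (length v2) \<I>" and ?q = "length v1"
    let ?I = "ins A (Suc (Suc ?q)) ?X"
    define h where "h = sw A A (opow A (length v1) ?X)"
    have h [simp]: "h \<in> Arr C" "Dom C h = A \<odot> (A \<odot> opow A (length v1 + length v2) \<I>)"
      "Cod C h = A \<odot> (A \<odot> opow A (length v1 + length v2) \<I>)"
      unfolding h_def by (simp_all)
    have IH: "can A xs (u @ b # a # v1 @ v2) = lpow A (length u) h \<cdot> can A xs (u @ a # b # v1 @ v2)"
      using Cons.IH[of u "v1 @ v2"] p by (simp add: h_def)
    have I: "ins A (length u + Suc (Suc ?q)) ?X = lpow A (length u) ?I \<cdot> ins A (length u) (Cod C h)"
      using ins_add[of ?X "length u" "Suc (Suc ?q)"] by simp
    have "(lpow A (length u) ?I \<cdot> ins A (length u) (Cod C h)) \<cdot> (ide A \<star> lpow A (length u) h)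
        = lpow A (length u) (?I \<cdot> (ide A \<star> h)) \<cdot> ins A (length u) (Cod C h)"
      using ins_natural[of h "length u"] by simp
    also have "?I \<cdot> (ide A \<star> h) = sw A A (opow A (length v) \<I>) \<cdot> ?I"
      unfolding h_def by (subst ins_sw) (simp_all add: v)
    finally have comm: "ins A (length u + Suc (Suc ?q)) ?X \<cdot> (ide A \<star> lpow A (length u) h)
       = lpow A (length u) (sw A A (opow A (length v) \<I>)) \<cdot> ins A (length u + Suc (Suc ?q)) ?X"
      unfolding I by (simp add: v)
    have "can A (x # xs) (u @ b # a # v)
        = ins A (length u + Suc (Suc ?q)) ?X \<cdot> (ide A \<star> can A xs (u @ b # a # v1 @ v2))"
      using can_Cons[OF x(2), of xs "v2"] by (simp add: v)
    also have "\<dots> = (ins A (length u + Suc (Suc ?q)) ?X \<cdot> (ide A \<star> lpow A (length u) h))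
        \<cdot> (ide A \<star> can A xs (u @ a # b # v1 @ v2))"
      using p perm_words_length[OF p] by (simp add: IH add.assoc)
    also have "\<dots> = lpow A (length u) (sw A A (opow A (length v) \<I>))
        \<cdot> (ins A (length u + Suc (Suc ?q)) ?X \<cdot> (ide A \<star> can A xs (u @ a # b # v1 @ v2)))"
      using p perm_words_length[OF p] by (simp only: comm) (simp add: v add.assoc)
    also have "\<dots> = lpow A (length u) (sw A A (opow A (length v) \<I>))
        \<cdot> can A (x # xs) (u @ a # b # v)"
      using can_Cons[OF x(1), of xs "v2"] by (simp add: v)
    finally show ?thesis .
  qed
qed simp

text \<open>\<open>can_swap\<close> splits the same last adjacent transposition off both
  sides.\<close>

lemma can_trans:
  assumes "perm_words xs ys" "perm_words ys zs"
  shows "can A ys zs \<cdot> can A xs ys = can A xs zs"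
  using assms(2)
proof (induction rule: perm_words_induct)
  case refl
  then show ?case using assms perm_words_length[OF assms(1)] by (simp add: can_self perm_words_def)
next
  case (swap u a b v)
  have p: "perm_words xs (u @ a # b # v)" using assms(1) swap.hyps perm_words_trans by blast
  show ?case
    unfolding can_swap[OF p] can_swap[OF swap.hyps] swap.IH[symmetric]
    using assms(1) swap.hyps perm_words_length[OF assms(1)] perm_words_length[OF swap.hyps] by simp
qed

text \<open>Labels merely name positions. Renaming them is what lets one permutation be described by
  whichever words suit the next step.\<close>

lemma can_map:
  assumes "perm_words xs ys" "inj_on h (set xs)"
  shows "can A (map h xs) (map h ys) = can A xs ys"
  using assms(1)
proof (induction rule: perm_words_induct)
  case refl
  then show ?case using assms by (simp add: can_self perm_words_def distinct_map)
next
  case (swap u a b v)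
  then show ?case
    using can_swap[of "map h xs" "map h u" "h a" "h b" "map h v"] can_swap[OF swap.hyps]
      perm_words_map[OF swap.hyps assms(2)] swap.IH by simp
qed

end

end

section \<open>Operations on blocks of factors\<close>

context symmetric_monoidal_category
begin

text \<open>\<open>f : A\<^sup>m \<rightarrow> B\<close> applied to the first \<open>m\<close> factors of \<open>A \<otimes> (\<dots> (A \<otimes> X))\<close>.\<close>

definition hat :: "'o \<Rightarrow> nat \<Rightarrow> 'm \<Rightarrow> 'o \<Rightarrow> 'm" where
  "hat A m f X = (f \<star> ide X) \<cdot> inv_arr C (app A m X)"

text \<open>The list \<open>fs\<close> pairs each arrow with the number of factors it consumes. The
  source is the flat tensor power, in contrast to \<open>tens_arr_list\<close>, which starts from a
  product of tensor powers; \<open>blocks_tens_concat\<close> relates the two.\<close>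

fun blocks :: "'o \<Rightarrow> (nat \<times> 'm) list \<Rightarrow> 'm" where
  "blocks A [] = ide \<I>"
| "blocks A ((m, f) # fs) = (ide A \<star> blocks A fs) \<cdot> hat A m f (opow A (sum_list (map fst fs)) \<I>)"

lemma tens_arr_list_simps [simp]:
  assumes "\<And>x. x \<in> set xs \<Longrightarrow> \<tau> x \<in> Arr C \<and> Dom C (\<tau> x) = A \<and> Cod C (\<tau> x) = B"
  shows "tens_arr_list C (map \<tau> xs) \<in> Arr C"
    "Dom C (tens_arr_list C (map \<tau> xs)) = opow A (length xs) \<I>"
    "Cod C (tens_arr_list C (map \<tau> xs)) = opow B (length xs) \<I>"
proof -
  have "tens_arr_list C (map \<tau> xs) \<in> Arr C \<and> Dom C (tens_arr_list C (map \<tau> xs))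
      = opow A (length xs) \<I>
    \<and> Cod C (tens_arr_list C (map \<tau> xs)) = opow B (length xs) \<I>"
    using assms by (induction xs) simp_all
  then show "tens_arr_list C (map \<tau> xs) \<in> Arr C"
    "Dom C (tens_arr_list C (map \<tau> xs)) = opow A (length xs) \<I>"
    "Cod C (tens_arr_list C (map \<tau> xs)) = opow B (length xs) \<I>" by simp_all
qed

lemma tens_arr_list_swap:
  assumes AB [simp]: "A \<in> Obj C" "B \<in> Obj C"
    and "\<And>x. x \<in> set (u @ a # b # v) \<Longrightarrow> \<tau> x \<in> Arr C \<and> Dom C (\<tau> x) = A \<and> Cod C (\<tau> x) = B"
  shows "tens_arr_list C (map \<tau> (u @ b # a # v)) \<cdot> lpow A (length u) (sw A A (opow A (length v) \<I>))
    = lpow B (length u) (sw B B (opow B (length v) \<I>)) \<cdot> tens_arr_list C (map \<tau> (u @ a # b # v))"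
  using assms(3)
proof (induction u)
  case Nil
  then show ?case using sw_natural[of "\<tau> a" "\<tau> b" "tens_arr_list C (map \<tau> v)"] by simp
next
  case (Cons x u)
  let ?L = "tens_arr_list C (map \<tau> (u @ b # a # v))" and ?s =
    "lpow A (length u) (sw A A (opow A (length v) \<I>))"
  let ?R = "tens_arr_list C (map \<tau> (u @ a # b # v))" and ?t =
    "lpow B (length u) (sw B B (opow B (length v) \<I>))"
  have L: "?L \<in> Arr C" "Dom C ?L = opow A (length u + Suc (Suc (length v))) \<I>"
    "Cod C ?L = opow B (length u + Suc (Suc (length v))) \<I>"
    using Cons.prems by (subst tens_arr_list_simps[where A=A and B=B]; force)+
  have R: "?R \<in> Arr C" "Dom C ?R = opow A (length u + Suc (Suc (length v))) \<I>"
    "Cod C ?R = opow B (length u + Suc (Suc (length v))) \<I>"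
    using Cons.prems by (subst tens_arr_list_simps[where A=A and B=B]; force)+
  have "(\<tau> x \<star> ?L) \<cdot> (ide A \<star> ?s) = \<tau> x \<star> (?L \<cdot> ?s)"
    using L Cons.prems[of x] by (subst interchange) simp_all
  also have "?L \<cdot> ?s = ?t \<cdot> ?R" by (rule Cons.IH) (use Cons.prems in auto)
  also have "\<tau> x \<star> (?t \<cdot> ?R) = (ide B \<star> ?t) \<cdot> (\<tau> x \<star> ?R)"
    using R Cons.prems[of x] by (subst interchange) simp_all
  finally show ?case by simp
qed

text \<open>The arrows are indexed by labels and so travel with their factors. One adjacent
  transposition is \<open>tens_arr_list_swap\<close>, that is, naturality of the symmetry.\<close>

lemma can_natural:
  assumes AB [simp]: "A \<in> Obj C" "B \<in> Obj C"
    and p: "perm_words xs ys"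
    and \<tau>: "\<And>x. x \<in> set xs \<Longrightarrow> \<tau> x \<in> Arr C \<and> Dom C (\<tau> x) = A \<and> Cod C (\<tau> x) = B"
  shows "tens_arr_list C (map \<tau> ys) \<cdot> can A xs ys = can B xs ys \<cdot> tens_arr_list C (map \<tau> xs)"
  using p
proof (induction rule: perm_words_induct)
  case refl
  note * = tens_arr_list_simps[of xs \<tau> A B, OF \<tau>]
  show ?case using p * by (simp add: can_self perm_words_def)
next
  case (swap u a b v)
  have \<tau>': "\<tau> x \<in> Arr C \<and> Dom C (\<tau> x) = A \<and> Cod C (\<tau> x) = B" if "x \<in> set (u @ a # b # v)" for x
    using swap.hyps \<tau> that by (auto simp: perm_words_def)
  have \<tau>'': "\<tau> x \<in> Arr C \<and> Dom C (\<tau> x) = A \<and> Cod C (\<tau> x) = B" if "x \<in> set (u @ b # a # v)" for x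
    using \<tau>' that by auto
  note len = perm_words_length[OF swap.hyps]
  note T = tens_arr_list_simps[of xs \<tau> A B, OF \<tau>]
    tens_arr_list_simps[of "u @ a # b # v" \<tau> A B, OF \<tau>']
    tens_arr_list_simps[of "u @ b # a # v" \<tau> A B, OF \<tau>'']
  have "tens_arr_list C (map \<tau> (u @ b # a # v)) \<cdot> can A xs (u @ b # a # v)
      = (tens_arr_list C (map \<tau> (u @ b # a # v)) \<cdot> lpow A (length u) (sw A A (opow A (length v) \<I>)))
          \<cdot> can A xs (u @ a # b # v)"
    unfolding can_swap[OF AB(1) swap.hyps] using swap.hyps len T(7-)
    by (subst Comp_assoc_right) simp_all
  also have "\<dots> = lpow B (length u) (sw B B (opow B (length v) \<I>))
      \<cdot> (tens_arr_list C (map \<tau> (u @ a # b # v)) \<cdot> can A xs (u @ a # b # v))"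
    by (subst tens_arr_list_swap[of A B u a b v \<tau>, OF AB \<tau>'], assumption, subst Comp_assoc_right)
      (use swap.hyps len T(4-6) in simp_all)
  also have "\<dots> = can B xs (u @ b # a # v) \<cdot> tens_arr_list C (map \<tau> xs)"
    unfolding can_swap[OF AB(2) swap.hyps] swap.IH using swap.hyps len T(1-3)
    by (subst Comp_assoc_right) simp_all
  finally show ?case .
qed

context
  fixes A
  assumes A [simp]: "A \<in> Obj C"
begin

text \<open>Joining \<open>X\<close> changes only what stands behind the two exchanged factors. With
  nothing in front this is \<open>sw_associator_right\<close>; each further factor in front is
  passed by naturality of the associator.\<close>

lemma app_swap:
  assumes X [simp]: "X \<in> Obj C"
  shows "app A (p + Suc (Suc q)) X \<cdot> (lpow A p (sw A A (opow A q \<I>)) \<star> ide X)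
    = lpow A p (sw A A (opow A q X)) \<cdot> app A (p + Suc (Suc q)) X"
proof (induction p)
  case 0
  let ?Y = "opow A q \<I>"
  have "app A (0 + Suc (Suc q)) X \<cdot> (lpow A 0 (sw A A ?Y) \<star> ide X)
      = (ide A \<star> (ide A \<star> app A q X))
          \<cdot> ((ide A \<star> \<alpha> A ?Y X) \<cdot> (\<alpha> A (A \<odot> ?Y) X \<cdot> (sw A A ?Y \<star> ide X)))"
    by simp
  also have "\<dots> = (ide A \<star> (ide A \<star> app A q X))
      \<cdot> (sw A A (?Y \<odot> X) \<cdot> ((ide A \<star> \<alpha> A ?Y X) \<cdot> \<alpha> A (A \<odot> ?Y) X))"
    by (simp add: sw_associator_right)
  also have "\<dots> = lpow A 0 (sw A A (opow A q X)) \<cdot> app A (0 + Suc (Suc q)) X"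
    using Comp2_ext[OF lpow_commute_swap[OF A, of "app A q X", symmetric]] by simp
  finally show ?case .
next
  case (Suc p)
  let ?s = "lpow A p (sw A A (opow A q \<I>))" and ?n = "p + Suc (Suc q)"
  have "app A (Suc ?n) X \<cdot> ((ide A \<star> ?s) \<star> ide X)
      = (ide A \<star> (app A ?n X \<cdot> (?s \<star> ide X))) \<cdot> \<alpha> A (opow A ?n \<I>) X"
    using associator_natural[of "ide A" ?s "ide X"] by simp
  also have "\<dots> = (ide A \<star> lpow A p (sw A A (opow A q X))) \<cdot> app A (Suc ?n) X"
    unfolding Suc.IH by simp
  finally show ?case by simp
qed

text \<open>A block may be permuted before or after it is joined to the remaining factors; one
  adjacent transposition is \<open>app_swap\<close>.\<close>

lemma can_append_right:
  assumes p: "perm_words xs ys" and zs: "distinct zs" "set xs \<inter> set zs = {}"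
  shows "app A (length xs) (opow A (length zs) \<I>) \<cdot> (can A xs ys \<star> ide (opow A (length zs) \<I>))
    = can A (xs @ zs) (ys @ zs) \<cdot> app A (length xs) (opow A (length zs) \<I>)"
  using p
proof (induction rule: perm_words_induct)
  case refl
  have "distinct xs" "distinct (xs @ zs)" using p zs by (auto simp: perm_words_def)
  then show ?case by (simp add: can_self)
next
  case (swap u a b v)
  have p': "perm_words (xs @ zs) (u @ a # b # v @ zs)"
    using perm_words_append[OF swap.hyps perm_words_refl[OF zs(1)] zs(2)] by simp
  note len = perm_words_length[OF swap.hyps]
  let ?X = "opow A (length zs) \<I>"
  let ?s = "lpow A (length u) (sw A A (opow A (length v) \<I>))"
  have n: "length xs = length u + Suc (Suc (length v))" using len by simp
  have "app A (length xs) ?X \<cdot> (can A xs (u @ b # a # v) \<star> ide ?X)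
      = (app A (length xs) ?X \<cdot> (?s \<star> ide ?X)) \<cdot> (can A xs (u @ a # b # v) \<star> ide ?X)"
    unfolding can_swap[OF A swap.hyps] using swap.hyps len by simp
  also have "\<dots> = lpow A (length u) (sw A A (opow A (length v) ?X))
      \<cdot> (app A (length xs) ?X \<cdot> (can A xs (u @ a # b # v) \<star> ide ?X))"
    unfolding n by (subst app_swap) (use swap.hyps len in \<open>simp_all add: add.assoc\<close>)
  also have "\<dots> = can A (xs @ zs) ((u @ b # a # v) @ zs) \<cdot> app A (length xs) ?X"
    unfolding swap.IH using can_swap[OF A p'] p' len by (simp add: add.assoc)
  finally show ?case .
qed

text \<open>Crossing a tensor power as one object equals crossing its factors one by one after
  joining. The inductive step is \<open>sw_hexagon\<close>; the empty power is unit coherence,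
  through \<open>lunitor_tens\<close> and \<open>lunitor_symmetry\<close>.\<close>

lemma app_sw:
  assumes X [simp]: "X \<in> Obj C"
  shows "app A m (A \<odot> X) \<cdot> sw A (opow A m \<I>) X = ins A m X \<cdot> (ide A \<star> app A m X)"
proof (induction m)
  case 0
  have "(lun (A \<odot> X) \<cdot> sw A \<I> X) \<cdot> \<alpha> A \<I> X = (ide A \<star> lun X) \<cdot> \<alpha> A \<I> X"
  proof -
    have "(lun (A \<odot> X) \<cdot> sw A \<I> X) \<cdot> \<alpha> A \<I> X = (lun (A \<odot> X) \<cdot> \<alpha> \<I> A X) \<cdot> (sym A \<I> \<star> ide X)"
      by (simp add: sw_associator)
    also have "\<dots> = (lun A \<cdot> sym A \<I>) \<star> ide X" by (simp add: lunitor_tens)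
    also have "\<dots> = (ide A \<star> lun X) \<cdot> \<alpha> A \<I> X" by (simp add: lunitor_symmetry triangle)
    finally show ?thesis .
  qed
  then have "lun (A \<odot> X) \<cdot> sw A \<I> X = ide A \<star> lun X" by (rule cancel_epi[rotated]) simp_all
  then show ?case by simp
next
  case (Suc m)
  let ?Y = "opow A m \<I>"
  have "app A (Suc m) (A \<odot> X) \<cdot> sw A (opow A (Suc m) \<I>) X
      = (ide A \<star> (app A m (A \<odot> X) \<cdot> sw A ?Y X)) \<cdot> (sw A A (?Y \<odot> X) \<cdot> (ide A \<star> \<alpha> A ?Y X))"
    by (simp add: sw_hexagon)
  also have "\<dots> = (ide A \<star> ins A m X)
      \<cdot> ((ide A \<star> (ide A \<star> app A m X)) \<cdot> (sw A A (?Y \<odot> X) \<cdot> (ide A \<star> \<alpha> A ?Y X)))"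
    unfolding Suc.IH by simp
  also have "\<dots> = ins A (Suc m) X \<cdot> (ide A \<star> app A (Suc m) X)"
    using Comp2_ext[OF lpow_commute_swap[OF A, of "app A m X", symmetric]] by simp
  finally show ?case .
qed

lemma hat_simps [simp]:
  assumes "f \<in> Arr C" "Dom C f = opow A m \<I>" "X \<in> Obj C"
  shows "hat A m f X \<in> Arr C" "Dom C (hat A m f X) = opow A m X" "Cod C (hat A m f X) = Cod C f \<odot> X"
    "hat A m f X \<cdot> app A m X = f \<star> ide X"
  using assms by (simp_all add: hat_def)

lemma hat_eqI:
  assumes "h \<cdot> app A m X = f \<star> ide X" "h \<in> Arr C" "Dom C h = opow A m X"
    "f \<in> Arr C" "Dom C f = opow A m \<I>" "X \<in> Obj C"
  shows "hat A m f X = h"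
  by (rule cancel_epi[of "app A m X"]) (use assms in simp_all)

lemma hat_natural:
  assumes "f \<in> Arr C" "Dom C f = opow A m \<I>" "h \<in> Arr C" "D = Cod C f"
  shows "hat A m f (Cod C h) \<cdot> lpow A m h = (ide D \<star> h) \<cdot> hat A m f (Dom C h)"
proof (rule cancel_epi)
  show "iso_arr C (app A m (Dom C h))" using assms by simp
  have "(hat A m f (Cod C h) \<cdot> lpow A m h) \<cdot> app A m (Dom C h)
      = (hat A m f (Cod C h) \<cdot> app A m (Cod C h)) \<cdot> (ide (opow A m \<I>) \<star> h)"
    using assms(1-3) by (simp del: hat_simps(4) add: app_natural)
  also have "\<dots> = ((ide D \<star> h) \<cdot> hat A m f (Dom C h)) \<cdot> app A m (Dom C h)"
    using assms by (simp add: whisker_commute)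
  finally show "(hat A m f (Cod C h) \<cdot> lpow A m h) \<cdot> app A m (Dom C h)
    = ((ide D \<star> h) \<cdot> hat A m f (Dom C h)) \<cdot> app A m (Dom C h)" .
qed (use assms in simp_all)

lemma hat_Comp:
  assumes "f \<in> Arr C" "Dom C f = opow A m \<I>" "t \<in> Arr C" "Dom C t = Cod C f" "X \<in> Obj C"
  shows "hat A m (t \<cdot> f) X = (t \<star> ide X) \<cdot> hat A m f X"
  using assms by (simp add: hat_def)

text \<open>By \<open>app_sw\<close> the insertion past the block is the switch with the whole
  tensor power, and the switch is natural in \<open>f\<close>.\<close>

lemma hat_ins:
  assumes f: "f \<in> Arr C" "Dom C f = opow A m \<I>" "Cod C f = A" and X [simp]: "X \<in> Obj C"
  shows "hat A m f (A \<odot> X) \<cdot> ins A m X = sw A A X \<cdot> (ide A \<star> hat A m f X)"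
proof (rule cancel_epi)
  show "iso_arr C (ide A \<star> app A m X)" by simp
  have "(hat A m f (A \<odot> X) \<cdot> ins A m X) \<cdot> (ide A \<star> app A m X)
      = (hat A m f (A \<odot> X) \<cdot> app A m (A \<odot> X)) \<cdot> sw A (opow A m \<I>) X"
    using f by (simp del: hat_simps(4) add: app_sw)
  also have "\<dots> = sw A A X \<cdot> (ide A \<star> (f \<star> ide X))"
    using f sw_natural[of "ide A" f "ide X"] by simp
  also have "\<dots> = (sw A A X \<cdot> (ide A \<star> hat A m f X)) \<cdot> (ide A \<star> app A m X)"
    using f by (simp flip: whisker_Comp)
  finally show "(hat A m f (A \<odot> X) \<cdot> ins A m X) \<cdot> (ide A \<star> app A m X)
    = (sw A A X \<cdot> (ide A \<star> hat A m f X)) \<cdot> (ide A \<star> app A m X)" .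
qed (use f in simp_all)

text \<open>This is \<open>hat_ins\<close> solved for the other side: the switch is an involution,
  and \<open>can_trans\<close> inverts the insertion. The labels serve to name that inverse.\<close>

lemma sw_hat:
  assumes f: "f \<in> Arr C" "Dom C f = opow A (length ks) \<I>" "Cod C f = A"
    and d: "distinct (ks @ y # rs)"
  shows "sw A A (opow A (length rs) \<I>) \<cdot> hat A (length ks) f (A \<odot> opow A (length rs) \<I>)
    = (ide A \<star> hat A (length ks) f (opow A (length rs) \<I>)) \<cdot> can A (ks @ y # rs) (y # ks @ rs)"
proof -
  let ?X = "opow A (length rs) \<I>" and ?m = "length ks"
  let ?c = "can A (ks @ y # rs) (y # ks @ rs)"
  have p: "perm_words (ks @ y # rs) (y # ks @ rs)" "perm_words (y # ks @ rs) (ks @ y # rs)"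
    using d by (auto simp: perm_words_def)
  have i: "ins A ?m ?X = can A (y # ks @ rs) (ks @ y # rs)"
    using d by (subst can_Cons) (simp_all add: can_self)
  have "ins A ?m ?X \<cdot> ?c = ide (opow A (length (ks @ y # rs)) \<I>)"
    unfolding i using d p by (subst can_trans) (simp_all add: can_self)
  then have "sw A A ?X \<cdot> hat A ?m f (A \<odot> ?X)
      = sw A A ?X \<cdot> (hat A ?m f (A \<odot> ?X) \<cdot> (ins A ?m ?X \<cdot> ?c))"
    using f by simp
  also have "\<dots> = sw A A ?X \<cdot> ((hat A ?m f (A \<odot> ?X) \<cdot> ins A ?m ?X) \<cdot> ?c)"
    using f p by (subst Comp_assoc_right) simp_all
  also have "\<dots> = sw A A ?X \<cdot> (sw A A ?X \<cdot> ((ide A \<star> hat A ?m f ?X) \<cdot> ?c))"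
    using f p by (subst hat_ins) simp_all
  also have "\<dots> = (ide A \<star> hat A ?m f ?X) \<cdot> ?c"
    using f p Comp2_ext[OF sw_sw, of A A ?X "(ide A \<star> hat A ?m f ?X) \<cdot> ?c"] by simp
  finally show ?thesis .
qed

text \<open>The result of the block crosses the factors \<open>ms\<close> one at a time by
  \<open>sw_hat\<close>, and \<open>can_trans\<close> collects the permutations.\<close>

lemma ins_hat:
  assumes f: "f \<in> Arr C" "Dom C f = opow A (length ks) \<I>" "Cod C f = A"
    and d: "distinct (ks @ ms @ rs)"
  shows "ins A (length ms) (opow A (length rs) \<I>)
      \<cdot> hat A (length ks) f (opow A (length ms + length rs) \<I>)
    = lpow A (length ms) (hat A (length ks) f (opow A (length rs) \<I>))
        \<cdot> can A (ks @ ms @ rs) (ms @ ks @ rs)"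
  using d
proof (induction ms)
  case Nil
  then show ?case using f by (simp add: can_self)
next
  case (Cons y ms)
  let ?X = "opow A (length rs) \<I>" and ?m = "length ks" and ?n = "length ms"
  have p: "perm_words (ks @ ms @ rs) (ms @ ks @ rs)"
    "perm_words (ks @ y # ms @ rs) (y # ks @ ms @ rs)"
    "perm_words (y # ks @ ms @ rs) (y # ms @ ks @ rs)"
    using Cons.prems by (auto simp: perm_words_def)
  have "ins A (Suc ?n) ?X \<cdot> hat A ?m f (opow A (Suc ?n + length rs) \<I>)
      = (ide A \<star> ins A ?n ?X)
          \<cdot> (sw A A (opow A (length (ms @ rs)) \<I>) \<cdot> hat A ?m f (A \<odot> opow A (length (ms @ rs)) \<I>))"
    using f by simp
  also have "\<dots> = (ide A \<star> (ins A ?n ?X \<cdot> hat A ?m f (opow A (?n + length rs) \<I>)))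
      \<cdot> can A (ks @ y # ms @ rs) (y # ks @ ms @ rs)"
    using f Cons.prems p by (subst sw_hat) (simp_all add: add.left_commute)
  also have "\<dots> = (ide A \<star> lpow A ?n (hat A ?m f ?X))
      \<cdot> (can A (y # ks @ ms @ rs) (y # ms @ ks @ rs) \<cdot> can A (ks @ y # ms @ rs) (y # ks @ ms @ rs))"
    using f Cons.prems p by (subst Cons.IH) (simp_all add: add.left_commute del: can.simps)
  also have "\<dots> = (ide A \<star> lpow A ?n (hat A ?m f ?X)) \<cdot> can A (ks @ y # ms @ rs) (y # ms @ ks @ rs)"
    using p by (subst can_trans) simp_all
  finally show ?case by simp
qed

end

text \<open>Blocks indexed by labels: block \<open>i\<close> consists of the factors labelled \<open>l i\<close>, to which \<open>f i\<close> is applied.\<close>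

definition lblocks :: "'o \<Rightarrow> ('l \<Rightarrow> 'k list) \<Rightarrow> ('l \<Rightarrow> 'm) \<Rightarrow> 'l list \<Rightarrow> 'm" where
  "lblocks A l f is = blocks A (map (\<lambda>i. (length (l i), f i)) is)"

lemma lblocks_Nil [simp]: "lblocks A l f [] = ide \<I>"
  by (simp add: lblocks_def)

lemma lblocks_Cons [simp]:
  "lblocks A l f (i # is)
      = (ide A \<star> lblocks A l f is)
          \<cdot> hat A (length (l i)) (f i) (opow A (length (concat (map l is))) \<I>)"
  by (simp add: lblocks_def comp_def length_concat)

definition block_family :: "'o \<Rightarrow> ('l \<Rightarrow> 'k list) \<Rightarrow> ('l \<Rightarrow> 'm) \<Rightarrow> 'l list \<Rightarrow> bool" where
  "block_family A l f is
      \<longleftrightarrow> (\<forall>i\<in>set is. f i \<in> Arr C \<and> Dom C (f i) = opow A (length (l i)) \<I> \<and> Cod C (f i) = A)"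

lemma block_family_simps [simp]:
  "block_family A l f []"
  "block_family A l f (i # is) \<longleftrightarrow>
    (f i \<in> Arr C \<and> Dom C (f i) = opow A (length (l i)) \<I> \<and> Cod C (f i) = A) \<and> block_family A l f is"
  "block_family A l f (is @ js) \<longleftrightarrow> block_family A l f is \<and> block_family A l f js"
  by (auto simp: block_family_def)

context
  fixes A
  assumes A [simp]: "A \<in> Obj C"
begin

lemma lblocks_simps [simp]:
  assumes "block_family A l f is"
  shows "lblocks A l f is \<in> Arr C"
    "Dom C (lblocks A l f is) = opow A (length (concat (map l is))) \<I>"
    "Cod C (lblocks A l f is) = opow A (length is) \<I>"
proof -
  have "lblocks A l f is \<in> Arr C \<and> Dom C (lblocks A l f is) = opow A (length (concat (map l is))) \<I>
    \<and> Cod C (lblocks A l f is) = opow A (length is) \<I>"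
    using assms by (induction "is") simp_all
  then show "lblocks A l f is \<in> Arr C"
    "Dom C (lblocks A l f is) = opow A (length (concat (map l is))) \<I>"
    "Cod C (lblocks A l f is) = opow A (length is) \<I>" by simp_all
qed

text \<open>Exchanging two results becomes exchanging their blocks in two moves. By
  \<open>hat_ins\<close> the result of \<open>a\<close> crosses the factors of block
  \<open>b\<close> in place of their result; by \<open>ins_hat\<close> the factors of block
  \<open>a\<close> then cross in place of theirs. Naturality of \<open>hat\<close> restores the
  order of the two operations.\<close>

lemma lblocks_swap:
  assumes "block_family A l f (u @ a # b # v)" "distinct (concat (map l (u @ a # b # v)))"
  shows "lpow A (length u) (sw A A (opow A (length v) \<I>)) \<cdot> lblocks A l f (u @ a # b # v)
    = lblocks A l f (u @ b # a # v)
        \<cdot> can A (concat (map l (u @ a # b # v))) (concat (map l (u @ b # a # v)))"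
  using assms
proof (induction u)
  case Nil
  let ?V = "lblocks A l f v" and ?r = "concat (map l v)"
  let ?X = "opow A (length ?r) \<I>"
  let ?ha = "hat A (length (l a)) (f a)" and ?hb = "hat A (length (l b)) (f b)"
  let ?c = "can A (l a @ l b @ ?r) (l b @ l a @ ?r)"
  have V: "?V \<in> Arr C" "Dom C ?V = ?X" "Cod C ?V = opow A (length v) \<I>"
    using Nil.prems by simp_all
  have fa: "f a \<in> Arr C" "Dom C (f a) = opow A (length (l a)) \<I>" "Cod C (f a) = A"
    and fb: "f b \<in> Arr C" "Dom C (f b) = opow A (length (l b)) \<I>" "Cod C (f b) = A"
    using Nil.prems by simp_all
  have d: "distinct (l a @ l b @ ?r)" "distinct (l b @ l a @ ?r)" using Nil.prems by auto
  have p: "perm_words (l a @ l b @ ?r) (l b @ l a @ ?r)" using d by (auto simp: perm_words_def)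
  have X: "?X \<in> Obj C" by simp
  have "sw A A (opow A (length v) \<I>) \<cdot> lblocks A l f (a # b # v)
      = (sw A A (opow A (length v) \<I>) \<cdot> (ide A \<star> (ide A \<star> ?V)))
          \<cdot> ((ide A \<star> ?hb ?X) \<cdot> ?ha (opow A (length (l b) + length ?r) \<I>))"
    using V fa fb by simp
  also have "sw A A (opow A (length v) \<I>) \<cdot> (ide A \<star> (ide A \<star> ?V))
      = (ide A \<star> (ide A \<star> ?V)) \<cdot> sw A A ?X"
    using lpow_commute_swap[OF A V(1)] V by simp
  also have "((ide A \<star> (ide A \<star> ?V)) \<cdot> sw A A ?X)
      \<cdot> ((ide A \<star> ?hb ?X) \<cdot> ?ha (opow A (length (l b) + length ?r) \<I>))
     = (ide A \<star> (ide A \<star> ?V))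
         \<cdot> ((sw A A ?X \<cdot> (ide A \<star> ?hb ?X)) \<cdot> ?ha (opow A (length (l b) + length ?r) \<I>))"
    using V fa fb by simp
  also have "sw A A ?X \<cdot> (ide A \<star> ?hb ?X) = ?hb (A \<odot> ?X) \<cdot> ins A (length (l b)) ?X"
    by (rule hat_ins[OF A fb X, symmetric])
  also have "(?hb (A \<odot> ?X) \<cdot> ins A (length (l b)) ?X) \<cdot> ?ha (opow A (length (l b) + length ?r) \<I>)
     = ?hb (A \<odot> ?X) \<cdot> (ins A (length (l b)) ?X \<cdot> ?ha (opow A (length (l b) + length ?r) \<I>))"
    using fa fb by simp
  also have "ins A (length (l b)) ?X \<cdot> ?ha (opow A (length (l b) + length ?r) \<I>)
      = lpow A (length (l b)) (?ha ?X) \<cdot> ?c"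
    by (rule ins_hat[OF A fa d(1)])
  also have "?hb (A \<odot> ?X) \<cdot> (lpow A (length (l b)) (?ha ?X) \<cdot> ?c)
      = (?hb (Cod C (?ha ?X)) \<cdot> lpow A (length (l b)) (?ha ?X)) \<cdot> ?c"
    using fa fb p by (simp add: add.left_commute)
  also have "?hb (Cod C (?ha ?X)) \<cdot> lpow A (length (l b)) (?ha ?X)
      = (ide A \<star> ?ha ?X) \<cdot> ?hb (Dom C (?ha ?X))"
    by (rule hat_natural[OF A fb(1,2)]) (use fa fb in simp_all)
  also have "(ide A \<star> (ide A \<star> ?V)) \<cdot> (((ide A \<star> ?ha ?X) \<cdot> ?hb (Dom C (?ha ?X))) \<cdot> ?c)
      = lblocks A l f (b # a # v) \<cdot> ?c"
    using V fa fb p by (simp add: add.left_commute)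
  finally show ?case by simp
next
  case (Cons x u)
  let ?r = "concat (map l (u @ a # b # v))" and ?s = "concat (map l (u @ b # a # v))"
  let ?L = "lblocks A l f (u @ a # b # v)" and ?R = "lblocks A l f (u @ b # a # v)"
  let ?m = "length (l x)"
  have fx: "f x \<in> Arr C" "Dom C (f x) = opow A ?m \<I>" "Cod C (f x) = A"
    and d: "distinct ?r" "distinct (l x @ ?r)" and bf: "block_family A l f (u @ a # b # v)"
    "block_family A l f (u @ b # a # v)"
    using Cons.prems by auto
  have p: "perm_words ?r ?s" using d by (auto simp: perm_words_def)
  have len: "length ?s = length ?r" using perm_words_length[OF p] by simp
  have c: "can A (l x @ ?r) (l x @ ?s) = lpow A ?m (can A ?r ?s)"
    using d p by (intro can_append_left) auto
  note L = lblocks_simps[OF bf(1)] and R = lblocks_simps[OF bf(2)]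
  have "(ide A \<star> lpow A (length u) (sw A A (opow A (length v) \<I>)))
      \<cdot> ((ide A \<star> ?L) \<cdot> hat A ?m (f x) (opow A (length ?r) \<I>))
      = (ide A \<star> (lpow A (length u) (sw A A (opow A (length v) \<I>)) \<cdot> ?L))
          \<cdot> hat A ?m (f x) (opow A (length ?r) \<I>)"
    using L fx by simp
  also have "lpow A (length u) (sw A A (opow A (length v) \<I>)) \<cdot> ?L = ?R \<cdot> can A ?r ?s"
    by (rule Cons.IH[OF bf(1) d(1)])
  also have "(ide A \<star> (?R \<cdot> can A ?r ?s)) \<cdot> hat A ?m (f x) (opow A (length ?r) \<I>)
      = (ide A \<star> ?R) \<cdot> ((ide A \<star> can A ?r ?s) \<cdot> hat A ?m (f x) (Dom C (can A ?r ?s)))"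
    using R fx p len by (simp del: map_append concat_append)
  also have "(ide A \<star> can A ?r ?s) \<cdot> hat A ?m (f x) (Dom C (can A ?r ?s))
      = hat A ?m (f x) (Cod C (can A ?r ?s)) \<cdot> lpow A ?m (can A ?r ?s)"
    by (rule hat_natural[OF A fx(1,2), symmetric]) (use p fx in simp_all)
  also have "(ide A \<star> ?R) \<cdot> (hat A ?m (f x) (Cod C (can A ?r ?s)) \<cdot> lpow A ?m (can A ?r ?s))
      = ((ide A \<star> ?R) \<cdot> hat A ?m (f x) (opow A (length ?s) \<I>)) \<cdot> lpow A ?m (can A ?r ?s)"
    using R fx p len by (simp del: map_append concat_append)
  also have "lpow A ?m (can A ?r ?s) = can A (l x @ ?r) (l x @ ?s)" by (rule c[symmetric])
  finally show ?case by simp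
qed

text \<open>Induction over adjacent transpositions of the block labels; \<open>lblocks_swap\<close>
  treats one of them and \<open>can_trans\<close> merges the permutations of factors.\<close>

lemma lblocks_natural:
  assumes p: "perm_words is js" and bf: "block_family A l f is"
    and d: "distinct (concat (map l is))"
  shows "can A is js \<cdot> lblocks A l f is
      = lblocks A l f js \<cdot> can A (concat (map l is)) (concat (map l js))"
  using p
proof (induction rule: perm_words_induct)
  case refl
  show ?case using p bf d by (simp add: can_self perm_words_def)
next
  case (swap u a b v)
  have bf': "block_family A l f (u @ a # b # v)" "block_family A l f (u @ b # a # v)"
    using bf swap.hyps by (auto simp: block_family_def perm_words_def)
  have p1: "perm_words (concat (map l is)) (concat (map l (u @ a # b # v)))"
    by (rule perm_words_concat[OF swap.hyps d])
  have p2: "perm_words (concat (map l (u @ a # b # v))) (concat (map l (u @ b # a # v)))"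
    using p1 by (auto simp: perm_words_def)
  note len = perm_words_length[OF swap.hyps] perm_words_length[OF p1] perm_words_length[OF p2]
  note T = lblocks_simps[OF bf] lblocks_simps[OF bf'(1)] lblocks_simps[OF bf'(2)]
  let ?s = "lpow A (length u) (sw A A (opow A (length v) \<I>))"
  have "can A is (u @ b # a # v) \<cdot> lblocks A l f is
      = ?s \<cdot> (can A is (u @ a # b # v) \<cdot> lblocks A l f is)"
    unfolding can_swap[OF A swap.hyps] using swap.hyps len T(1-3)
    by (subst Comp_assoc_right) simp_all
  also have "\<dots> = (?s \<cdot> lblocks A l f (u @ a # b # v))
      \<cdot> can A (concat (map l is)) (concat (map l (u @ a # b # v)))"
    unfolding swap.IH using p1 len T(4-6) by (subst Comp_assoc_right) simp_all
  also have "?s \<cdot> lblocks A l f (u @ a # b # v)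
      = lblocks A l f (u @ b # a # v)
          \<cdot> can A (concat (map l (u @ a # b # v))) (concat (map l (u @ b # a # v)))"
    by (rule lblocks_swap[OF bf'(1)]) (use p1 in \<open>simp add: perm_words_def\<close>)
  also have "(lblocks A l f (u @ b # a # v)
      \<cdot> can A (concat (map l (u @ a # b # v))) (concat (map l (u @ b # a # v))))
      \<cdot> can A (concat (map l is)) (concat (map l (u @ a # b # v)))
    = lblocks A l f (u @ b # a # v) \<cdot> can A (concat (map l is)) (concat (map l (u @ b # a # v)))"
    using p1 p2 len T(7-) can_trans[OF A p1 p2]
    by (subst Comp_assoc_right) (simp_all del: map_append concat_append)
  finally show ?case .
qed

end

section \<open>Arrows and permutations absorbed by blocks\<close>

context
  fixes A
  assumes A [simp]: "A \<in> Obj C"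
begin

lemma app_tens_arr_list:
  assumes "\<And>x. x \<in> set ks \<union> set rs \<Longrightarrow> \<tau> x \<in> Arr C \<and> Dom C (\<tau> x) = A \<and> Cod C (\<tau> x) = A"
  shows "app A (length ks) (opow A (length rs) \<I>)
      \<cdot> (tens_arr_list C (map \<tau> ks) \<star> tens_arr_list C (map \<tau> rs))
    = tens_arr_list C (map \<tau> (ks @ rs)) \<cdot> app A (length ks) (opow A (length rs) \<I>)"
  using assms
proof (induction ks)
  case Nil
  have "tens_arr_list C (map \<tau> rs) \<in> Arr C"
    "Dom C (tens_arr_list C (map \<tau> rs)) = opow A (length rs) \<I>"
    "Cod C (tens_arr_list C (map \<tau> rs)) = opow A (length rs) \<I>"
    using Nil by (auto simp: tens_arr_list_simps[where A=A and B=A])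
  then show ?case using lunitor_natural[of "tens_arr_list C (map \<tau> rs)"] by simp
next
  case (Cons x ks)
  let ?K = "tens_arr_list C (map \<tau> ks)" and ?R = "tens_arr_list C (map \<tau> rs)"
  let ?X = "opow A (length rs) \<I>"
  have R: "?R \<in> Arr C" "Dom C ?R = ?X" "Cod C ?R = ?X"
    using Cons.prems by (auto simp: tens_arr_list_simps[where A=A and B=A])
  have K: "?K \<in> Arr C" "Dom C ?K = opow A (length ks) \<I>" "Cod C ?K = opow A (length ks) \<I>"
    using Cons.prems by (auto simp: tens_arr_list_simps[where A=A and B=A])
  have KR: "tens_arr_list C (map \<tau> (ks @ rs)) \<in> Arr C"
    "Dom C (tens_arr_list C (map \<tau> (ks @ rs))) = opow A (length ks + length rs) \<I>"
     "Cod C (tens_arr_list C (map \<tau> (ks @ rs))) = opow A (length ks + length rs) \<I>"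
    using Cons.prems by (subst tens_arr_list_simps[where A=A and B=A]; force)+
  have x: "\<tau> x \<in> Arr C" "Dom C (\<tau> x) = A" "Cod C (\<tau> x) = A" using Cons.prems by auto
  have "app A (Suc (length ks)) ?X \<cdot> ((\<tau> x \<star> ?K) \<star> ?R)
      = ((ide A \<star> app A (length ks) ?X) \<cdot> (\<tau> x \<star> (?K \<star> ?R))) \<cdot> \<alpha> A (opow A (length ks) \<I>) ?X"
    using associator_natural[OF x(1) K(1) R(1)] x K R by simp
  also have "(ide A \<star> app A (length ks) ?X) \<cdot> (\<tau> x \<star> (?K \<star> ?R))
      = \<tau> x \<star> (app A (length ks) ?X \<cdot> (?K \<star> ?R))"
    using x K R by (subst interchange) simp_all
  also have "app A (length ks) ?X \<cdot> (?K \<star> ?R)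
      = tens_arr_list C (map \<tau> (ks @ rs)) \<cdot> app A (length ks) ?X"
    by (rule Cons.IH) (use Cons.prems in auto)
  also have "\<tau> x \<star> (tens_arr_list C (map \<tau> (ks @ rs)) \<cdot> app A (length ks) ?X)
      = (\<tau> x \<star> tens_arr_list C (map \<tau> (ks @ rs))) \<cdot> (ide A \<star> app A (length ks) ?X)"
    using x KR by (subst interchange) simp_all
  finally show ?case using x KR by simp
qed

lemma hat_can:
  assumes f: "f \<in> Arr C" "Dom C f = opow A (length xs) \<I>"
    and p: "perm_words xs ys" and zs: "distinct zs" "set xs \<inter> set zs = {}"
  shows "hat A (length xs) (f \<cdot> can A xs ys) (opow A (length zs) \<I>)
    = hat A (length xs) f (opow A (length zs) \<I>) \<cdot> can A (xs @ zs) (ys @ zs)"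
proof (rule hat_eqI)
  let ?X = "opow A (length zs) \<I>" and ?m = "length xs"
  have p': "perm_words (xs @ zs) (ys @ zs)"
    by (rule perm_words_append[OF p perm_words_refl[OF zs(1)] zs(2)])
  have "(hat A ?m f ?X \<cdot> can A (xs @ zs) (ys @ zs)) \<cdot> app A ?m ?X
      = hat A ?m f ?X \<cdot> (app A ?m ?X \<cdot> (can A xs ys \<star> ide ?X))"
    using f p' by (simp add: can_append_right[OF A p zs])
  also have "\<dots> = (f \<cdot> can A xs ys) \<star> ide ?X"
    using f p Comp2_ext[OF hat_simps(4)[OF A f, of ?X]] by simp
  finally show
    "(hat A ?m f ?X \<cdot> can A (xs @ zs) (ys @ zs)) \<cdot> app A ?m ?X = (f \<cdot> can A xs ys) \<star> ide ?X" .
qed (use f p perm_words_append[OF p perm_words_refl[OF zs(1)] zs(2)] in simp_all)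

lemma hat_tens_arr_list:
  assumes f: "f \<in> Arr C" "Dom C f = opow A (length ks) \<I>"
    and \<tau>: "\<And>x. x \<in> set ks \<union> set rs \<Longrightarrow> \<tau> x \<in> Arr C \<and> Dom C (\<tau> x) = A \<and> Cod C (\<tau> x) = A"
  shows "hat A (length ks) (f \<cdot> tens_arr_list C (map \<tau> ks)) (opow A (length rs) \<I>)
      \<cdot> lpow A (length ks) (tens_arr_list C (map \<tau> rs))
    = hat A (length ks) f (opow A (length rs) \<I>) \<cdot> tens_arr_list C (map \<tau> (ks @ rs))"
proof (rule cancel_epi)
  let ?X = "opow A (length rs) \<I>" and ?m = "length ks"
  let ?K = "tens_arr_list C (map \<tau> ks)" and ?R = "tens_arr_list C (map \<tau> rs)"
  let ?KR = "tens_arr_list C (map \<tau> (ks @ rs))"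
  show "iso_arr C (app A ?m ?X)" by simp
  have R: "?R \<in> Arr C" "Dom C ?R = ?X" "Cod C ?R = ?X"
    using \<tau> by (auto simp: tens_arr_list_simps[where A=A and B=A])
  have K: "?K \<in> Arr C" "Dom C ?K = opow A (length ks) \<I>" "Cod C ?K = opow A (length ks) \<I>"
    using \<tau> by (auto simp: tens_arr_list_simps[where A=A and B=A])
  have KR: "?KR \<in> Arr C" "Dom C ?KR = opow A (length ks + length rs) \<I>"
     "Cod C ?KR = opow A (length ks + length rs) \<I>"
    using \<tau> by (subst tens_arr_list_simps[where A=A and B=A]; force)+
  show "hat A ?m (f \<cdot> ?K) ?X \<cdot> lpow A ?m ?R \<in> Arr C" "hat A ?m f ?X \<cdot> ?KR \<in> Arr C"
    "Dom C (hat A ?m (f \<cdot> ?K) ?X \<cdot> lpow A ?m ?R) = Cod C (app A ?m ?X)"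
    "Dom C (hat A ?m f ?X \<cdot> ?KR) = Cod C (app A ?m ?X)"
    using f K R KR by (simp_all del: map_append)
  have n: "lpow A ?m ?R \<cdot> app A ?m ?X = app A ?m ?X \<cdot> (ide (opow A ?m \<I>) \<star> ?R)"
    using app_natural[OF A R(1), of ?m] R by simp
  have "(hat A ?m (f \<cdot> ?K) ?X \<cdot> lpow A ?m ?R) \<cdot> app A ?m ?X
      = (hat A ?m (f \<cdot> ?K) ?X \<cdot> app A ?m ?X) \<cdot> (ide (opow A ?m \<I>) \<star> ?R)"
    using f K R n by (simp del: hat_simps(4))
  also have "\<dots> = (f \<star> ide ?X) \<cdot> (?K \<star> ?R)"
    using f K R by (simp add: interchange del: whisker_Comp)
  also have "\<dots> = hat A ?m f ?X \<cdot> (app A ?m ?X \<cdot> (?K \<star> ?R))"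
    using f K R Comp2_ext[OF hat_simps(4)[OF A f, of ?X]] by simp
  also have "app A ?m ?X \<cdot> (?K \<star> ?R) = ?KR \<cdot> app A ?m ?X"
    by (rule app_tens_arr_list[OF \<tau>])
  also have "hat A ?m f ?X \<cdot> (?KR \<cdot> app A ?m ?X) = (hat A ?m f ?X \<cdot> ?KR) \<cdot> app A ?m ?X"
    using f KR by (simp del: map_append)
  finally show
    "(hat A ?m (f \<cdot> ?K) ?X \<cdot> lpow A ?m ?R) \<cdot> app A ?m ?X = (hat A ?m f ?X \<cdot> ?KR) \<cdot> app A ?m ?X" .
qed

text \<open>The label lists enter through their lengths, so the factors of a block may be relabelled
  freely.\<close>

lemma lblocks_cong_length:
  assumes "\<And>i. i \<in> set is \<Longrightarrow> length (l i) = length (l' i)" "\<And>i. i \<in> set is \<Longrightarrow> f i = f' i"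
  shows "lblocks A l f is = lblocks A l' f' is"
  unfolding lblocks_def by (intro arg_cong[of _ _ "blocks A"] map_cong) (use assms in auto)

lemma lblocks_post:
  assumes "block_family A l f is"
    and "\<And>i. i \<in> set is \<Longrightarrow> \<tau> i \<in> Arr C \<and> Dom C (\<tau> i) = A \<and> Cod C (\<tau> i) = A"
  shows "tens_arr_list C (map \<tau> is) \<cdot> lblocks A l f is = lblocks A l (\<lambda>i. \<tau> i \<cdot> f i) is"
  using assms
proof (induction "is")
  case (Cons i "is")
  let ?T = "tens_arr_list C (map \<tau> is)" and ?B = "lblocks A l f is"
  let ?h = "hat A (length (l i)) (f i) (opow A (length (concat (map l is))) \<I>)"
  have T: "?T \<in> Arr C" "Dom C ?T = opow A (length is) \<I>" "Cod C ?T = opow A (length is) \<I>"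
    using Cons.prems by (auto simp: tens_arr_list_simps[where A=A and B=A])
  have i: "f i \<in> Arr C" "Dom C (f i) = opow A (length (l i)) \<I>" "Cod C (f i) = A"
    and bf: "block_family A l f is" using Cons.prems by auto
  have t: "\<tau> i \<in> Arr C" "Dom C (\<tau> i) = A" "Cod C (\<tau> i) = A" using Cons.prems by auto
  note B = lblocks_simps[OF A bf]
  have "(\<tau> i \<star> ?T) \<cdot> ((ide A \<star> ?B) \<cdot> ?h) = ((\<tau> i \<star> ?T) \<cdot> (ide A \<star> ?B)) \<cdot> ?h"
    using T i t B by simp
  also have "(\<tau> i \<star> ?T) \<cdot> (ide A \<star> ?B) = (ide A \<star> (?T \<cdot> ?B)) \<cdot> (\<tau> i \<star> ide (Dom C ?B))"
    using T t B by (simp add: interchange del: whisker_Comp)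
  also have "?T \<cdot> ?B = lblocks A l (\<lambda>i. \<tau> i \<cdot> f i) is" using Cons.IH bf Cons.prems by simp
  finally show ?case
    using i t B Cons.IH[OF bf, symmetric] Cons.prems T by (simp add: hat_Comp)
qed simp

text \<open>Permutations inside separate blocks assemble to one permutation of all factors. In the
  inductive step the tail is permuted with the first block fixed, and then the first block with the
  tail fixed.\<close>

lemma lblocks_can:
  assumes "block_family A l f is" "distinct (concat (map l is))"
    "\<And>i. i \<in> set is \<Longrightarrow> perm_words (l i) (l' i)"
  shows "perm_words (concat (map l is)) (concat (map l' is))"
    "lblocks A l (\<lambda>i. f i \<cdot> can A (l i) (l' i)) is
        = lblocks A l f is \<cdot> can A (concat (map l is)) (concat (map l' is))"
proof -
  have "perm_words (concat (map l is)) (concat (map l' is)) \<and>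
    lblocks A l (\<lambda>i. f i \<cdot> can A (l i) (l' i)) is
        = lblocks A l f is \<cdot> can A (concat (map l is)) (concat (map l' is))"
    using assms
  proof (induction "is")
    case (Cons i "is")
    let ?r = "concat (map l is)" and ?r' = "concat (map l' is)" and ?m = "length (l i)"
    let ?B = "lblocks A l f is" and ?c = "can A (concat (map l is)) (concat (map l' is))"
    let ?X = "opow A (length ?r) \<I>"
    have i: "f i \<in> Arr C" "Dom C (f i) = opow A ?m \<I>" "Cod C (f i) = A"
      and bf: "block_family A l f is" and p: "perm_words (l i) (l' i)"
      using Cons.prems by auto
    have IH: "perm_words ?r ?r'" "lblocks A l (\<lambda>i. f i \<cdot> can A (l i) (l' i)) is = ?B \<cdot> ?c"
      using Cons.IH[OF bf] Cons.prems by auto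
    have dis: "set (l i) \<inter> set ?r = {}" "set (l i) \<inter> set ?r' = {}" "distinct ?r" "distinct ?r'"
      "distinct (l i)"
      using Cons.prems IH(1) by (auto simp: perm_words_def)
    have p1: "perm_words (l i @ ?r) (l i @ ?r')" "perm_words (l i @ ?r') (l' i @ ?r')"
      using dis p IH(1) by (auto simp: perm_words_def)
    note B = lblocks_simps[OF A bf]
    have len: "length ?r' = length ?r" using perm_words_length[OF IH(1)] by simp
    have c: "?c \<in> Arr C" "Dom C ?c = ?X" "Cod C ?c = ?X" using IH(1) by simp_all
    let ?fc = "f i \<cdot> can A (l i) (l' i)"
    have fc: "?fc \<in> Arr C" "Dom C ?fc = opow A ?m \<I>" "Cod C ?fc = A"
      using i p by simp_all
    have "lblocks A l (\<lambda>i. f i \<cdot> can A (l i) (l' i)) (i # is)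
        = (ide A \<star> ?B) \<cdot> ((ide A \<star> ?c) \<cdot> hat A ?m ?fc (Dom C ?c))"
      using B c fc by (simp add: IH(2))
    also have "(ide A \<star> ?c) \<cdot> hat A ?m ?fc (Dom C ?c) = hat A ?m ?fc (Cod C ?c) \<cdot> lpow A ?m ?c"
      using hat_natural[OF A fc(1,2) c(1)] fc by simp
    also have "hat A ?m ?fc (Cod C ?c) = hat A ?m (f i) ?X \<cdot> can A (l i @ ?r') (l' i @ ?r')"
      using hat_can[OF i(1,2) p dis(4,2)] c len by simp
    also have "lpow A ?m ?c = can A (l i @ ?r) (l i @ ?r')"
      by (rule can_append_left[OF A dis(5) IH(1) dis(1), symmetric])
    also have "(ide A \<star> ?B)
        \<cdot> ((hat A ?m (f i) ?X \<cdot> can A (l i @ ?r') (l' i @ ?r')) \<cdot> can A (l i @ ?r) (l i @ ?r'))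
       = ((ide A \<star> ?B) \<cdot> hat A ?m (f i) ?X)
           \<cdot> (can A (l i @ ?r') (l' i @ ?r') \<cdot> can A (l i @ ?r) (l i @ ?r'))"
      using B i p1 len by simp
    also have "can A (l i @ ?r') (l' i @ ?r') \<cdot> can A (l i @ ?r) (l i @ ?r')
        = can A (l i @ ?r) (l' i @ ?r')"
      by (rule can_trans[OF A p1])
    finally show ?case using perm_words_trans[OF p1] by simp
  qed simp
  then show "perm_words (concat (map l is)) (concat (map l' is))"
    "lblocks A l (\<lambda>i. f i \<cdot> can A (l i) (l' i)) is
        = lblocks A l f is \<cdot> can A (concat (map l is)) (concat (map l' is))"
    by blast+
qed

lemma lblocks_tens_arr_list:
  assumes "block_family A l f is"
    "\<And>k. k \<in> set (concat (map l is)) \<Longrightarrow> \<tau> k \<in> Arr C \<and> Dom C (\<tau> k) = A \<and> Cod C (\<tau> k) = A"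
  shows "lblocks A l (\<lambda>i. f i \<cdot> tens_arr_list C (map \<tau> (l i))) is
    = lblocks A l f is \<cdot> tens_arr_list C (map \<tau> (concat (map l is)))"
  using assms
proof (induction "is")
  case (Cons i "is")
  let ?r = "concat (map l is)" and ?m = "length (l i)"
  let ?B = "lblocks A l f is" and ?T = "tens_arr_list C (map \<tau> (l i))" and ?c =
    "tens_arr_list C (map \<tau> (concat (map l is)))"
  let ?X = "opow A (length ?r) \<I>"
  have i: "f i \<in> Arr C" "Dom C (f i) = opow A ?m \<I>" "Cod C (f i) = A"
    and bf: "block_family A l f is"
    using Cons.prems by auto
  have IH: "lblocks A l (\<lambda>i. f i \<cdot> tens_arr_list C (map \<tau> (l i))) is = ?B \<cdot> ?c"
    using Cons.IH[OF bf] Cons.prems by auto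
  have \<tau>1: "\<tau> k \<in> Arr C \<and> Dom C (\<tau> k) = A \<and> Cod C (\<tau> k) = A" if "k \<in> set (l i)" for k
    using Cons.prems that by auto
  have \<tau>2: "\<tau> k \<in> Arr C \<and> Dom C (\<tau> k) = A \<and> Cod C (\<tau> k) = A" if "k \<in> set ?r" for k
    using Cons.prems that by auto
  have \<tau>3: "\<tau> k \<in> Arr C \<and> Dom C (\<tau> k) = A \<and> Cod C (\<tau> k) = A" if "k \<in> set (l i @ ?r)" for k
    using Cons.prems that by auto
  note T = tens_arr_list_simps[of "l i" \<tau> A A, OF \<tau>1]
  note c = tens_arr_list_simps[of ?r \<tau> A A, OF \<tau>2]
  note Tc = tens_arr_list_simps[of "l i @ ?r" \<tau> A A, OF \<tau>3]
  note B = lblocks_simps[OF A bf]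
  let ?fc = "f i \<cdot> ?T"
  have fc: "?fc \<in> Arr C" "Dom C ?fc = opow A ?m \<I>" "Cod C ?fc = A"
    using i T by simp_all
  have "lblocks A l (\<lambda>i. f i \<cdot> tens_arr_list C (map \<tau> (l i))) (i # is)
      = (ide A \<star> ?B) \<cdot> ((ide A \<star> ?c) \<cdot> hat A ?m ?fc (Dom C ?c))"
    using B c fc by (simp add: IH)
  also have "(ide A \<star> ?c) \<cdot> hat A ?m ?fc (Dom C ?c) = hat A ?m ?fc (Cod C ?c) \<cdot> lpow A ?m ?c"
    using hat_natural[OF A fc(1,2) c(1)] fc by simp
  also have "\<dots> = hat A ?m (f i) ?X \<cdot> tens_arr_list C (map \<tau> (l i @ ?r))"
    by (subst c(3), assumption, rule hat_tens_arr_list[OF i(1,2)]) (use \<tau>1 \<tau>2 in blast)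
  finally show ?case using B i Tc by simp
qed simp

section \<open>Comparison with \<open>tens_concat\<close> and \<open>perm_arr\<close>\<close>

lemma tens_append_replicate:
  "tens_append C (replicate m A) (replicate n A) = app A m (opow A n \<I>)"
  by (induction m) (simp_all add: tens_pow_opow)

text \<open>The algebra axiom starts from a product of tensor powers. Since
  \<open>tens_concat\<close> is invertible, the last equation allows the axiom to be moved to the
  flat tensor power.\<close>

lemma blocks_tens_concat:
  assumes "\<And>m f. (m, f) \<in> set fs \<Longrightarrow> f \<in> Arr C \<and> Dom C f = opow A m \<I> \<and> Cod C f = A"
  shows "iso_arr C (tens_concat C (map (\<lambda>n. replicate n A) (map fst fs)))"
    "Cod C (tens_concat C (map (\<lambda>n. replicate n A) (map fst fs)))
        = opow A (sum_list (map fst fs)) \<I>"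
    "blocks A fs \<in> Arr C" "Dom C (blocks A fs) = opow A (sum_list (map fst fs)) \<I>"
    "Cod C (blocks A fs) = opow A (length fs) \<I>"
    "blocks A fs \<cdot> tens_concat C (map (\<lambda>n. replicate n A) (map fst fs))
        = tens_arr_list C (map snd fs)"
proof -
  let ?t = "\<lambda>fs :: (nat \<times> 'm) list. tens_concat C (map (\<lambda>n. replicate n A) (map fst fs))"
  let ?N = "\<lambda>fs :: (nat \<times> 'm) list. sum_list (map fst fs)"
  have "iso_arr C (?t fs) \<and> Cod C (?t fs) = opow A (?N fs) \<I> \<and>
    blocks A fs \<in> Arr C \<and> Dom C (blocks A fs) = opow A (?N fs) \<I> \<and> Cod C (blocks A fs) = opow A
      (length fs) \<I> \<and>
    blocks A fs \<cdot> ?t fs = tens_arr_list C (map snd fs)"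
    using assms
  proof (induction fs)
    case (Cons mf fs)
    obtain m f where [simp]: "mf = (m, f)" by (cases mf)
    have IH: "iso_arr C (?t fs)" "Cod C (?t fs) = opow A (?N fs) \<I>"
      "blocks A fs \<in> Arr C" "Dom C (blocks A fs) = opow A (?N fs) \<I>"
      "Cod C (blocks A fs) = opow A (length fs) \<I>"
      "blocks A fs \<cdot> ?t fs = tens_arr_list C (map snd fs)"
      using Cons.IH[OF Cons.prems[OF list.set_intros(2)]] by blast+
    have f: "f \<in> Arr C" "Dom C f = opow A m \<I>" "Cod C f = A" using Cons.prems[of m f] by auto
    have t: "?t (mf # fs) = app A m (opow A (?N fs) \<I>) \<cdot> (ide (opow A m \<I>) \<star> ?t fs)"
      using concat_replicate_sum_list[of A "map fst fs"]
      by (simp add: tens_append_replicate tens_pow_opow comp_def)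
    have "blocks A (mf # fs) \<cdot> ?t (mf # fs)
        = (ide A \<star> blocks A fs)
            \<cdot> ((hat A m f (opow A (?N fs) \<I>) \<cdot> app A m (opow A (?N fs) \<I>))
                \<cdot> (ide (opow A m \<I>) \<star> ?t fs))"
      unfolding t using IH f by (simp del: hat_simps(4))
    also have "\<dots> = f \<star> (blocks A fs \<cdot> ?t fs)"
      using IH(1-5) f by (simp add: interchange del: whisker_Comp)
    finally have "blocks A (mf # fs) \<cdot> ?t (mf # fs) = tens_arr_list C (map snd (mf # fs))"
      using IH(6) by simp
    then show ?case unfolding t using IH f by simp
  qed simp
  then show "iso_arr C (?t fs)" "Cod C (?t fs) = opow A (?N fs) \<I>"
    "blocks A fs \<in> Arr C" "Dom C (blocks A fs) = opow A (?N fs) \<I>"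
    "Cod C (blocks A fs) = opow A (length fs) \<I>"
    "blocks A fs \<cdot> ?t fs = tens_arr_list C (map snd fs)" by blast+
qed

lemma swap_at_sw: "Suc i < n \<Longrightarrow> swap_at C A n i = lpow A i (sw A A (opow A (n - Suc (Suc i)) \<I>))"
proof (induction i arbitrary: n)
  case 0
  then obtain k where "n = Suc (Suc k)" by (metis Suc_lessE gr0_implies_Suc)
  then show ?case by (simp add: sw_def tens_pow_opow)
next
  case (Suc i)
  then obtain k where k: "n = Suc k" by (metis Suc_lessE)
  then obtain k' where "k = Suc k'" using Suc.prems by (cases k) auto
  with Suc k show ?case by simp
qed

lemma can_transpose:
  assumes "Suc i < n" "perm_words xs [0..<n]"
  shows "can A xs (map (transpose i (Suc i)) [0..<n]) = swap_at C A n i \<cdot> can A xs [0..<n]"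
proof -
  let ?v = "[Suc (Suc i)..<n]"
  have *: "[0..<n] = [0..<i] @ i # Suc i # ?v" by (rule upt_split_swap[OF assms(1)])
  have **: "map (transpose i (Suc i)) [0..<n] = [0..<i] @ Suc i # i # ?v"
    by (subst *) (auto simp: transpose_def intro!: map_idI)
  show ?thesis unfolding ** swap_at_sw[OF assms(1)]
    using can_swap[OF A, of xs "[0..<i]" i "Suc i" ?v] assms * by simp
qed

text \<open>Label the factor in position \<open>i\<close> by its target position
  \<open>\<sigma> i\<close>: the source word is \<open>map \<sigma> [0..<n]\<close> and the target
  word is \<open>[0..<n]\<close>. The arrow is thus a function of \<open>\<sigma>\<close>, whatever
  product of adjacent symmetries presents it.\<close>

lemma perm_arr_can:
  assumes "perm_arr C A n \<sigma> f"
  shows "bij_betw \<sigma> {..<n} {..<n}" "f = can A (map \<sigma> [0..<n]) [0..<n]"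
proof -
  have "bij_betw \<sigma> {..<n} {..<n} \<and> f = can A (map \<sigma> [0..<n]) [0..<n]"
    using assms
  proof (induction rule: perm_arr.induct)
    case perm_arr_id
    show ?case by (simp add: can_self tens_pow_opow bij_betw_def)
  next
    case (perm_arr_swap \<sigma> f i)
    let ?h = "transpose i (Suc i)" and ?N = "[0..<n]"
    have h: "bij_betw ?h {..<n} {..<n}"
      by (rule bij_betw_byWitness[of _ ?h]) (use perm_arr_swap.hyps in \<open>auto simp: transpose_def\<close>)
    have \<sigma>: "bij_betw \<sigma> {..<n} {..<n}" using perm_arr_swap.IH by simp
    have h\<sigma>: "bij_betw (?h \<circ> \<sigma>) {..<n} {..<n}" using \<sigma> h by (rule bij_betw_trans)
    have p: "perm_words (map \<sigma> ?N) ?N"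
      using \<sigma> by (auto simp: perm_words_def distinct_map bij_betw_def atLeast0LessThan)
    have p': "perm_words (map (?h \<circ> \<sigma>) ?N) ?N"
      using h\<sigma> by (auto simp: perm_words_def distinct_map bij_betw_def atLeast0LessThan)
    \<comment> \<open>Relabelling by the transposition leaves the arrow unchanged;
      \<open>can_transpose\<close> then returns the target word to \<open>[0..<n]\<close> at the
      cost of one swap, which the new swap cancels.\<close>
    have "f = can A (map ?h (map \<sigma> ?N)) (map ?h ?N)"
      using perm_arr_swap.IH p can_map[OF A p, of ?h] by simp
    also have "\<dots> = swap_at C A n i \<cdot> can A (map (?h \<circ> \<sigma>) ?N) ?N"
      using can_transpose[OF perm_arr_swap.hyps(2) p'] by simp
    finally have f: "f = swap_at C A n i \<cdot> can A (map (?h \<circ> \<sigma>) ?N) ?N" .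
    obtain k where k: "n = i + Suc (Suc k)"
      using perm_arr_swap.hyps(2) by (metis add_Suc_right add_Suc_shift less_iff_Suc_add)
    have sw_eq: "swap_at C A n i = lpow A i (sw A A (opow A k \<I>))"
      using swap_at_sw[OF perm_arr_swap.hyps(2)] k by simp
    have ss: "swap_at C A n i \<cdot> swap_at C A n i = ide (opow A n \<I>)"
      unfolding sw_eq by (simp add: k flip: lpow_Comp)
    have sw: "swap_at C A n i \<in> Arr C" "Dom C (swap_at C A n i) = opow A n \<I>"
      "Cod C (swap_at C A n i) = opow A n \<I>"
      unfolding sw_eq by (simp_all add: k)
    have "swap_at C A n i \<cdot> f = can A (map (?h \<circ> \<sigma>) ?N) ?N"
      unfolding f using p' Comp2_ext[OF ss] sw by simp
    with h\<sigma> show ?case by (metis (no_types))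
  qed
  then show "bij_betw \<sigma> {..<n} {..<n}" "f = can A (map \<sigma> [0..<n]) [0..<n]" by blast+
qed

text \<open>Adjacent transpositions reach every word. The permutation \<open>\<sigma>\<close> sends
  a letter to its position in \<open>w\<close>, which is where its factor goes.\<close>

lemma perm_arr_exists:
  assumes "perm_words [0..<n] w"
  shows "\<exists>\<sigma>. perm_arr C A n \<sigma> (can A [0..<n] w) \<and> map \<sigma> w = [0..<n]"
  using assms
proof (induction rule: perm_words_induct)
  case refl
  show ?case using perm_arr_id[of C A n]
    by (intro exI[of _ id]) (simp add: can_self flip: tens_pow_opow id_def)
next
  case (swap u a b v)
  then obtain \<sigma> where \<sigma>: "perm_arr C A n \<sigma> (can A [0..<n] (u @ a # b # v))"
    "map \<sigma> (u @ a # b # v) = [0..<n]" by blast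
  let ?i = "length u"
  have n: "n = length u + Suc (Suc (length v))" using perm_words_length[OF swap.hyps] by simp
  have i: "Suc ?i < n" using n by simp
  have "map \<sigma> (u @ a # b # v) = [0..<?i] @ ?i # Suc ?i # [Suc (Suc ?i)..<n]"
    using \<sigma>(2) upt_split_swap[OF i] by simp
  then have s: "map \<sigma> u = [0..<?i]" "\<sigma> a = ?i" "\<sigma> b = Suc ?i" "map \<sigma> v = [Suc (Suc ?i)..<n]"
    by (auto simp: append_eq_append_conv)
  have "map (transpose ?i (Suc ?i) \<circ> \<sigma>) (u @ b # a # v)
      = map (transpose ?i (Suc ?i)) (map \<sigma> u @ \<sigma> b # \<sigma> a # map \<sigma> v)"
    by simp
  also have "\<dots> = [0..<?i] @ ?i # Suc ?i # [Suc (Suc ?i)..<n]"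
    unfolding s by (auto simp: transpose_def intro!: map_idI)
  finally have "map (transpose ?i (Suc ?i) \<circ> \<sigma>) (u @ b # a # v) = [0..<n]"
    using upt_split_swap[OF i] by simp
  moreover have "can A [0..<n] (u @ b # a # v) = swap_at C A n ?i \<cdot> can A [0..<n] (u @ a # b # v)"
    unfolding swap_at_sw[OF i] using can_swap[OF A swap.hyps] n by simp
  ultimately show ?case using perm_arr_swap[OF \<sigma>(1) i] by metis
qed

end

end

section \<open>The operations of a monoid with twisted action\<close>

context symmetric_monoidal_category
begin

primrec mpow :: "'o \<Rightarrow> 'm \<Rightarrow> 'm \<Rightarrow> nat \<Rightarrow> 'm" where
  "mpow A \<mu> \<eta> 0 = \<eta>"
| "mpow A \<mu> \<eta> (Suc n) = \<mu> \<cdot> (ide A \<star> mpow A \<mu> \<eta> n)"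

text \<open>Iterated left multiplication onto a last factor \<open>A\<close>. Feeding a product into
  that factor gives a longer product (\<open>mact_mpow\<close>), which is how the products of blocks
  are combined.\<close>

primrec mact :: "'o \<Rightarrow> 'm \<Rightarrow> nat \<Rightarrow> 'm" where
  "mact A \<mu> 0 = ide A"
| "mact A \<mu> (Suc n) = \<mu> \<cdot> (ide A \<star> mact A \<mu> n)"

text \<open>The \<open>i\<close>-th decoration acts on the factor in position \<open>i\<close>,
  before the factors are permuted; this agrees with the way \<open>op_perm\<close> and
  \<open>op_comp\<close> treat the list of decorations.\<close>

definition twop :: "'o \<Rightarrow> 'm \<Rightarrow> 'm \<Rightarrow> ('g \<Rightarrow> 'm) \<Rightarrow> nat \<Rightarrow> (nat \<times> nat) set \<times> 'g list \<Rightarrow> 'm" where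
  "twop A \<mu> \<eta> t n x
      = mpow A \<mu> \<eta> n \<cdot> (can A [0..<n] (word_of (fst x)) \<cdot> tens_arr_list C (map t (snd x)))"

lemma tens_arr_list_Comp:
  assumes "\<And>x. x \<in> set xs \<Longrightarrow> f x \<in> Arr C \<and> g x \<in> Arr C \<and> Dom C (g x) = Cod C (f x)"
  shows "tens_arr_list C (map (\<lambda>x. g x \<cdot> f x) xs)
      = tens_arr_list C (map g xs) \<cdot> tens_arr_list C (map f xs)"
proof -
  have "tens_arr_list C (map (\<lambda>x. g x \<cdot> f x) xs)
      = tens_arr_list C (map g xs) \<cdot> tens_arr_list C (map f xs)
    \<and> tens_arr_list C (map g xs) \<in> Arr C \<and> tens_arr_list C (map f xs) \<in> Arr C
    \<and> Dom C (tens_arr_list C (map g xs)) = Cod C (tens_arr_list C (map f xs))"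
    using assms by (induction xs) (simp_all add: interchange)
  then show ?thesis by blast
qed

text \<open>Carrying a factor to the very end, next to the closing unit, is the symmetry with the
  whole power once this unit is absorbed. The inductive step is the hexagon.\<close>

lemma lpow_run_ins:
  assumes [simp]: "A \<in> Obj C"
  shows "lpow A n (run A) \<cdot> ins A n \<I> = app A n A \<cdot> sym A (opow A n \<I>)"
proof (induction n)
  case 0
  then show ?case by (simp add: lunitor_symmetry)
next
  case (Suc n)
  let ?Y = "opow A n \<I>"
  have h: "\<alpha> A ?Y A \<cdot> sym A (A \<odot> ?Y) = (ide A \<star> sym A ?Y) \<cdot> sw A A ?Y"
  proof (rule cancel_epi)
    show "iso_arr C (\<alpha> A A ?Y)" by simp
    show "(\<alpha> A ?Y A \<cdot> sym A (A \<odot> ?Y)) \<cdot> \<alpha> A A ?Y = ((ide A \<star> sym A ?Y) \<cdot> sw A A ?Y) \<cdot> \<alpha> A A ?Y"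
      using hexagon'[of A A ?Y] by (simp add: sw_associator)
  qed simp_all
  have "lpow A (Suc n) (run A) \<cdot> ins A (Suc n) \<I>
      = (ide A \<star> (lpow A n (run A) \<cdot> ins A n \<I>)) \<cdot> sw A A ?Y"
    by simp
  also have "\<dots> = (ide A \<star> app A n A) \<cdot> ((ide A \<star> sym A ?Y) \<cdot> sw A A ?Y)"
    unfolding Suc.IH by simp
  also have "\<dots> = app A (Suc n) A \<cdot> sym A (opow A (Suc n) \<I>)"
    by (simp flip: h)
  finally show ?case .
qed

end

section \<open>Iterated products in a monoid\<close>

locale internal_monoid = symmetric_monoidal_category C
  for C :: "('o, 'm, 'z) smc_scheme" (structure) +
  fixes A \<mu> \<eta>
  assumes monoid_data: "is_monoid C (A, \<mu>, \<eta>)"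
begin

lemma monoid_simps [simp]:
  "A \<in> Obj C" "\<mu> \<in> Arr C" "Dom C \<mu> = A \<odot> A" "Cod C \<mu> = A" "\<eta> \<in> Arr C" "Dom C \<eta> = \<I>" "Cod C \<eta> = A"
  using monoid_data by (auto simp: is_monoid_def mem_Hom)

lemma mult_assoc: "\<mu> \<cdot> (\<mu> \<star> ide A) = \<mu> \<cdot> ((ide A \<star> \<mu>) \<cdot> \<alpha> A A A)"
  using monoid_data by (simp add: is_monoid_def)

lemma mult_unit_left: "\<mu> \<cdot> (\<eta> \<star> ide A) = lun A"
  and mult_unit_right: "\<mu> \<cdot> (ide A \<star> \<eta>) = run A"
  using monoid_data by (simp_all add: is_monoid_def)

abbreviation "M \<equiv> mpow A \<mu> \<eta>"
abbreviation "act \<equiv> mact A \<mu>"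

lemma mpow_simps [simp]: "M n \<in> Arr C" "Dom C (M n) = opow A n \<I>" "Cod C (M n) = A"
proof -
  have "M n \<in> Arr C \<and> Dom C (M n) = opow A n \<I> \<and> Cod C (M n) = A" by (induction n) simp_all
  then show "M n \<in> Arr C" "Dom C (M n) = opow A n \<I>" "Cod C (M n) = A" by simp_all
qed

lemma mact_simps [simp]: "act n \<in> Arr C" "Dom C (act n) = opow A n A" "Cod C (act n) = A"
proof -
  have "act n \<in> Arr C \<and> Dom C (act n) = opow A n A \<and> Cod C (act n) = A" by (induction n) simp_all
  then show "act n \<in> Arr C" "Dom C (act n) = opow A n A" "Cod C (act n) = A" by simp_all
qed

text \<open>Associativity moves the bracket inward one factor at a time; the left unit law is the
  case of no factors.\<close>

lemma mact_app: "\<mu> \<cdot> (M n \<star> ide A) = act n \<cdot> app A n A"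
proof (induction n)
  case 0
  then show ?case by (simp add: mult_unit_left)
next
  case (Suc n)
  have "\<mu> \<cdot> (M (Suc n) \<star> ide A) = (\<mu> \<cdot> (\<mu> \<star> ide A)) \<cdot> ((ide A \<star> M n) \<star> ide A)"
    by simp
  also have "\<dots> = \<mu> \<cdot> ((ide A \<star> \<mu>) \<cdot> (\<alpha> A A A \<cdot> ((ide A \<star> M n) \<star> ide A)))"
    unfolding mult_assoc by simp
  also have "\<dots> = \<mu> \<cdot> ((ide A \<star> (\<mu> \<cdot> (M n \<star> ide A))) \<cdot> \<alpha> A (opow A n \<I>) A)"
    using associator_natural[of "ide A" "M n" "ide A"] by simp
  also have "\<dots> = act (Suc n) \<cdot> app A (Suc n) A"
    unfolding Suc.IH by simp
  finally show ?case .
qed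

lemma mult_hat: "\<mu> \<cdot> hat A n (M n) A = act n"
proof (rule cancel_epi)
  show "(\<mu> \<cdot> hat A n (M n) A) \<cdot> app A n A = act n \<cdot> app A n A"
    using mact_app[of n] by simp
qed simp_all

lemma mact_mpow: "act n \<cdot> lpow A n (M k) = M (n + k)"
proof (induction n)
  case (Suc n)
  have "act (Suc n) \<cdot> lpow A (Suc n) (M k) = \<mu> \<cdot> (ide A \<star> (act n \<cdot> lpow A n (M k)))"
    by simp
  then show ?case unfolding Suc.IH by simp
qed simp

lemma block_family_mpow [simp]: "block_family A l (\<lambda>i. M (length (l i))) is"
  by (simp add: block_family_def)

text \<open>General associativity: \<open>mult_hat\<close> turns multiplication by the product of
  the first block into \<open>mact\<close>, and \<open>mact_mpow\<close> merges it with the product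
  of the remaining factors.\<close>

lemma mpow_lblocks: "M (length is) \<cdot> lblocks A l (\<lambda>i. M (length (l i))) is
    = M (length (concat (map l is)))"
proof (induction "is")
  case (Cons i "is")
  let ?B = "lblocks A l (\<lambda>i. M (length (l i))) is" and ?N = "length (concat (map l is))" and ?m =
    "length (l i)"
  have "M (length (i # is)) \<cdot> lblocks A l (\<lambda>i. M (length (l i))) (i # is)
      = \<mu> \<cdot> ((ide A \<star> (M (length is) \<cdot> ?B)) \<cdot> hat A ?m (M ?m) (opow A ?N \<I>))"
    by simp
  also have "\<dots> = \<mu> \<cdot> (hat A ?m (M ?m) A \<cdot> lpow A ?m (M ?N))"
    unfolding Cons.IH using hat_natural[of A "M ?m" ?m "M ?N"] by simp
  also have "\<dots> = act ?m \<cdot> lpow A ?m (M ?N)"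
    by (rule Comp2_ext[OF mult_hat]) simp_all
  finally show ?case by (simp add: mact_mpow)
qed simp

text \<open>Reversal puts the first factor last, and by \<open>lpow_run_ins\<close> this insertion
  is a symmetry. The reversed products thus satisfy the recursion of products in the opposite
  monoid.\<close>

lemma mpow_can_rev:
  "M (Suc n) \<cdot> can A [0..<Suc n] (rev [0..<Suc n])
      = \<mu> \<cdot> (sym A A \<cdot> (ide A \<star> (M n \<cdot> can A [0..<n] (rev [0..<n]))))"
proof -
  let ?c = "can A [0..<n] (rev [0..<n])"
  have p: "perm_words [0..<n] (rev [0..<n])" by (simp add: perm_words_def)
  \<comment> \<open>Relabelling the tail by \<open>Suc\<close> reduces its reversal to the case
    \<open>n\<close>.\<close>
  have u: "[0..<Suc n] = 0 # map Suc [0..<n]" by (simp add: map_Suc_upt upt_conv_Cons)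
  have r: "rev [0..<Suc n] = map Suc (rev [0..<n]) @ [0]" unfolding u by (simp add: rev_map)
  have c: "can A [0..<Suc n] (rev [0..<Suc n]) = ins A n \<I> \<cdot> (ide A \<star> ?c)"
    unfolding r u
    using can_Cons[of A 0 "map Suc (rev [0..<n])" "map Suc [0..<n]" "[]"] can_map[OF _ p, of A Suc]
    by (simp del: can.simps add: rev_map)
  \<comment> \<open>The product of one factor is the right unitor, so \<open>mact_mpow\<close>
    splits off the last factor in the form required by \<open>lpow_run_ins\<close>.\<close>
  have M1: "M 1 = run A" using mult_unit_right by simp
  have M: "M (Suc n) = act n \<cdot> lpow A n (run A)" using mact_mpow[of n 1] unfolding M1 by simp
  have "M (Suc n) \<cdot> can A [0..<Suc n] (rev [0..<Suc n])
      = act n \<cdot> (lpow A n (run A) \<cdot> (ins A n \<I> \<cdot> (ide A \<star> ?c)))"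
    unfolding M c using p by simp
  also have "\<dots> = (act n \<cdot> app A n A) \<cdot> (sym A (opow A n \<I>) \<cdot> (ide A \<star> ?c))"
    using p by (subst Comp2_ext[OF lpow_run_ins]) simp_all
  also have "\<dots> = \<mu> \<cdot> ((M n \<star> ide A) \<cdot> (sym A (opow A n \<I>) \<cdot> (ide A \<star> ?c)))"
    unfolding mact_app[symmetric] using p by simp
  also have "\<dots> = \<mu> \<cdot> (sym A A \<cdot> ((ide A \<star> M n) \<cdot> (ide A \<star> ?c)))"
    using p Comp2_ext[OF symmetry_natural[of "ide A" "M n", symmetric]] by simp
  finally show ?thesis using p by simp
qed

text \<open>An anti-homomorphism turns each \<open>\<mu>\<close> into
  \<open>\<mu> \<cdot> sym A A\<close>, which is the recursion of
  \<open>mpow_can_rev\<close>.\<close>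

lemma antihom_mpow:
  assumes \<tau> [simp]: "\<tau> \<in> Arr C" "Dom C \<tau> = A" "Cod C \<tau> = A"
    and \<tau>1: "\<tau> \<cdot> \<eta> = \<eta>" and \<tau>2: "\<tau> \<cdot> \<mu> = (\<mu> \<cdot> sym A A) \<cdot> (\<tau> \<star> \<tau>)"
  shows "\<tau> \<cdot> M n = (M n \<cdot> can A [0..<n] (rev [0..<n])) \<cdot> tens_arr_list C (replicate n \<tau>)"
proof (induction n)
  case 0
  then show ?case using \<tau>1 by (simp add: can_self)
next
  case (Suc n)
  let ?T = "tens_arr_list C (replicate n \<tau>)" and ?c = "can A [0..<n] (rev [0..<n])"
  have p: "perm_words [0..<n] (rev [0..<n])" by (simp add: perm_words_def)
  have T: "?T \<in> Arr C" "Dom C ?T = opow A n \<I>" "Cod C ?T = opow A n \<I>"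
    using tens_arr_list_simps[of "[0..<n]" "\<lambda>_. \<tau>" A A] by (simp_all add: map_replicate_const)
  have "\<tau> \<cdot> M (Suc n) = (\<tau> \<cdot> \<mu>) \<cdot> (ide A \<star> M n)" by simp
  also have "\<dots> = \<mu> \<cdot> (sym A A \<cdot> (\<tau> \<star> (\<tau> \<cdot> M n)))"
    unfolding \<tau>2 by (simp add: interchange)
  also have "\<dots> = \<mu> \<cdot> (sym A A \<cdot> ((ide A \<star> (M n \<cdot> ?c)) \<cdot> (\<tau> \<star> ?T)))"
    unfolding Suc.IH using T p by (simp add: interchange del: whisker_Comp)
  also have "\<dots> = (M (Suc n) \<cdot> can A [0..<Suc n] (rev [0..<Suc n]))
      \<cdot> tens_arr_list C (replicate (Suc n) \<tau>)"
    unfolding mpow_can_rev using T p by simp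
  finally show ?case .
qed

end

context symmetric_monoidal_category
begin

lemma hom_mpow:
  assumes A: "is_monoid C (A, \<mu>, \<eta>)" and B: "is_monoid C (B, \<mu>', \<eta>')"
    and h: "is_monoid_hom C (A, \<mu>, \<eta>) (B, \<mu>', \<eta>') h"
  shows "h \<cdot> mpow A \<mu> \<eta> n = mpow B \<mu>' \<eta>' n \<cdot> tens_arr_list C (replicate n h)"
proof -
  interpret A: internal_monoid C A \<mu> \<eta> by unfold_locales (rule A)
  interpret B: internal_monoid C B \<mu>' \<eta>' by unfold_locales (rule B)
  have h [simp]: "h \<in> Arr C" "Dom C h = A" "Cod C h = B"
    and h2: "h \<cdot> \<mu> = \<mu>' \<cdot> (h \<star> h)" "h \<cdot> \<eta> = \<eta>'"
    using h by (auto simp: is_monoid_hom_def mem_Hom)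
  show ?thesis
  proof (induction n)
    case 0
    then show ?case using h2(2) by simp
  next
    case (Suc n)
    let ?T = "tens_arr_list C (replicate n h)"
    have T: "?T \<in> Arr C" "Dom C ?T = opow A n \<I>" "Cod C ?T = opow B n \<I>"
      using tens_arr_list_simps[of "[0..<n]" "\<lambda>_. h" A B] by (simp_all add: map_replicate_const)
    have "h \<cdot> A.M (Suc n) = (h \<cdot> \<mu>) \<cdot> (ide A \<star> A.M n)" by simp
    also have "\<dots> = \<mu>' \<cdot> (h \<star> (h \<cdot> A.M n))"
      unfolding h2 by (simp add: interchange)
    also have "\<dots> = B.M (Suc n) \<cdot> tens_arr_list C (replicate (Suc n) h)"
      unfolding Suc.IH using T by (simp add: interchange del: whisker_Comp)
    finally show ?case .
  qed
qed

end

section \<open>Equivariance and composition of the operations\<close>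

locale twisted_monoid = internal_monoid C A \<mu> \<eta> + group G
  for C :: "('o, 'm, 'z) smc_scheme" (structure) and A \<mu> \<eta> and G :: "('g, 'y) monoid_scheme" +
  fixes \<phi> :: "'g \<Rightarrow> int" and t :: "'g \<Rightarrow> 'm"
  assumes \<phi>: "\<phi> \<in> hom G C2"
    and t_Hom: "g \<in> carrier G \<Longrightarrow> t g \<in> Hom C A A"
    and t_one: "t \<one>\<^bsub>G\<^esub> = ide A"
    and t_mult: "g \<in> carrier G \<Longrightarrow> h \<in> carrier G \<Longrightarrow> t (g \<otimes>\<^bsub>G\<^esub> h) = t g \<cdot> t h"
    and t_unit: "g \<in> carrier G \<Longrightarrow> t g \<cdot> \<eta> = \<eta>"
    and t_mu: "g \<in> carrier G \<Longrightarrow> t g \<cdot> \<mu> = (if \<phi> g = 1 then \<mu> else \<mu> \<cdot> sym A A) \<cdot> (t g \<star> t g)"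
begin

lemma t_simps [simp]: "g \<in> carrier G \<Longrightarrow> t g \<in> Arr C" "g \<in> carrier G \<Longrightarrow> Dom C (t g) = A"
  "g \<in> carrier G \<Longrightarrow> Cod C (t g) = A"
  using t_Hom by (auto simp: mem_Hom)

lemma tens_t [simp]:
  assumes "set gs \<subseteq> carrier G"
  shows "tens_arr_list C (map t gs) \<in> Arr C"
    "Dom C (tens_arr_list C (map t gs)) = opow A (length gs) \<I>"
    "Cod C (tens_arr_list C (map t gs)) = opow A (length gs) \<I>"
  using assms by (subst tens_arr_list_simps[where A=A and B=A]; force)+

abbreviation "twop' \<equiv> twop A \<mu> \<eta> t"

lemma twop_simps:
  assumes "perm_words [0..<n] w" "length gs = n" "set gs \<subseteq> carrier G"
  shows "twop' n (ord_of w, gs) = M n \<cdot> (can A [0..<n] w \<cdot> tens_arr_list C (map t gs))"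
    "twop' n (ord_of w, gs) \<in> Arr C" "Dom C (twop' n (ord_of w, gs)) = opow A n \<I>"
    "Cod C (twop' n (ord_of w, gs)) = A"
proof -
  have "distinct w" using assms by (simp add: perm_words_def)
  then show "twop' n (ord_of w, gs) = M n \<cdot> (can A [0..<n] w \<cdot> tens_arr_list C (map t gs))"
    "twop' n (ord_of w, gs) \<in> Arr C" "Dom C (twop' n (ord_of w, gs)) = opow A n \<I>"
    "Cod C (twop' n (ord_of w, gs)) = A"
    using assms by (simp_all add: twop_def)
qed

lemma t_mpow:
  assumes g: "g \<in> carrier G"
  shows "t g \<cdot> M n
      = (M n \<cdot> can A [0..<n] (if \<phi> g = 1 then [0..<n] else rev [0..<n]))
          \<cdot> tens_arr_list C (replicate n (t g))"
proof (cases "\<phi> g = 1")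
  case True
  have "is_monoid_hom C (A, \<mu>, \<eta>) (A, \<mu>, \<eta>) (t g)"
    using g True t_Hom t_unit t_mu by (simp add: is_monoid_hom_def)
  from hom_mpow[OF monoid_data monoid_data this] show ?thesis
    using True by (simp add: can_self)
next
  case False
  then show ?thesis using antihom_mpow[of "t g" n] g t_unit t_mu by simp
qed

text \<open>This realises the action of \<open>g\<close> on the operad: the reversal of the order
  comes from \<open>t_mpow\<close>, and the new decorations come from \<open>t_mult\<close> after
  \<open>t g\<close> has been moved past the permutation.\<close>

lemma t_twop:
  assumes g: "g \<in> carrier G" and w: "perm_words [0..<n] w" and hs: "length hs = n"
    "set hs \<subseteq> carrier G"
  shows "t g \<cdot> twop' n (ord_of w, hs) = twop' n (reversal (\<phi> g) (ord_of w), map ((\<otimes>\<^bsub>G\<^esub>) g) hs)"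
proof -
  let ?v = "if \<phi> g = 1 then [0..<n] else rev [0..<n]" and ?w' = "if \<phi> g = 1 then w else rev w"
  let ?gs = "map ((\<otimes>\<^bsub>G\<^esub>) g) hs" and ?T = "tens_arr_list C (replicate n (t g))"
  have gs: "length ?gs = n" "set ?gs \<subseteq> carrier G" using g hs by auto
  have v: "perm_words [0..<n] ?v" by (simp add: perm_words_def)
  have w': "perm_words w ?w'" using w by (simp add: perm_words_def)
  have w'': "perm_words [0..<n] ?w'" using w w' perm_words_trans by blast
  have rev: "reversal (\<phi> g) (ord_of w) = ord_of ?w'" by (simp add: reversal_def ord_of_rev)
  have len: "length w = n" using perm_words_length[OF w] by simp
  \<comment> \<open>The reversal in \<open>t_mpow\<close> is labelled by positions. Relabelled along
    \<open>(!) w\<close> it leads from \<open>w\<close> to its reversal and so composes with the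
    permutation into \<open>w\<close>.\<close>
  have v': "can A [0..<n] ?v = can A w ?w'"
  proof -
    have "map ((!) w) [0..<n] = w" using len map_nth by metis
    moreover have "map ((!) w) (rev [0..<n]) = rev w" using len map_nth by (metis rev_map)
    moreover have "inj_on ((!) w) (set [0..<n])"
      using w len by (intro inj_on_nth) (auto simp: perm_words_def)
    ultimately show ?thesis using can_map[OF _ v, of A "(!) w"] by auto
  qed
  have T: "?T = tens_arr_list C (map (\<lambda>_. t g) w)" "?T = tens_arr_list C (map (\<lambda>_. t g) [0..<n])"
    "?T = tens_arr_list C (map (\<lambda>_. t g) hs)"
    using len hs by (simp_all add: map_replicate_const)
  have T': "?T \<in> Arr C" "Dom C ?T = opow A n \<I>" "Cod C ?T = opow A n \<I>"
    unfolding T(2) using g tens_arr_list_simps[of "[0..<n]" "\<lambda>_. t g" A A] by simp_all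
  have "t g \<cdot> twop' n (ord_of w, hs) = (t g \<cdot> M n) \<cdot> (can A [0..<n] w \<cdot> tens_arr_list C (map t hs))"
    unfolding twop_simps(1)[OF w hs] using g w hs by simp
  also have "\<dots> = M n \<cdot> (can A [0..<n] ?v \<cdot> ((?T \<cdot> can A [0..<n] w) \<cdot> tens_arr_list C (map t hs)))"
    unfolding t_mpow[OF g] using w v hs T' by simp
  also have "?T \<cdot> can A [0..<n] w = can A [0..<n] w \<cdot> ?T"
    using can_natural[of A A "[0..<n]" w "\<lambda>_. t g"] w g unfolding T(1)[symmetric] T(2)[symmetric]
    by simp
  also have "M n \<cdot> (can A [0..<n] ?v \<cdot> ((can A [0..<n] w \<cdot> ?T) \<cdot> tens_arr_list C (map t hs)))
      = M n \<cdot> ((can A w ?w' \<cdot> can A [0..<n] w) \<cdot> (?T \<cdot> tens_arr_list C (map t hs)))"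
    unfolding v' using w w' hs T' len by (simp split del: if_split)
  also have "can A w ?w' \<cdot> can A [0..<n] w = can A [0..<n] ?w'" by (rule can_trans[OF _ w w']) simp
  also have "?T \<cdot> tens_arr_list C (map t hs) = tens_arr_list C (map (\<lambda>h. t g \<cdot> t h) hs)"
    unfolding T(3) using g hs by (subst tens_arr_list_Comp[where xs=hs]) auto
  also have "map (\<lambda>h. t g \<cdot> t h) hs = map t ?gs"
    using g hs by (auto simp: t_mult)
  finally show ?thesis unfolding rev twop_simps(1)[OF w'' gs] .
qed

lemma twop_perm:
  assumes x: "x \<in> op_set (Assoc_tw G \<phi>) n" and f: "perm_arr C A n \<sigma> f"
  shows "twop' n (op_perm (Assoc_tw G \<phi>) n x \<sigma>) = twop' n x \<cdot> f"
proof -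
  let ?N = "[0..<n]"
  obtain r gs where x': "x = (r, gs)" "r \<in> op_set Assoc n" "length gs = n" "set gs \<subseteq> carrier G"
    using x by (auto simp: Assoc_tw_def semidirect_operad_def)
  then obtain v where v: "perm_words ?N v" "r = ord_of v" by (auto simp: op_set_Assoc)
  have A: "A \<in> Obj C" by simp
  note \<sigma> = perm_arr_can[OF A f]
  have inj: "inj_on \<sigma> {..<n}" and im: "\<sigma> ` {..<n} = {..<n}" using \<sigma>(1) by (auto simp: bij_betw_def)
  obtain w where w: "perm_words ?N w" "map \<sigma> w = v"
    "op_perm (Assoc_tw G \<phi>) n (ord_of v, gs) \<sigma> = (ord_of w, map ((!) gs) (map \<sigma> ?N))"
    using op_perm_Assoc_tw[OF \<sigma>(1) v(1)] by blast
  have p1: "perm_words (map \<sigma> ?N) ?N"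
    using inj im by (auto simp: perm_words_def distinct_map atLeast0LessThan)
  have p2: "perm_words (map \<sigma> ?N) v" using p1 v(1) perm_words_trans by blast
  have set\<sigma>: "set (map ((!) gs) (map \<sigma> ?N)) \<subseteq> carrier G"
  proof -
    have "\<sigma> i < n" if "i < n" for i using im that by auto
    then show ?thesis using x'(3,4) by (auto intro!: subsetD[OF x'(4)] nth_mem)
  qed
  have gs: "map ((!) gs) ?N = gs" using x'(3) map_nth by metis
have "twop' n (op_perm (Assoc_tw G \<phi>) n x \<sigma>)
    = M n \<cdot> (can A ?N w \<cdot> tens_arr_list C (map t (map ((!) gs) (map \<sigma> ?N))))"
    unfolding x'(1) v(2) w(3) using twop_simps(1)[OF w(1) _ set\<sigma>] by simp
  \<comment> \<open>Renaming the labels by \<open>\<sigma>\<close> lets the permutation factor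
    through \<open>[0..<n]\<close>, and its first factor is then \<open>f\<close>; naturality moves
    the decorations past it.\<close>
  also have "can A ?N w = can A (map \<sigma> ?N) v"
    using can_map[OF A w(1), of \<sigma>] inj w(2) by (simp add: atLeast0LessThan)
  also have "\<dots> = can A ?N v \<cdot> can A (map \<sigma> ?N) ?N" by (rule can_trans[OF A p1 v(1), symmetric])
  also have "M n \<cdot> ((can A ?N v \<cdot> can A (map \<sigma> ?N) ?N)
      \<cdot> tens_arr_list C (map t (map ((!) gs) (map \<sigma> ?N))))
      = M n \<cdot> (can A ?N v
          \<cdot> (can A (map \<sigma> ?N) ?N \<cdot> tens_arr_list C (map (\<lambda>i. t (gs ! i)) (map \<sigma> ?N))))"
    using v(1) p1 tens_t[OF set\<sigma>] by (simp add: comp_def)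
  also have "can A (map \<sigma> ?N) ?N \<cdot> tens_arr_list C (map (\<lambda>i. t (gs ! i)) (map \<sigma> ?N))
      = tens_arr_list C (map (\<lambda>i. t (gs ! i)) ?N) \<cdot> f"
    unfolding \<sigma>(2) using set\<sigma> by (subst can_natural[OF A A p1]) auto
  also have "map (\<lambda>i. t (gs ! i)) ?N = map t gs"
    by (subst (2) gs[symmetric]) simp
  also have "M n \<cdot> (can A ?N v \<cdot> (tens_arr_list C (map t gs) \<cdot> f)) = twop' n x \<cdot> f"
    unfolding x'(1) v(2) twop_simps(1)[OF v(1) x'(3,4)] \<sigma>(2) using v(1) p1 x' by simp
  finally show ?thesis .
qed

end

context twisted_monoid
begin

text \<open>Decorations and permutations of the inner operations are pulled out in front of all
  blocks, the blocks are permuted as the outer word demands, and what remains is a product of block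
  products, settled by \<open>mpow_lblocks\<close>.\<close>

lemma twop_comp:
  assumes x: "x \<in> op_set (Assoc_tw G \<phi>) (length ns)"
    and ys: "list_all2 (\<lambda>n y. y \<in> op_set (Assoc_tw G \<phi>) n) ns ys"
  shows "twop' (sum_list ns) (op_comp (Assoc_tw G \<phi>) ns x ys)
    = twop' (length ns) x \<cdot> blocks A (zip ns (map2 twop' ns ys))"
proof -
  have A: "A \<in> Obj C" by simp
  let ?k = "length ns" and ?N = "sum_list ns"
  let ?K = "[0..<?k]"
  obtain w gs where x': "x = (ord_of w, gs)" "perm_words ?K w" "length gs = ?k" "set gs \<subseteq> carrier G"
    using x by (auto simp: mem_op_set_Assoc_tw)
  obtain W H where len: "length ys = ?k" and yWH: "\<forall>i<?k. ys ! i = (ord_of (W i), H i) \<and>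
      perm_words [0..<ns ! i] (W i) \<and> length (H i) = ns ! i \<and> set (H i) \<subseteq> carrier G"
    using Assoc_tw_words[OF ys] by blast
  then have y: "ys ! i = (ord_of (W i), H i)" "perm_words [0..<ns ! i] (W i)"
    "length (H i) = ns ! i" "set (H i) \<subseteq> carrier G"
    if "i < ?k" for i
    using that by simp_all
  have g: "gs ! i \<in> carrier G" if "i < ?k" for i using that x' by (metis nth_mem subsetD)
  define W' where "W' i = (if \<phi> (gs ! i) = 1 then W i else rev (W i))" for i
  define H' where "H' i = map ((\<otimes>\<^bsub>G\<^esub>) (gs ! i)) (H i)" for i
  define HS where "HS = concat (map H' ?K)"
  \<comment> \<open>The decorations of the composite are attached to global labels, so that they can
    be followed through the blocks.\<close>
  define \<tau> where "\<tau> = (\<lambda>q. t (HS ! q))"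
  \<comment> \<open>Block \<open>i\<close> is the interval \<open>l i\<close> of global labels;
    \<open>l' i\<close> lists the same labels in the order of the inner word, reversed when the
    outer decoration is not even.\<close>
  define l where "l i = shift ns i [0..<ns ! i]" for i
  define l' where "l' i = shift ns i (W' i)" for i
  have W': "perm_words [0..<ns ! i] (W' i)" if "i < ?k" for i
    using y(2)[OF that] by (auto simp: W'_def perm_words_def)
  have ll': "perm_words (l i) (l' i)" if "i < ?k" for i
    unfolding l_def l'_def by (rule perm_words_shift[OF W'[OF that]])
  have ll: "length (l i) = ns ! i" for i by (simp add: l_def)
  have cl: "concat (map l ?K) = [0..<?N]" unfolding l_def by (rule concat_shift_upt)
  have H': "set (H' i) \<subseteq> carrier G" "length (H' i) = ns ! i" if "i < ?k" for i
    using y(3,4)[OF that] g[OF that] by (auto simp: H'_def)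
  have mH': "map length (map H' ?K) = ns" using H'(2) by (intro nth_equalityI) auto
  have HS: "length HS = ?N" "set HS \<subseteq> carrier G"
    using H'(1) mH' by (auto simp: HS_def length_concat subset_iff)
  have \<tau>l: "map \<tau> (l i) = map t (H' i)" if "i < ?k" for i
  proof -
    have "map ((!) HS) (l i) = H' i"
      unfolding HS_def l_def using nth_concat_shift[OF mH'] that by simp
    then have "map t (map ((!) HS) (l i)) = map t (H' i)" by simp
    then show ?thesis by (simp add: \<tau>_def comp_def)
  qed
  have \<tau>N: "map \<tau> [0..<?N] = map t HS"
  proof -
    have "map ((!) HS) [0..<?N] = HS" using HS(1) map_nth by metis
    then have "map t (map ((!) HS) [0..<?N]) = map t HS" by simp
    then show ?thesis by (simp add: \<tau>_def comp_def)
  qed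
  have \<tau>: "\<tau> q \<in> Arr C \<and> Dom C (\<tau> q) = A \<and> Cod C (\<tau> q) = A" if "q \<in> set [0..<?N]" for q
    using HS that nth_mem[of q HS] by (auto simp: \<tau>_def subset_iff)
  let ?f = "\<lambda>i. twop' (ns ! i) (ord_of (W i), H i)"
  let ?m = "\<lambda>i. M (length (l i))"
  have bf: "block_family A l ?f ?K"
    using twop_simps(2-4)[OF y(2,3,4)] by (simp add: block_family_def ll)
  have blocks: "blocks A (zip ns (map2 twop' ns ys)) = lblocks A l ?f ?K"
  proof -
    have "zip ns (map2 twop' ns ys) = map (\<lambda>i. (length (l i), ?f i)) ?K"
      using len y(1) by (intro nth_equalityI) (auto simp: ll)
    then show ?thesis by (simp add: lblocks_def)
  qed
  \<comment> \<open>By \<open>t_twop\<close> the outer decoration disappears into the inner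
    operation; the result is written with global labels.\<close>
  have f: "t (gs ! i) \<cdot> ?f i = (?m i \<cdot> can A (l i) (l' i)) \<cdot> tens_arr_list C (map \<tau> (l i))" if
    "i < ?k" for i
  proof -
    have "t (gs ! i) \<cdot> ?f i = twop' (ns ! i) (ord_of (W' i), H' i)"
      using t_twop[OF g[OF that] y(2)[OF that] y(3)[OF that] y(4)[OF that]]
      by (simp add: W'_def H'_def reversal_def ord_of_rev)
    also have "\<dots> = M (ns ! i) \<cdot> (can A [0..<ns ! i] (W' i) \<cdot> tens_arr_list C (map t (H' i)))"
      using twop_simps(1)[OF W' H'(2,1)] that by simp
    also have "can A [0..<ns ! i] (W' i) = can A (l i) (l' i)"
      unfolding l_def l'_def shift_def by (rule can_map[OF A W'[OF that], symmetric]) simp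
    finally show ?thesis
      using \<tau>l[OF that] ll'[OF that] H'[OF that] ll[of i] by simp
  qed
  have p': "perm_words (concat (map l ?K)) (concat (map l' ?K))"
    and lc: "lblocks A l (\<lambda>i. ?m i \<cdot> can A (l i) (l' i)) ?K
        = lblocks A l ?m ?K \<cdot> can A (concat (map l ?K)) (concat (map l' ?K))"
    using lblocks_can[OF A, of l ?m ?K l'] ll' cl by simp_all
  have d': "distinct (concat (map l' ?K))" using p' by (simp add: perm_words_def)
  have p'': "perm_words (concat (map l' ?K)) (concat (map l' w))"
    by (rule perm_words_concat[OF x'(2) d'])
  \<comment> \<open>After the inner permutations the factors of each block are listed by
    \<open>l'\<close>. The block products depend on lengths alone, so they may be indexed by
    \<open>l'\<close> before the blocks themselves are permuted.\<close>
  have m: "lblocks A l ?m js = lblocks A l' (\<lambda>i. M (length (l' i))) js" if "set js \<subseteq> set ?K" for js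
    by (rule lblocks_cong_length[OF A]) (use that ll' perm_words_length in \<open>fastforce+\<close>)
  have bf': "block_family A l (\<lambda>i. ?m i \<cdot> can A (l i) (l' i)) ?K"
    using ll' by (simp add: block_family_def)
  have len': "length (concat (map l' w)) = ?N" "length (concat (map l' ?K)) = ?N"
    using perm_words_length[OF p'] perm_words_length[OF p''] cl by simp_all
  have wK: "length w = ?k" "set w \<subseteq> set ?K" using perm_words_length[OF x'(2)] x'(2)
    by (simp_all add: perm_words_def)
  let ?T = "tens_arr_list C (map \<tau> [0..<?N])"
  have T: "?T \<in> Arr C" "Dom C ?T = opow A ?N \<I>" "Cod C ?T = opow A ?N \<I>"
    using \<tau> by (subst tens_arr_list_simps[where A=A and B=A]; force)+
  let ?L = "\<lambda>js. lblocks A l' (\<lambda>i. M (length (l' i))) js"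
  have "twop' ?k x \<cdot> lblocks A l ?f ?K
      = M ?k \<cdot> (can A ?K w \<cdot> (tens_arr_list C (map t gs) \<cdot> lblocks A l ?f ?K))"
    unfolding x'(1) twop_simps(1)[OF x'(2-4)] using x' lblocks_simps[OF A bf] by simp
  also have "tens_arr_list C (map t gs) = tens_arr_list C (map (\<lambda>i. t (gs ! i)) ?K)"
    using x'(3) map_nth[of gs] by (metis map_map comp_def map_cong)
  also have "\<dots> \<cdot> lblocks A l ?f ?K = lblocks A l (\<lambda>i. t (gs ! i) \<cdot> ?f i) ?K"
    using g by (intro lblocks_post[OF A bf]) simp
  also have "\<dots> = lblocks A l (\<lambda>i. (?m i \<cdot> can A (l i) (l' i)) \<cdot> tens_arr_list C (map \<tau> (l i))) ?K"
    using f by (intro lblocks_cong_length[OF A]) simp_all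
  also have "\<dots> = lblocks A l (\<lambda>i. ?m i \<cdot> can A (l i) (l' i)) ?K \<cdot> ?T"
    using lblocks_tens_arr_list[OF A bf', of \<tau>] \<tau> unfolding cl by blast
  also have "\<dots> = ?L ?K \<cdot> (can A [0..<?N] (concat (map l' ?K)) \<cdot> ?T)"
    unfolding lc m[OF subset_refl] cl using T p'[unfolded cl] len' by simp
  also have "M ?k \<cdot> (can A ?K w \<cdot> (?L ?K \<cdot> (can A [0..<?N] (concat (map l' ?K)) \<cdot> ?T)))
      = M ?k \<cdot> ((can A ?K w \<cdot> ?L ?K) \<cdot> (can A [0..<?N] (concat (map l' ?K)) \<cdot> ?T))"
    using T p'[unfolded cl] len' x'(2) by simp
  \<comment> \<open>The outer permutation of results becomes a permutation of whole blocks.\<close>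
  also have "can A ?K w \<cdot> ?L ?K = ?L w \<cdot> can A (concat (map l' ?K)) (concat (map l' w))"
    by (rule lblocks_natural[OF A x'(2) _ d']) simp
  also have "M ?k \<cdot> ((?L w \<cdot> can A (concat (map l' ?K)) (concat (map l' w)))
      \<cdot> (can A [0..<?N] (concat (map l' ?K)) \<cdot> ?T))
      = (M (length w) \<cdot> ?L w)
          \<cdot> ((can A (concat (map l' ?K)) (concat (map l' w)) \<cdot> can A [0..<?N] (concat (map l' ?K)))
              \<cdot> ?T)"
    using T p'[unfolded cl] p'' len' wK by simp
  also have "M (length w) \<cdot> ?L w = M ?N" unfolding mpow_lblocks len' ..
  also have "can A (concat (map l' ?K)) (concat (map l' w)) \<cdot> can A [0..<?N] (concat (map l' ?K))
      = can A [0..<?N] (concat (map l' w))"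
    by (rule can_trans[OF A p'[unfolded cl] p''])
  also have "M ?N \<cdot> (can A [0..<?N] (concat (map l' w)) \<cdot> ?T)
      = twop' ?N (ord_of (concat (map l' w)), HS)"
    unfolding \<tau>N by (rule twop_simps(1)[OF perm_words_trans[OF p'[unfolded cl] p''] HS, symmetric])
  also have "(ord_of (concat (map l' w)), HS) = op_comp (Assoc_tw G \<phi>) ns x ys"
    unfolding x'(1) HS_def H'_def l'_def W'_def
    by (subst op_comp_Assoc_tw[OF x'(2) y(2) len y(1) x'(3)]) simp_all
  finally show ?thesis unfolding blocks ..
qed

lemma twop_unit: "twop' 1 (op_unit (Assoc_tw G \<phi>)) = run A"
proof -
  have "op_unit (Assoc_tw G \<phi>) = (ord_of [0], [\<one>\<^bsub>G\<^esub>])"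
    by (simp add: Assoc_tw_def semidirect_operad_def Assoc_def)
  then show ?thesis
    using twop_simps(1)[of 1 "[0]" "[\<one>\<^bsub>G\<^esub>]"] mult_unit_right by (simp add: perm_words_def t_one)
qed

text \<open>Each stage of an operation commutes with \<open>h\<close>: the decorations by
  equivariance, the permutation by naturality and the product by \<open>hom_mpow\<close>.\<close>

lemma twop_hom:
  assumes B: "is_monoid C (B, \<mu>', \<eta>')" and h: "is_monoid_hom C (A, \<mu>, \<eta>) (B, \<mu>', \<eta>') h"
    and t': "\<And>g. g \<in> carrier G \<Longrightarrow> t' g \<in> Hom C B B" "\<And>g. g \<in> carrier G \<Longrightarrow> h \<cdot> t g = t' g \<cdot> h"
    and x: "x \<in> op_set (Assoc_tw G \<phi>) n"
  shows "h \<cdot> twop' n x = twop B \<mu>' \<eta>' t' n x \<cdot> tens_arr_list C (replicate n h)"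
proof -
  interpret B: internal_monoid C B \<mu>' \<eta>' by unfold_locales (rule B)
  have A: "A \<in> Obj C" "B \<in> Obj C" by simp_all
  have h' [simp]: "h \<in> Arr C" "Dom C h = A" "Cod C h = B"
    using h by (auto simp: is_monoid_hom_def mem_Hom)
  obtain w gs where x': "x = (ord_of w, gs)" "perm_words [0..<n] w" "length gs = n"
    "set gs \<subseteq> carrier G"
    using x by (auto simp: mem_op_set_Assoc_tw)
  have w: "distinct w" "length w = n" using x'(2) perm_words_length[OF x'(2)]
    by (auto simp: perm_words_def)
  let ?T = "tens_arr_list C (replicate n h)" and ?t = "tens_arr_list C (map t gs)" and ?t' =
    "tens_arr_list C (map t' gs)"
  have T: "?T = tens_arr_list C (map (\<lambda>_. h) w)" "?T = tens_arr_list C (map (\<lambda>_. h) [0..<n])"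
    "?T = tens_arr_list C (map (\<lambda>_. h) gs)"
    using w x' by (simp_all add: map_replicate_const)
  have T': "?T \<in> Arr C" "Dom C ?T = opow A n \<I>" "Cod C ?T = opow B n \<I>"
    unfolding T(2) using tens_arr_list_simps[of "[0..<n]" "\<lambda>_. h" A B] by simp_all
  have t'': "t' g \<in> Arr C \<and> Dom C (t' g) = B \<and> Cod C (t' g) = B" if "g \<in> set gs" for g
    using t'(1) x'(4) that by (auto simp: mem_Hom)
  have tt: "?t' \<in> Arr C" "Dom C ?t' = opow B n \<I>" "Cod C ?t' = opow B n \<I>"
    unfolding x'(3)[symmetric] using t'' by (subst tens_arr_list_simps[where A=B and B=B]; force)+
  have ht: "?T \<cdot> ?t = ?t' \<cdot> ?T"
  proof -
    have "?T \<cdot> ?t = tens_arr_list C (map (\<lambda>g. h \<cdot> t g) gs)"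
      unfolding T(3) using x'(4) by (subst tens_arr_list_Comp[where xs=gs]) auto
    also have "\<dots> = tens_arr_list C (map (\<lambda>g. t' g \<cdot> h) gs)"
      using t'(2) x'(4) by (intro arg_cong[of _ _ "tens_arr_list C"] map_cong) auto
    also have "\<dots> = ?t' \<cdot> ?T"
      unfolding T(3) using t'' by (subst tens_arr_list_Comp[where xs=gs]) auto
    finally show ?thesis .
  qed
  have "h \<cdot> twop' n x = (h \<cdot> M n) \<cdot> (can A [0..<n] w \<cdot> ?t)"
    unfolding x'(1) twop_simps(1)[OF x'(2-4)] using x' by simp
  also have "\<dots> = B.M n \<cdot> ((?T \<cdot> can A [0..<n] w) \<cdot> ?t)"
    unfolding hom_mpow[OF monoid_data B h] using x' T' by simp
  also have "?T \<cdot> can A [0..<n] w = can B [0..<n] w \<cdot> ?T"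
    using can_natural[OF A x'(2), of "\<lambda>_. h"] unfolding T(1)[symmetric] T(2)[symmetric] by simp
  also have "B.M n \<cdot> ((can B [0..<n] w \<cdot> ?T) \<cdot> ?t) = B.M n \<cdot> (can B [0..<n] w \<cdot> (?T \<cdot> ?t))"
    using x' T' by simp
  also have "\<dots> = twop B \<mu>' \<eta>' t' n x \<cdot> ?T"
    unfolding ht using x' T' tt w by (simp add: twop_def)
  finally show ?thesis .
qed

end

section \<open>The monoid of an algebra\<close>

context symmetric_monoidal_category
begin

definition unary :: "'g \<Rightarrow> (nat \<times> nat) set \<times> 'g list" where
  "unary g = (ord_of [0], [g])"

definition std :: "'g \<Rightarrow> nat \<Rightarrow> (nat \<times> nat) set \<times> 'g list" where
  "std e n = (ord_of [0..<n], replicate n e)"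

text \<open>The second tensor power is \<open>A \<odot> (A \<odot> \<I>)\<close>, so the inverse
  unitor supplies the closing unit. The parameter \<open>e\<close> stands for the unit of the
  group.\<close>

definition mult_of :: "'g \<Rightarrow> 'o \<Rightarrow> (nat \<Rightarrow> (nat \<times> nat) set \<times> 'g list \<Rightarrow> 'm) \<Rightarrow> 'm" where
  "mult_of e A a = a 2 (std e 2) \<cdot> (ide A \<star> inv_arr C (run A))"

definition unit_of :: "'g \<Rightarrow> (nat \<Rightarrow> (nat \<times> nat) set \<times> 'g list \<Rightarrow> 'm) \<Rightarrow> 'm" where
  "unit_of e a = a 0 (std e 0)"

definition act_of :: "'o \<Rightarrow> (nat \<Rightarrow> (nat \<times> nat) set \<times> 'g list \<Rightarrow> 'm) \<Rightarrow> 'g \<Rightarrow> 'm" where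
  "act_of A a g = a 1 (unary g) \<cdot> inv_arr C (run A)"

context
  fixes A
  assumes A [simp]: "A \<in> Obj C"
begin

lemma app_unit: "app A n \<I> = run (opow A n \<I>)"
  by (induction n) (simp_all add: lunitor_unit runitor_tens)

lemma run_hat: "f \<in> Arr C \<Longrightarrow> Dom C f = opow A n \<I> \<Longrightarrow> run (Cod C f) \<cdot> hat A n f \<I> = f"
  by (simp add: hat_def app_unit Comp2_ext[OF runitor_natural])

lemma hat_one: "u \<in> Arr C \<Longrightarrow> Dom C u = A \<Longrightarrow> X \<in> Obj C \<Longrightarrow> hat A (Suc 0) (u \<cdot> run A) X = u \<star> ide X"
  by (rule hat_eqI) (simp_all add: triangle)

lemma hat_run [simp]: "X \<in> Obj C \<Longrightarrow> hat A (Suc 0) (run A) X = ide (A \<odot> X)"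
  using hat_one[of "ide A" X] by simp

lemma hat_zero: "u \<in> Arr C \<Longrightarrow> Dom C u = \<I> \<Longrightarrow> X \<in> Obj C \<Longrightarrow> hat A 0 u X
    = (u \<star> ide X) \<cdot> inv_arr C (lun X)"
  by (rule hat_eqI) simp_all

text \<open>The triangle absorbs the unit that closes the block of two factors; what is left is the
  rebracketing that puts these two factors together in front.\<close>

lemma hat_two:
  assumes "u \<in> Arr C" "Dom C u = A \<odot> A" "X \<in> Obj C"
  shows "hat A (Suc (Suc 0)) (u \<cdot> (ide A \<star> run A)) X = (u \<star> ide X) \<cdot> \<alpha>' A A X"
proof (rule hat_eqI)
  have "app A (Suc (Suc 0)) X = (ide A \<star> ((ide A \<star> lun X) \<cdot> \<alpha> A \<I> X)) \<cdot> \<alpha> A (A \<odot> \<I>) X"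
    using assms by simp
  also have "(ide A \<star> lun X) \<cdot> \<alpha> A \<I> X = run A \<star> ide X"
    using assms by (simp add: triangle)
  also have "(ide A \<star> (run A \<star> ide X)) \<cdot> \<alpha> A (A \<odot> \<I>) X = \<alpha> A A X \<cdot> ((ide A \<star> run A) \<star> ide X)"
    using associator_natural[of "ide A" "run A" "ide X"] assms by simp
  finally show "((u \<star> ide X) \<cdot> \<alpha>' A A X) \<cdot> app A (Suc (Suc 0)) X = (u \<cdot> (ide A \<star> run A)) \<star> ide X"
    using assms by simp
qed (use assms in simp_all)

lemma blocks_unary:
  "(\<And>u. u \<in> set us \<Longrightarrow> u \<in> Arr C \<and> Dom C u = A \<and> Cod C u = A) \<Longrightarrow>
    blocks A (map (\<lambda>u. (Suc 0, u \<cdot> run A)) us) = tens_arr_list C us \<and>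
    tens_arr_list C us \<in> Arr C \<and> Dom C (tens_arr_list C us)
        = opow A (length us) \<I> \<and> Cod C (tens_arr_list C us) = opow A (length us) \<I>"
  by (induction us) (simp_all add: hat_one tens_split comp_def sum_list_triv)

lemma run_swap: "(ide A \<star> run A) \<cdot> sw A A \<I> = sym A A \<cdot> (ide A \<star> run A)"
proof -
  have "(ide A \<star> run A) \<cdot> sw A A \<I> = ((ide A \<star> lun A) \<cdot> \<alpha> A \<I> A) \<cdot> sym A (A \<odot> \<I>)"
    using lpow_run_ins[OF A, of "Suc 0"] by simp
  also have "\<dots> = sym A A \<cdot> (ide A \<star> run A)"
    using triangle[of A A] symmetry_natural[of "ide A" "run A"] by simp
  finally show ?thesis .
qed

end

end

text \<open>An algebra presented by its operations \<open>a n x\<close> in place of structure maps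
  out of set tensors, with associativity stated on the flat tensor power through
  \<open>blocks\<close>. \<open>is_algebra_iff\<close> justifies this form.\<close>

locale twisted_algebra = symmetric_monoidal_category C + group G
  for C :: "('o, 'm, 'z) smc_scheme" (structure) and G :: "('g, 'y) monoid_scheme" +
  fixes \<phi> :: "'g \<Rightarrow> int" and A :: 'o and a :: "nat \<Rightarrow> (nat \<times> nat) set \<times> 'g list \<Rightarrow> 'm"
  assumes \<phi>: "\<phi> \<in> hom G C2"
    and A [simp]: "A \<in> Obj C"
    and a_Hom: "x \<in> op_set (Assoc_tw G \<phi>) n \<Longrightarrow> a n x \<in> Hom C (opow A n \<I>) A"
    and a_unit: "a 1 (op_unit (Assoc_tw G \<phi>)) = run A"
    and a_comp: "x \<in> op_set (Assoc_tw G \<phi>) (length ns) \<Longrightarrow>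
        list_all2 (\<lambda>n y. y \<in> op_set (Assoc_tw G \<phi>) n) ns ys \<Longrightarrow>
        a (sum_list ns) (op_comp (Assoc_tw G \<phi>) ns x ys)
            = a (length ns) x \<cdot> blocks A (zip ns (map2 a ns ys))"
    and a_perm: "x \<in> op_set (Assoc_tw G \<phi>) n \<Longrightarrow> perm_arr C A n \<sigma> f \<Longrightarrow>
        a n (op_perm (Assoc_tw G \<phi>) n x \<sigma>) = a n x \<cdot> f"
begin

abbreviation "e \<equiv> \<one>\<^bsub>G\<^esub>"
abbreviation "\<mu> \<equiv> mult_of e A a"
abbreviation "\<eta> \<equiv> unit_of e a"
abbreviation "t \<equiv> act_of A a"
abbreviation "P \<equiv> Assoc_tw G \<phi>"

lemma a_simps:
  "x \<in> op_set P n \<Longrightarrow> a n x \<in> Arr C" "x \<in> op_set P n \<Longrightarrow> Dom C (a n x) = opow A n \<I>"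
  "x \<in> op_set P n \<Longrightarrow> Cod C (a n x) = A"
  using a_Hom by (auto simp: mem_Hom)

lemma \<phi>_one: "\<phi> e = 1"
proof -
  have "\<phi> e = 1 \<or> \<phi> e = -1" using hom_in_carrier[OF \<phi> one_closed] by (simp add: C2_def)
  moreover have "\<phi> e = \<phi> e * \<phi> e" using hom_mult[OF \<phi> one_closed one_closed] by (simp add: C2_def)
  ultimately show ?thesis by auto
qed

lemma unary_op_set [simp]: "g \<in> carrier G \<Longrightarrow> unary g \<in> op_set P (Suc 0)"
  by (auto simp: mem_op_set_Assoc_tw unary_def perm_words_upt_Suc simp del: ord_of.simps)

lemma std_op_set [simp]: "std e n \<in> op_set P n"
  unfolding mem_op_set_Assoc_tw std_def using perm_words_refl[of "[0..<n]"]
  by (intro exI[of _ "[0..<n]"]) auto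

lemma unit_simps [simp]: "\<eta> \<in> Arr C" "Dom C \<eta> = \<I>" "Cod C \<eta> = A"
  using a_simps[OF std_op_set[of 0]] by (simp_all add: unit_of_def)

lemma act_simps [simp]:
  assumes "g \<in> carrier G"
  shows "t g \<in> Arr C" "Dom C (t g) = A" "Cod C (t g) = A" "a (Suc 0) (unary g) = t g \<cdot> run A"
  using assms a_simps[of "unary g" "Suc 0"] by (simp_all add: act_of_def)

lemma mult_simps [simp]:
  "\<mu> \<in> Arr C" "Dom C \<mu> = A \<odot> A" "Cod C \<mu> = A"
  "a (Suc (Suc 0)) (std e (Suc (Suc 0))) = \<mu> \<cdot> (ide A \<star> run A)"
proof -
  note [simp] = a_simps[OF std_op_set[of 2]]
  have *: "opow A 2 \<I> = A \<odot> (A \<odot> \<I>)" by (simp add: eval_nat_numeral)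
  show "\<mu> \<in> Arr C" "Dom C \<mu> = A \<odot> A" "Cod C \<mu> = A"
    by (simp_all add: mult_of_def *)
  have "a 2 (std e 2) = \<mu> \<cdot> (ide A \<star> run A)"
    by (simp add: mult_of_def * flip: whisker_Comp)
  then show "a (Suc (Suc 0)) (std e (Suc (Suc 0))) = \<mu> \<cdot> (ide A \<star> run A)"
    by (simp add: numeral_2_eq_2)
qed

lemma unary_one: "a (Suc 0) (unary e) = run A" "t e = ide A"
proof -
  have "unary e = op_unit P"
    by (simp add: unary_def Assoc_tw_def semidirect_operad_def Assoc_def)
  then show "a (Suc 0) (unary e) = run A" using a_unit by simp
  then show "t e = ide A" by (simp add: act_of_def del: act_simps)
qed

lemma std_simps: "std e 0 = (ord_of [], [])" "std e (Suc 0) = unary e"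
  "std e (Suc (Suc 0)) = (ord_of [0, Suc 0], [e, e])"
  by (simp_all add: std_def unary_def)

lemma comp_unary:
  assumes "g \<in> carrier G" "perm_words [0..<n] w"
  shows "op_comp P [n] (unary g) [(ord_of w, hs)] = (reversal (\<phi> g) (ord_of w), map ((\<otimes>\<^bsub>G\<^esub>) g) hs)"
  using op_comp_Assoc_tw[of "[n]" "[0]" "\<lambda>_. w" "[(ord_of w, hs)]" "\<lambda>_. hs" "[g]" G \<phi>] assms(2)
  unfolding unary_def
  by (simp add: perm_words_upt_Suc shift_zero reversal_def ord_of_rev del: ord_of.simps)

text \<open>Substitution into a unary operation realises the action of \<open>G\<close> on the
  operad. Taking the inner operation unary, nullary or binary gives \<open>t_mult\<close>,
  \<open>t_unit\<close> and half of \<open>t_mu\<close>.\<close>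

lemma act_comp:
  assumes g: "g \<in> carrier G" and y: "(ord_of w, hs) \<in> op_set P n" and w: "perm_words [0..<n] w"
  shows "a n (reversal (\<phi> g) (ord_of w), map ((\<otimes>\<^bsub>G\<^esub>) g) hs) = t g \<cdot> a n (ord_of w, hs)"
proof -
  have "a n (op_comp P [n] (unary g) [(ord_of w, hs)])
      = (t g \<cdot> run A) \<cdot> hat A n (a n (ord_of w, hs)) \<I>"
    using a_comp[of "unary g" "[n]" "[(ord_of w, hs)]"] g y a_simps[OF y] by simp
  also have "\<dots> = t g \<cdot> a n (ord_of w, hs)"
    using a_simps[OF y] g run_hat[OF A, of "a n (ord_of w, hs)" n] by simp
  finally show ?thesis unfolding comp_unary[OF g w] .
qed

lemma t_mult: "g \<in> carrier G \<Longrightarrow> h \<in> carrier G \<Longrightarrow> t (g \<otimes>\<^bsub>G\<^esub> h) = t g \<cdot> t h"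
proof -
  assume g: "g \<in> carrier G" and h: "h \<in> carrier G"
  have r: "reversal (\<phi> g) (ord_of [0]) = ord_of [0::nat]" by (auto simp: reversal_def)
  have "a (Suc 0) (unary (g \<otimes>\<^bsub>G\<^esub> h)) = t g \<cdot> a (Suc 0) (unary h)"
    using act_comp[OF g, of "[0]" "[h]" "Suc 0"] unary_op_set[OF h] unfolding r unary_def
    by (simp add: perm_words_upt_Suc del: ord_of.simps)
  then have "t (g \<otimes>\<^bsub>G\<^esub> h) \<cdot> run A = (t g \<cdot> t h) \<cdot> run A" using g h by simp
  then show ?thesis by (rule cancel_epi[rotated]) (use g h in simp_all)
qed

text \<open>The nullary operation has an empty order and no decorations, so the action on the operad
  fixes it.\<close>

lemma t_unit: "g \<in> carrier G \<Longrightarrow> t g \<cdot> \<eta> = \<eta>"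
  using act_comp[of g "[]" "[]" 0] std_op_set[of 0]
  by (simp add: unit_of_def std_simps reversal_def split: if_splits)

text \<open>The outer decorations are the unit, which is even, so the inner orders are kept. The
  outer order \<open>r\<close> is arbitrary because odd elements produce the reversed one in
  \<open>t_mu\<close>.\<close>

lemma comp_binary:
  assumes r: "perm_words [0, Suc 0] r"
    and "(ord_of v, gs) \<in> op_set P m" "(ord_of w, hs) \<in> op_set P n"
    and vw: "perm_words [0..<m] v" "perm_words [0..<n] w"
  shows "a (m + n) (ord_of (concat (map (\<lambda>i. shift [m, n] i (if i = 0 then v else w)) r)), gs @ hs)
    = a (Suc (Suc 0)) (ord_of r, [e, e])
        \<cdot> blocks A [(m, a m (ord_of v, gs)), (n, a n (ord_of w, hs))]"
proof -
  have gh: "set gs \<subseteq> carrier G" "set hs \<subseteq> carrier G" using assms(2,3)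
    by (auto simp: mem_op_set_Assoc_tw)
  then have id: "map ((\<otimes>\<^bsub>G\<^esub>) e) gs = gs" "map ((\<otimes>\<^bsub>G\<^esub>) e) hs = hs" by (auto intro!: map_idI)
  have x: "(ord_of r, [e, e]) \<in> op_set P (Suc (Suc 0))"
    using r by (auto simp: mem_op_set_Assoc_tw simp del: ord_of.simps)
  have s: "set r = {0, Suc 0}" using r by (auto simp: perm_words_def)
  have "op_comp P [m, n] (ord_of r, [e, e]) [(ord_of v, gs), (ord_of w, hs)]
      = (ord_of (concat (map (\<lambda>i. shift [m, n] i (if i = 0 then v else w)) r)), gs @ hs)"
  proof -
    have 1: "perm_words [0..<[m, n] ! i] (if i = 0 then v else w)" if "i < length [m, n]" for i
      using that vw by (auto simp: less_Suc_eq)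
    have 2: "[(ord_of v, gs), (ord_of w, hs)] ! i
        = (ord_of (if i = 0 then v else w), if i = 0 then gs else hs)" if "i < length [m, n]" for i
      using that by (auto simp: less_Suc_eq)
    have "op_comp P [m, n] (ord_of r, [e, e]) [(ord_of v, gs), (ord_of w, hs)]
      = (ord_of (concat (map (\<lambda>i. shift [m, n] i (if \<phi> ([e, e] ! i) = 1 then if i
          = 0 then v else w else rev (if i = 0 then v else w))) r)),
        concat (map (\<lambda>i. map ((\<otimes>\<^bsub>G\<^esub>) ([e, e] ! i)) (if i
            = 0 then gs else hs)) [0..<length [m, n]]))"
      by (rule op_comp_Assoc_tw) (use r 1 2 in auto)
    moreover have "map (\<lambda>i. shift [m, n] i (if \<phi> ([e, e] ! i) = 1 then if i
        = 0 then v else w else rev (if i = 0 then v else w))) r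
      = map (\<lambda>i. shift [m, n] i (if i = 0 then v else w)) r"
      by (rule map_cong) (auto simp: s \<phi>_one)
    ultimately show ?thesis using id by simp
  qed
  then show ?thesis
    using a_comp[OF _, of "(ord_of r, [e, e])" "[m, n]" "[(ord_of v, gs), (ord_of w, hs)]"] x assms
    by simp
qed

text \<open>The reversed binary order is the standard one pulled back along the transposition, so
  equivariance supplies the symmetry.\<close>

lemma a_swap: "a (Suc (Suc 0)) (ord_of [Suc 0, 0], [e, e]) = (\<mu> \<cdot> sym A A) \<cdot> (ide A \<star> run A)"
proof -
  let ?h = "transpose 0 (Suc 0)"
  have p: "perm_arr C A (Suc (Suc 0)) (?h \<circ> id) (swap_at C A (Suc (Suc 0)) 0
      \<cdot> ide (tens_pow C A (Suc (Suc 0))))"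
    by (intro perm_arr_swap perm_arr_id) simp
  have s: "swap_at C A (Suc (Suc 0)) 0 = sw A A \<I>" by (simp add: sw_def)
  have "bij_betw ?h {..<Suc (Suc 0)} {..<Suc (Suc 0)}"
    by (rule bij_betw_byWitness[of _ ?h]) (auto simp: transpose_def)
  from op_perm_Assoc[OF this, of "[Suc 0, 0]"]
  have "op_perm P (Suc (Suc 0)) (std e (Suc (Suc 0))) ?h = (ord_of [Suc 0, 0], [e, e])"
    by (simp add: std_simps Assoc_tw_def semidirect_operad_def perm_words_upt_Suc transpose_def del: ord_of.simps)
  then have "a (Suc (Suc 0)) (ord_of [Suc 0, 0], [e, e])
      = a (Suc (Suc 0)) (std e (Suc (Suc 0))) \<cdot> sw A A \<I>"
    using a_perm[OF std_op_set p] unfolding s by simp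
  also have "\<dots> = \<mu> \<cdot> ((ide A \<star> run A) \<cdot> sw A A \<I>)" by simp
  finally show ?thesis by (simp add: run_swap)
qed

text \<open>The binary operation with both inputs decorated by \<open>g\<close> is evaluated in two
  ways: as \<open>g\<close> applied to the standard multiplication, which reverses the order for odd
  \<open>g\<close>, and as the binary operation of order \<open>?r\<close> with \<open>g\<close>
  substituted in both inputs.\<close>

lemma t_mu:
  assumes g: "g \<in> carrier G"
  shows "t g \<cdot> \<mu> = (if \<phi> g = 1 then \<mu> else \<mu> \<cdot> sym A A) \<cdot> (t g \<star> t g)"
proof -
  let ?r = "if \<phi> g = 1 then [0, Suc 0] else [Suc 0, 0]"
  let ?\<mu> = "if \<phi> g = 1 then \<mu> else \<mu> \<cdot> sym A A"
  have rev: "reversal (\<phi> g) (ord_of [0, Suc 0]) = ord_of ?r"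
    using ord_of_rev[of "[0, Suc 0]"] by (simp add: reversal_def del: ord_of.simps)
  have "a (Suc (Suc 0)) (ord_of ?r, [g, g]) = t g \<cdot> a (Suc (Suc 0)) (std e (Suc (Suc 0)))"
    using act_comp[OF g, of "[0, Suc 0]" "[e, e]" "Suc (Suc 0)"] std_op_set[of "Suc (Suc 0)"] g
    by (simp add: rev std_simps perm_words_upt_Suc del: ord_of.simps)
  moreover have
    "a (Suc (Suc 0)) (ord_of ?r, [g, g])
        = a (Suc (Suc 0)) (ord_of ?r, [e, e])
            \<cdot> blocks A [(Suc 0, a (Suc 0) (unary g)), (Suc 0, a (Suc 0) (unary g))]"
    using comp_binary[of ?r "[0]" "[g]" "Suc 0" "[0]" "[g]" "Suc 0"] unary_op_set[OF g]
    by (cases "\<phi> g = 1")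
      (simp_all add: unary_def perm_words_upt_Suc shift_def del: ord_of.simps blocks.simps)
  moreover have
    "blocks A [(Suc 0, a (Suc 0) (unary g)), (Suc 0, a (Suc 0) (unary g))] = t g \<star> (t g \<star> ide \<I>)"
    using blocks_unary[OF A, of "[t g, t g]"] g by simp
  moreover have "a (Suc (Suc 0)) (ord_of ?r, [e, e]) = ?\<mu> \<cdot> (ide A \<star> run A)"
    using a_swap mult_simps(4) by (simp add: std_simps del: ord_of.simps)
  ultimately have "t g \<cdot> (\<mu> \<cdot> (ide A \<star> run A)) = (?\<mu> \<cdot> (ide A \<star> run A)) \<cdot> (t g \<star> (t g \<star> ide \<I>))"
    by simp
  also have "\<dots> = ?\<mu> \<cdot> (t g \<star> (run A \<cdot> (t g \<star> ide \<I>)))"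
    using g by (simp add: interchange)
  also have "\<dots> = (?\<mu> \<cdot> (t g \<star> t g)) \<cdot> (ide A \<star> run A)"
    using g runitor_natural[of "t g"] by (simp add: interchange)
  finally have "(t g \<cdot> \<mu>) \<cdot> (ide A \<star> run A) = (?\<mu> \<cdot> (t g \<star> t g)) \<cdot> (ide A \<star> run A)"
    using g by simp
  then show ?thesis by (rule cancel_epi[rotated]) (use g in simp_all)
qed

lemma comp_binary_std:
  "a (m + n) (std e (m + n))
      = \<mu> \<cdot> ((ide A \<star> run A) \<cdot> blocks A [(m, a m (std e m)), (n, a n (std e n))])"
proof -
  have w: "concat (map (\<lambda>i. shift [m, n] i (if i = 0 then [0..<m] else [0..<n])) [0, Suc 0])
      = [0..<m + n]"
    using concat_shift_upt[of "[m, n]"] by (simp add: shift_def)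
  have B: "blocks A [(m, a m (std e m)), (n, a n (std e n))] \<in> Arr C"
    "Cod C (blocks A [(m, a m (std e m)), (n, a n (std e n))]) = A \<odot> (A \<odot> \<I>)"
    using a_simps[OF std_op_set[of m]] a_simps[OF std_op_set[of n]] by simp_all
  have "a (m + n) (std e (m + n))
      = a (Suc (Suc 0)) (std e (Suc (Suc 0))) \<cdot> blocks A [(m, a m (std e m)), (n, a n (std e n))]"
    using comp_binary[of "[0, Suc 0]" "[0..<m]" "replicate m e" m "[0..<n]" "replicate n e" n]
      std_op_set
    unfolding w std_simps unfolding std_def
    by (simp add: perm_words_upt_Suc perm_words_refl replicate_add del: ord_of.simps blocks.simps upt_Suc)
  then show ?thesis using B by (simp del: blocks.simps)
qed

text \<open>The laws come from \<open>comp_binary_std\<close>: the splittings \<open>0 + 1\<close>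
  and \<open>1 + 0\<close> of the unary operation give the unit laws, and the splittings
  \<open>2 + 1\<close> and \<open>1 + 2\<close> of the ternary one give associativity, after
  cancelling right unitors where they remain.\<close>

lemma is_monoid_data: "is_monoid C (A, \<mu>, \<eta>)"
proof -
  have e0: "a 0 (std e 0) = \<eta>" by (simp add: unit_of_def)
  have e1: "a (Suc 0) (std e (Suc 0)) = run A" by (simp add: std_simps unary_one)
  have e2: "a (Suc (Suc 0)) (std e (Suc (Suc 0))) = \<mu> \<cdot> (ide A \<star> run A)" by simp
  have unit_left: "\<mu> \<cdot> (\<eta> \<star> ide A) = lun A"
  proof (rule cancel_epi)
    show "iso_arr C (ide \<I> \<star> run A)" by simp
    have "run A = \<mu> \<cdot> ((ide A \<star> run A) \<cdot> ((\<eta> \<star> ide (A \<odot> \<I>)) \<cdot> inv_arr C (lun (A \<odot> \<I>))))"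
      using comp_binary_std[of 0 "Suc 0"] by (simp add: e0 e1 hat_zero)
    then have "run A \<cdot> lun (A \<odot> \<I>)
        = (\<mu> \<cdot> ((ide A \<star> run A) \<cdot> ((\<eta> \<star> ide (A \<odot> \<I>)) \<cdot> inv_arr C (lun (A \<odot> \<I>))))) \<cdot> lun (A \<odot> \<I>)"
      by (rule arg_cong)
    then show "(\<mu> \<cdot> (\<eta> \<star> ide A)) \<cdot> (ide \<I> \<star> run A) = lun A \<cdot> (ide \<I> \<star> run A)"
      using lunitor_natural[of "run A"] by (simp add: interchange)
  qed simp_all
  have unit_right: "\<mu> \<cdot> (ide A \<star> \<eta>) = run A"
    using comp_binary_std[of "Suc 0" 0] run_hat[OF A, of \<eta> 0]
    by (simp add: e0 e1 flip: whisker_Comp)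
  have "\<mu> \<cdot> ((ide A \<star> run A) \<cdot> ((\<mu> \<star> ide (A \<odot> \<I>)) \<cdot> \<alpha>' A A (A \<odot> \<I>)))
      = a (Suc (Suc (Suc 0))) (std e (Suc (Suc (Suc 0))))"
    using comp_binary_std[of "Suc (Suc 0)" "Suc 0"] by (simp add: e1 e2 hat_two)
  also have "\<dots> = \<mu> \<cdot> (ide A \<star> (run A \<cdot> hat A (Suc (Suc 0)) (\<mu> \<cdot> (ide A \<star> run A)) \<I>))"
    using comp_binary_std[of "Suc 0" "Suc (Suc 0)"] by (simp add: e1 e2)
  also have "\<dots> = \<mu> \<cdot> (ide A \<star> (\<mu> \<cdot> (ide A \<star> run A)))"
    using run_hat[OF A, of "\<mu> \<cdot> (ide A \<star> run A)" "Suc (Suc 0)"] by simp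
  finally have
    eq: "\<mu> \<cdot> ((ide A \<star> run A) \<cdot> ((\<mu> \<star> ide (A \<odot> \<I>)) \<cdot> \<alpha>' A A (A \<odot> \<I>)))
        = \<mu> \<cdot> (ide A \<star> (\<mu> \<cdot> (ide A \<star> run A)))" .
  have assoc: "\<mu> \<cdot> (\<mu> \<star> ide A) = \<mu> \<cdot> ((ide A \<star> \<mu>) \<cdot> \<alpha> A A A)"
  proof (rule cancel_epi)
    show "iso_arr C (ide (A \<odot> A) \<star> run A)" by simp
    have "(\<mu> \<cdot> (\<mu> \<star> ide A)) \<cdot> (ide (A \<odot> A) \<star> run A)
        = (\<mu> \<cdot> ((ide A \<star> run A) \<cdot> ((\<mu> \<star> ide (A \<odot> \<I>)) \<cdot> \<alpha>' A A (A \<odot> \<I>)))) \<cdot> \<alpha> A A (A \<odot> \<I>)"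
      by (simp add: interchange)
    also have "\<dots> = (\<mu> \<cdot> ((ide A \<star> \<mu>) \<cdot> \<alpha> A A A)) \<cdot> (ide (A \<odot> A) \<star> run A)"
      unfolding eq using associator_natural[of "ide A" "ide A" "run A"] by simp
    finally show
      "(\<mu> \<cdot> (\<mu> \<star> ide A)) \<cdot> (ide (A \<odot> A) \<star> run A)
          = (\<mu> \<cdot> ((ide A \<star> \<mu>) \<cdot> \<alpha> A A A)) \<cdot> (ide (A \<odot> A) \<star> run A)" .
  qed simp_all
  show ?thesis using unit_left unit_right assoc by (simp add: is_monoid_def mem_Hom)
qed

lemma twisted_monoid_data: "twisted_monoid C A \<mu> \<eta> G \<phi> t"
  by unfold_locales (simp_all add: is_monoid_data \<phi> mem_Hom unary_one t_mult t_unit t_mu)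

end

context twisted_algebra
begin

text \<open>The splitting \<open>1 + n\<close> of the standard operation is the recursion of
  \<open>mpow\<close>.\<close>

lemma a_std: "a n (std e n) = mpow A \<mu> \<eta> n"
proof (induction n)
  case 0
  then show ?case by (simp add: unit_of_def)
next
  case (Suc n)
  interpret D: twisted_monoid C A \<mu> \<eta> G \<phi> t by (rule twisted_monoid_data)
  have "a (Suc n) (std e (Suc n)) = \<mu> \<cdot> (ide A \<star> (run A \<cdot> hat A n (D.M n) \<I>))"
    using comp_binary_std[of "Suc 0" n] by (simp add: Suc.IH std_simps unary_one)
  also have "run A \<cdot> hat A n (D.M n) \<I> = D.M n"
    using run_hat[OF A, of "D.M n" n] by simp
  finally show ?case by simp
qed

text \<open>The order of \<open>w\<close> is the standard order pulled back along a permutation that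
  takes \<open>w\<close> to the standard word, so equivariance applies.\<close>

lemma a_perm_std:
  assumes w: "perm_words [0..<n] w"
  shows "a n (ord_of w, replicate n e) = mpow A \<mu> \<eta> n \<cdot> can A [0..<n] w"
proof -
  obtain \<sigma> where \<sigma>: "perm_arr C A n \<sigma> (can A [0..<n] w)" "map \<sigma> w = [0..<n]"
    using perm_arr_exists[OF A w] by blast
  have b: "bij_betw \<sigma> {..<n} {..<n}" by (rule perm_arr_can(1)[OF A \<sigma>(1)])
  have "map (\<lambda>i. replicate n e ! \<sigma> i) [0..<n] = replicate n e"
    using bij_betwE[OF b] by (intro nth_equalityI) auto
  then have "op_perm P n (std e n) \<sigma> = (ord_of w, replicate n e)"
    using op_perm_Assoc[OF b w] unfolding \<sigma>(2)
    by (simp add: std_def Assoc_tw_def semidirect_operad_def)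
  then show ?thesis using a_perm[OF std_op_set \<sigma>(1)] by (simp add: a_std)
qed

text \<open>Each element of the operad is an order with unit decorations into whose inputs unary
  operations are substituted. Its operation is therefore determined by the product, a permutation
  and the action.\<close>

lemma a_eq_twop:
  assumes "x \<in> op_set P n"
  shows "a n x = twop A \<mu> \<eta> t n x"
proof -
  interpret D: twisted_monoid C A \<mu> \<eta> G \<phi> t by (rule twisted_monoid_data)
  obtain w gs where x: "x = (ord_of w, gs)" "perm_words [0..<n] w" "length gs = n"
    "set gs \<subseteq> carrier G"
    using assms by (auto simp: mem_op_set_Assoc_tw)
  let ?ns = "replicate n (Suc 0)" and ?ys = "map unary gs"
  have len: "length ?ns = n" "sum_list ?ns = n" by (simp_all add: sum_list_replicate)
  have c: "op_comp P ?ns (ord_of w, replicate n e) ?ys = x"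
  proof -
    have "op_comp P ?ns (ord_of w, replicate n e) ?ys
      = (ord_of (concat (map (\<lambda>i. shift ?ns i (if \<phi> (replicate n e ! i)
          = 1 then [0] else rev [0])) w)),
         concat (map (\<lambda>i. map ((\<otimes>\<^bsub>G\<^esub>) (replicate n e ! i)) [gs ! i]) [0..<length ?ns]))"
      by (rule op_comp_Assoc_tw)
        (use x in \<open>auto simp: unary_def perm_words_upt_Suc simp del: ord_of.simps\<close>)
    \<comment> \<open>All blocks have length one, so the offset of block \<open>i\<close> is
      \<open>i\<close> itself.\<close>
    moreover have
      "map (\<lambda>i. shift ?ns i (if \<phi> (replicate n e ! i) = 1 then [0] else rev [0])) w
          = map (\<lambda>i. [i]) w"
      using x(2) by (auto simp: shift_def sum_list_replicate perm_words_upt)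
    moreover have "map (\<lambda>i. replicate n e ! i \<otimes>\<^bsub>G\<^esub> gs ! i) [0..<n] = gs"
      using x(3,4) by (intro nth_equalityI) (auto simp: subset_iff)
    ultimately show ?thesis using x(1) by simp
  qed
  have y: "list_all2 (\<lambda>n y. y \<in> op_set P n) ?ns ?ys"
    using x(3,4) by (auto simp: list_all2_conv_all_nth subset_iff)
  have x': "(ord_of w, replicate n e) \<in> op_set P (length ?ns)"
    using x(2) by (auto simp: mem_op_set_Assoc_tw)
  have z: "zip ?ns (map2 a ?ns ?ys) = map (\<lambda>u. (Suc 0, u \<cdot> run A)) (map t gs)"
    using x(3,4) by (intro nth_equalityI) (auto simp: subset_iff)
  have "u \<in> Arr C \<and> Dom C u = A \<and> Cod C u = A" if "u \<in> set (map t gs)" for u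
    using that x(4) by auto
  from blocks_unary[OF A this] have
    "blocks A (zip ?ns (map2 a ?ns ?ys)) = tens_arr_list C (map t gs)"
    unfolding z by blast
  then have "a n x = a n (ord_of w, replicate n e) \<cdot> tens_arr_list C (map t gs)"
    using a_comp[OF x' y] unfolding c len by simp
  also have "\<dots> = D.twop' n x"
    unfolding x(1) a_perm_std[OF x(2)] D.twop_simps(1)[OF x(2-4)] using x by simp
  finally show ?thesis .
qed

end

context twisted_monoid
begin

lemma twisted_algebra_twop: "twisted_algebra C G \<phi> A twop'"
proof unfold_locales
  fix x n assume "x \<in> op_set (Assoc_tw G \<phi>) n"
  then obtain w gs where "x = (ord_of w, gs)" "perm_words [0..<n] w" "length gs = n"
    "set gs \<subseteq> carrier G"
    by (auto simp: mem_op_set_Assoc_tw)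
  then show "twop' n x \<in> Hom C (opow A n \<I>) A" using twop_simps(2-4) by (simp add: mem_Hom)
qed (use \<phi> twop_unit twop_comp twop_perm in \<open>(simp; fail | blast)+\<close>)

text \<open>This and the next two lemmas read the original data back off the operations; with
  \<open>a_eq_twop\<close> the two constructions are mutually inverse.\<close>

lemma unit_of_twop: "unit_of \<one>\<^bsub>G\<^esub> twop' = \<eta>"
  by (simp add: unit_of_def std_def twop_def)

lemma mult_of_twop: "mult_of \<one>\<^bsub>G\<^esub> A twop' = \<mu>"
proof -
  have "twop' (Suc (Suc 0)) (ord_of [0, Suc 0], [\<one>\<^bsub>G\<^esub>, \<one>\<^bsub>G\<^esub>]) = \<mu> \<cdot> (ide A \<star> run A)"
    using twop_simps(1)[of "Suc (Suc 0)" "[0, Suc 0]" "[\<one>\<^bsub>G\<^esub>, \<one>\<^bsub>G\<^esub>]"] mult_unit_right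
    by (simp add: perm_words_upt_Suc can_self t_one del: ord_of.simps can.simps flip: whisker_Comp)
  then show ?thesis
    by (simp add: mult_of_def std_def numeral_2_eq_2 del: ord_of.simps flip: whisker_Comp)
qed

lemma act_of_twop:
  assumes "g \<in> carrier G"
  shows "act_of A twop' g = t g"
proof -
  have "twop' (Suc 0) (ord_of [0], [g]) = run A \<cdot> (t g \<star> ide \<I>)"
    using twop_simps(1)[of "Suc 0" "[0]" "[g]"] mult_unit_right assms
    by (simp add: perm_words_upt_Suc can_self del: ord_of.simps can.simps)
  then show ?thesis using runitor_natural[of "t g"] assms
    by (simp add: act_of_def unary_def del: ord_of.simps)
qed

end

section \<open>Structure maps and families of operations\<close>

locale tensored_smc = symmetric_monoidal_category C + tensored_over_Set C T + group G
  for C :: "('o, 'm, 'z) smc_scheme" (structure)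
    and T :: "((nat \<times> nat) set \<times> 'g list, 'o, 'm) tensoring"
    and G :: "('g, 'y) monoid_scheme" +
  fixes \<phi> :: "'g \<Rightarrow> int"
  assumes \<phi>: "\<phi> \<in> hom G C2"
begin

abbreviation "P \<equiv> Assoc_tw G \<phi>"
abbreviation "src A n \<equiv> set_tens T (op_set P n) (opow A n \<I>)"
abbreviation "oact A \<theta> \<equiv> op_act C T P A \<theta>"

lemma oact_def: "oact A \<theta> n x = \<theta> n \<cdot> set_incl T (op_set P n) (opow A n \<I>) x"
  by (simp add: op_act_def tens_pow_opow)

lemma oact_Hom:
  assumes "A \<in> Obj C" "\<theta> n \<in> Hom C (src A n) A" "x \<in> op_set P n"
  shows "oact A \<theta> n x \<in> Hom C (opow A n \<I>) A"
  unfolding oact_def using set_incl_in[of "opow A n \<I>" x "op_set P n"] assms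
  by (auto intro: Comp_in)

text \<open>Injectivity of the universal bijection; its surjectivity gives
  \<open>structure_exists\<close>. Together they exchange structure maps for families of
  arrows.\<close>

lemma structure_unique:
  assumes "A \<in> Obj C" "\<theta> n \<in> Hom C (src A n) A" "\<theta>' n \<in> Hom C (src A n) A"
    "\<And>x. x \<in> op_set P n \<Longrightarrow> oact A \<theta> n x = oact A \<theta>' n x"
  shows "\<theta> n = \<theta>' n"
proof -
  have "inj_on (\<lambda>h. \<lambda>x\<in>op_set P n. h \<cdot> set_incl T (op_set P n) (opow A n \<I>) x) (Hom C (src A n) A)"
    using set_tens_universal[of "opow A n \<I>" A "op_set P n"] assms(1) by (simp add: bij_betw_def)
  then show ?thesis using assms(2-4) unfolding oact_def
    by (elim inj_onD) (auto intro!: restrict_ext)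
qed

lemma structure_exists:
  assumes "A \<in> Obj C" "\<And>n x. x \<in> op_set P n \<Longrightarrow> a n x \<in> Hom C (opow A n \<I>) A"
  shows "\<exists>\<theta>. (\<forall>n. \<theta> n \<in> Hom C (src A n) A) \<and> (\<forall>n. \<forall>x\<in>op_set P n. oact A \<theta> n x = a n x)"
proof -
  have "\<exists>h. h \<in> Hom C (src A n) A
      \<and> (\<forall>x\<in>op_set P n. h \<cdot> set_incl T (op_set P n) (opow A n \<I>) x = a n x)" for n
  proof -
    have "restrict (a n) (op_set P n)
        \<in> (\<lambda>h. \<lambda>x\<in>op_set P n. h \<cdot> set_incl T (op_set P n) (opow A n \<I>) x) ` Hom C (src A n) A"
      using set_tens_universal[of "opow A n \<I>" A "op_set P n"] assms by (auto simp: bij_betw_def)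
    then obtain h where h: "h \<in> Hom C (src A n) A"
      "restrict (a n) (op_set P n) = (\<lambda>x\<in>op_set P n. h \<cdot> set_incl T (op_set P n) (opow A n \<I>) x)"
      by blast
    have "h \<cdot> set_incl T (op_set P n) (opow A n \<I>) x = a n x" if "x \<in> op_set P n" for x
      using fun_cong[OF h(2), of x] that by simp
    then show ?thesis using h(1) by blast
  qed
  then obtain \<theta> where
    "\<forall>n. \<theta> n \<in> Hom C (src A n) A
        \<and> (\<forall>x\<in>op_set P n. \<theta> n \<cdot> set_incl T (op_set P n) (opow A n \<I>) x = a n x)"
    by metis
  then show ?thesis unfolding oact_def by blast
qed

text \<open>Once the right-hand side is expressed through \<open>blocks\<close>, both sides end in
  the invertible \<open>tens_concat\<close>, which cancels.\<close>

lemma blocks_cancel: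
  assumes "A \<in> Obj C" and f: "f \<in> Hom C (opow A (sum_list ns) \<I>) A"
    and h: "h \<in> Hom C (opow A (length ns) \<I>) A"
    and fs: "length fs = length ns" "\<And>i. i < length ns \<Longrightarrow> fs ! i \<in> Hom C (opow A (ns ! i) \<I>) A"
  shows "f \<cdot> tens_concat C (map (\<lambda>n. replicate n A) ns) = h \<cdot> tens_arr_list C fs \<longleftrightarrow> f
      = h \<cdot> blocks A (zip ns fs)"
proof -
  let ?t = "tens_concat C (map (\<lambda>n. replicate n A) ns)" and ?B = "blocks A (zip ns fs)"
  have *: "map fst (zip ns fs) = ns" "map snd (zip ns fs) = fs" using fs(1) by simp_all
  have "g \<in> Arr C \<and> Dom C g = opow A m \<I> \<and> Cod C g = A" if "(m, g) \<in> set (zip ns fs)" for m g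
    using that fs by (auto simp: in_set_zip mem_Hom)
  then have t: "iso_arr C ?t" "Cod C ?t = opow A (sum_list ns) \<I>" "?B \<in> Arr C"
    "Dom C ?B = opow A (sum_list ns) \<I>"
    "Cod C ?B = opow A (length ns) \<I>" "?B \<cdot> ?t = tens_arr_list C fs"
    using blocks_tens_concat[OF assms(1), of "zip ns fs"] fs(1) unfolding * by simp_all
  have "h \<cdot> tens_arr_list C fs = (h \<cdot> ?B) \<cdot> ?t"
    using t h by (simp add: mem_Hom flip: t(6))
  moreover have "f \<cdot> ?t = (h \<cdot> ?B) \<cdot> ?t \<longleftrightarrow> f = h \<cdot> ?B"
    using cancel_epi[OF t(1), of f "h \<cdot> ?B"] t(2-5) f h
    by (auto simp: mem_Hom simp del: Comp_assoc_right)
  ultimately show ?thesis by simp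
qed

text \<open>The axioms correspond one by one. Associativity alone changes its form, and its two
  forms are equivalent by \<open>blocks_cancel\<close>.\<close>

lemma is_algebra_iff:
  "is_algebra C T P (A, \<theta>) \<longleftrightarrow> (\<forall>n. \<theta> n \<in> Hom C (src A n) A) \<and> twisted_algebra C G \<phi> A (oact A \<theta>)"
proof (cases "A \<in> Obj C \<and> (\<forall>n. \<theta> n \<in> Hom C (src A n) A)")
  case False
  then show ?thesis
    by (auto simp: is_algebra_def tens_pow_opow dest: twisted_algebra.A)
next
  case True
  then have A: "A \<in> Obj C" and \<theta>: "\<theta> n \<in> Hom C (src A n) A" for n by auto
  have h: "oact A \<theta> n x \<in> Hom C (opow A n \<I>) A" if "x \<in> op_set P n" for n x
    by (rule oact_Hom[of A \<theta> n, OF A \<theta> that])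
  have comp_set: "op_comp P ns x ys \<in> op_set P (sum_list ns)"
    if x: "x \<in> op_set P (length ns)" and ys: "list_all2 (\<lambda>n y. y \<in> op_set P n) ns ys" for ns x ys
    using op_comp_closed[OF x ys] .
  have "(\<forall>ns x ys. x \<in> op_set P (length ns) \<longrightarrow> list_all2 (\<lambda>n y. y \<in> op_set P n) ns ys \<longrightarrow>
        oact A \<theta> (sum_list ns) (op_comp P ns x ys) \<cdot> tens_concat C (map (\<lambda>n. replicate n A) ns)
        = oact A \<theta> (length ns) x \<cdot> tens_arr_list C (map2 (oact A \<theta>) ns ys)) \<longleftrightarrow>
      (\<forall>ns x ys. x \<in> op_set P (length ns) \<longrightarrow> list_all2 (\<lambda>n y. y \<in> op_set P n) ns ys \<longrightarrow>
        oact A \<theta> (sum_list ns) (op_comp P ns x ys)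
            = oact A \<theta> (length ns) x \<cdot> blocks A (zip ns (map2 (oact A \<theta>) ns ys)))"
  proof -
    have "oact A \<theta> (sum_list ns) (op_comp P ns x ys) \<cdot> tens_concat C (map (\<lambda>n. replicate n A) ns)
        = oact A \<theta> (length ns) x \<cdot> tens_arr_list C (map2 (oact A \<theta>) ns ys) \<longleftrightarrow>
        oact A \<theta> (sum_list ns) (op_comp P ns x ys)
            = oact A \<theta> (length ns) x \<cdot> blocks A (zip ns (map2 (oact A \<theta>) ns ys))"
      if x: "x \<in> op_set P (length ns)" and ys: "list_all2 (\<lambda>n y. y \<in> op_set P n) ns ys" for ns x ys
      by (rule blocks_cancel[OF A h[OF comp_set[OF x ys]] h[OF x]])
        (use ys h in \<open>auto simp: list_all2_conv_all_nth\<close>)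
    then show ?thesis by blast
  qed
  moreover have "twisted_algebra C G \<phi> A (oact A \<theta>) \<longleftrightarrow>
    oact A \<theta> 1 (op_unit P) = run A \<and>
    (\<forall>ns x ys. x \<in> op_set P (length ns) \<longrightarrow> list_all2 (\<lambda>n y. y \<in> op_set P n) ns ys \<longrightarrow>
        oact A \<theta> (sum_list ns) (op_comp P ns x ys) = oact A \<theta> (length ns) x \<cdot> blocks A
          (zip ns (map2 (oact A \<theta>) ns ys))) \<and>
    (\<forall>n x \<sigma> f. x \<in> op_set P n \<longrightarrow> perm_arr C A n \<sigma> f \<longrightarrow>
        oact A \<theta> n (op_perm P n x \<sigma>) = oact A \<theta> n x \<cdot> f)"
    using A h \<phi> symmetric_monoidal_category_axioms group_axioms
    unfolding twisted_algebra_def twisted_algebra_axioms_def by blast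
  ultimately show ?thesis using A \<theta> by (simp add: is_algebra_def tens_pow_opow)
qed

end

section \<open>Functor categories and semidirect products\<close>

text \<open>The inverse maps are functorial because each required equation may be checked after
  applying the injective \<open>F\<close>.\<close>

lemma isomorphic_categoriesI:
  fixes A :: "('o1, 'm1, 'z1) cat_scheme" and B :: "('o2, 'm2, 'z2) cat_scheme"
  assumes "category A" "category B" and F: "is_functor A B F"
    and bo: "bij_betw (fob F) (Obj A) (Obj B)" and ba: "bij_betw (far F) (Arr A) (Arr B)"
  shows "isomorphic_categories A B"
proof -
  interpret A: category A by (rule assms(1))
  interpret B: category B by (rule assms(2))
  define G where
    "G = \<lparr>fob = restrict (inv_into (Obj A) (fob F)) (Obj B), far
        = restrict (inv_into (Arr A) (far F)) (Arr B)\<rparr>"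
  have Fo: "fob F X \<in> Obj B" if "X \<in> Obj A" for X using bo that by (auto simp: bij_betw_def)
  have Fa: "far F f \<in> Hom B (fob F (Dom A f)) (fob F (Cod A f))" if "f \<in> Arr A" for f
    using F that by (auto simp: is_functor_def)
  have Fa': "far F f \<in> Arr B" "Dom B (far F f) = fob F (Dom A f)"
    "Cod B (far F f) = fob F (Cod A f)" if "f \<in> Arr A" for f
    using Fa[OF that] by (auto simp: B.mem_Hom)
  have GF: "fob G (fob F X) = X" if "X \<in> Obj A" for X
    using bo that Fo by (simp add: G_def bij_betw_inv_into_left)
  have GFa: "far G (far F f) = f" if "f \<in> Arr A" for f
    using ba that Fa' by (simp add: G_def bij_betw_inv_into_left)
  have Go: "fob G Y \<in> Obj A" "fob F (fob G Y) = Y" if "Y \<in> Obj B" for Y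
    using bo that by (auto simp: G_def bij_betw_def inv_into_into f_inv_into_f)
  have Ga: "far G g \<in> Arr A" "far F (far G g) = g" if "g \<in> Arr B" for g
    using ba that by (auto simp: G_def bij_betw_def inv_into_into f_inv_into_f)
  have DC: "Dom A (far G g) = fob G (Dom B g)" "Cod A (far G g) = fob G (Cod B g)" if "g \<in> Arr B"
    for g
  proof -
    have "Dom B g = fob F (Dom A (far G g))" "Cod B g = fob F (Cod A (far G g))"
      using Fa'(2,3)[OF Ga(1)[OF that]] Ga(2)[OF that] by simp_all
    then show "Dom A (far G g) = fob G (Dom B g)" "Cod A (far G g) = fob G (Cod B g)"
      using GF Ga(1)[OF that] by simp_all
  qed
  have "is_functor B A G"
    unfolding is_functor_def
  proof (intro conjI ballI impI)
    show "fob G \<in> Obj B \<rightarrow>\<^sub>E Obj A" using Go(1) by (auto simp: G_def)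
    show "far G \<in> extensional (Arr B)" by (simp add: G_def)
    show "far G f \<in> Hom A (fob G (Dom B f)) (fob G (Cod B f))" if "f \<in> Arr B" for f
      using Ga(1)[OF that] DC[OF that] by (simp add: A.mem_Hom)
    show "far G (Ide B X) = Ide A (fob G X)" if "X \<in> Obj B" for X
    proof -
      have "far F (Ide A (fob G X)) = Ide B X"
        using F Go[OF that] by (auto simp: is_functor_def)
      then show ?thesis using GFa[of "Ide A (fob G X)"] Go(1)[OF that] by simp
    qed
    show "far G (g \<cdot>\<^bsub>B\<^esub> f) = far G g \<cdot>\<^bsub>A\<^esub> far G f" if "f \<in> Arr B" "g \<in> Arr B" "Cod B f = Dom B g"
      for f g
    proof -
      have *: "Cod A (far G f) = Dom A (far G g)" using DC that by simp
      then have "far F (far G g \<cdot>\<^bsub>A\<^esub> far G f) = g \<cdot>\<^bsub>B\<^esub> f"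
        using F Ga that by (auto simp: is_functor_def)
      then show ?thesis using GFa[of "far G g \<cdot>\<^bsub>A\<^esub> far G f"] Ga(1) that * by simp
    qed
  qed
  then show ?thesis
    unfolding isomorphic_categories_def using assms(1-3) GF GFa Go(2) Ga(2) by blast
qed

lemma is_functorD:
  assumes "is_functor A B F"
  shows "X \<in> Obj A \<Longrightarrow> fob F X \<in> Obj B" "f \<in> Arr A \<Longrightarrow> far F f \<in> Arr B"
    "f \<in> Arr A \<Longrightarrow> Dom B (far F f) = fob F (Dom A f)" "f \<in> Arr A \<Longrightarrow> Cod B (far F f) = fob F (Cod A f)"
    "X \<in> Obj A \<Longrightarrow> far F (Ide A X) = Ide B (fob F X)"
    "f \<in> Arr A \<Longrightarrow> g \<in> Arr A \<Longrightarrow> Cod A f = Dom A g \<Longrightarrow> far F (g \<cdot>\<^bsub>A\<^esub> f) = far F g \<cdot>\<^bsub>B\<^esub> far F f"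
  using assms by (auto simp: is_functor_def Hom_def)

lemma C2_simps [simp]: "carrier C2 = {1, -1}" "\<one>\<^bsub>C2\<^esub> = 1" "x \<otimes>\<^bsub>C2\<^esub> y = x * y"
  by (simp_all add: C2_def)

lemma group_C2: "group C2"
proof (rule groupI)
  show "\<exists>y\<in>carrier C2. y \<otimes>\<^bsub>C2\<^esub> x = \<one>\<^bsub>C2\<^esub>" if "x \<in> carrier C2" for x
    using that by (intro bexI[of _ x]) auto
qed auto

lemma inv_C2 [simp]: "x = 1 \<or> x = -1 \<Longrightarrow> inv\<^bsub>C2\<^esub> x = x"
  using group.inv_equality[OF group_C2, of x x] by auto

lemma category_deloop: "group G \<Longrightarrow> category (deloop G)"
  by (rule category.intro) (auto simp: deloop_def Hom_def group.is_monoid monoid.m_assoc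
      intro: monoid.one_closed monoid.m_closed)

lemma category_functor_category_over:
  fixes A :: "('o1, 'm1, 'z1) cat_scheme" and B :: "('o2, 'm2, 'z2) cat_scheme"
    and E :: "('o3, 'm3, 'z3) cat_scheme"
  assumes A: "category A" and B: "category B" and E: "category E" and q: "is_functor B E q"
  shows "category (functor_category_over A B E p q)"
proof -
  interpret A: category A by (rule A)
  interpret B: category B by (rule B)
  interpret E: category E by (rule E)
  note q' = is_functorD[OF q]
  let ?N = "nat_trans_over A B E p q"
  have ob: "fob F X \<in> Obj B" "fob q (fob F X) = fob p X" "fob p X \<in> Obj E"
    if "F \<in> functors_over A B E p q" "X \<in> Obj A" for F X
  proof -
    show "fob F X \<in> Obj B" "fob q (fob F X) = fob p X"
      using that is_functorD(1) by (auto simp: functors_over_def)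
    then show "fob p X \<in> Obj E" using q'(1) by metis
  qed
  have fu: "is_functor A B F" if "F \<in> functors_over A B E p q" for F using that
    by (simp add: functors_over_def)
  have nt: "\<tau> X \<in> Arr B" "Dom B (\<tau> X) = fob F X" "Cod B (\<tau> X) = fob F' X"
    "far q (\<tau> X) = Ide E (fob p X)"
    if "\<tau> \<in> ?N F F'" "X \<in> Obj A" for \<tau> F F' X
    using that by (auto simp: nat_trans_over_def B.mem_Hom)
  have nat: "\<tau> (Cod A f) \<cdot>\<^bsub>B\<^esub> far F f = far F' f \<cdot>\<^bsub>B\<^esub> \<tau> (Dom A f)" if "\<tau> \<in> ?N F F'" "f \<in> Arr A" for
    \<tau> F F' f
    using that by (auto simp: nat_trans_over_def)
  have ext: "\<tau> \<in> extensional (Obj A)" if "\<tau> \<in> ?N F F'" for \<tau> F F' using that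
    by (simp add: nat_trans_over_def)
  have ide: "(\<lambda>X\<in>Obj A. Ide B (fob F X)) \<in> ?N F F" if F: "F \<in> functors_over A B E p q" for F
    using ob[OF F] q'(5) is_functorD[OF fu[OF F]] by (auto simp: nat_trans_over_def B.mem_Hom)
  have comp: "(\<lambda>X\<in>Obj A. \<sigma> X \<cdot>\<^bsub>B\<^esub> \<tau> X) \<in> ?N F H"
    if \<tau>: "\<tau> \<in> ?N F F'" and \<sigma>: "\<sigma> \<in> ?N F' H" and FH: "F \<in> functors_over A B E p q"
      "F' \<in> functors_over A B E p q" "H \<in> functors_over A B E p q"
    for \<sigma> \<tau> F F' H
  proof -
    note F = is_functorD[OF fu[OF FH(1)]] and F' = is_functorD[OF fu[OF FH(2)]] and H =
      is_functorD[OF fu[OF FH(3)]]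
    \<comment> \<open>Components over identities compose to components over identities, since
      \<open>q\<close> preserves composition.\<close>
    have "far q (\<sigma> X \<cdot>\<^bsub>B\<^esub> \<tau> X) = Ide E (fob p X)" if "X \<in> Obj A" for X
      using nt[OF \<tau> that] nt[OF \<sigma> that] ob(3)[OF FH(1) that] by (subst q'(6)) simp_all
    moreover have
      "(\<sigma> (Cod A f) \<cdot>\<^bsub>B\<^esub> \<tau> (Cod A f)) \<cdot>\<^bsub>B\<^esub> far F f = far H f \<cdot>\<^bsub>B\<^esub> (\<sigma> (Dom A f) \<cdot>\<^bsub>B\<^esub> \<tau> (Dom A f))" if
      f: "f \<in> Arr A" for f
    proof -
      have X: "Dom A f \<in> Obj A" "Cod A f \<in> Obj A" using f by simp_all
      note n = nt[OF \<tau> X(1)] nt[OF \<tau> X(2)] nt[OF \<sigma> X(1)] nt[OF \<sigma> X(2)]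
      have "(\<sigma> (Cod A f) \<cdot>\<^bsub>B\<^esub> \<tau> (Cod A f)) \<cdot>\<^bsub>B\<^esub> far F f
          = \<sigma> (Cod A f) \<cdot>\<^bsub>B\<^esub> (far F' f \<cdot>\<^bsub>B\<^esub> \<tau> (Dom A f))"
        using n F(2-4)[OF f] by (simp flip: nat[OF \<tau> f])
      also have "\<dots> = (\<sigma> (Cod A f) \<cdot>\<^bsub>B\<^esub> far F' f) \<cdot>\<^bsub>B\<^esub> \<tau> (Dom A f)"
        using n F'(2-4)[OF f] by simp
      also have "\<dots> = far H f \<cdot>\<^bsub>B\<^esub> (\<sigma> (Dom A f) \<cdot>\<^bsub>B\<^esub> \<tau> (Dom A f))"
        unfolding nat[OF \<sigma> f] using n H(2-4)[OF f] by simp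
      finally show ?thesis .
    qed
    ultimately show ?thesis
      using nt[OF \<tau>] nt[OF \<sigma>] by (auto simp: nat_trans_over_def B.mem_Hom)
  qed
  show ?thesis
  proof (rule category.intro)
    fix \<Phi> \<Psi> \<Theta> \<Omega> and f g h
    let ?C = "functor_category_over A B E p q"
    note [simp] = functor_category_over_def Hom_def
    show "f \<in> Arr ?C \<Longrightarrow> Dom ?C f \<in> Obj ?C" "f \<in> Arr ?C \<Longrightarrow> Cod ?C f \<in> Obj ?C"
      by auto
    show "\<Phi> \<in> Obj ?C \<Longrightarrow> Ide ?C \<Phi> \<in> Hom ?C \<Phi> \<Phi>"
      using ide by auto
    show "f \<in> Hom ?C \<Phi> \<Psi> \<Longrightarrow> g \<in> Hom ?C \<Psi> \<Theta> \<Longrightarrow> g \<cdot>\<^bsub>?C\<^esub> f \<in> Hom ?C \<Phi> \<Theta>"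
      using comp by auto
    show "f \<in> Hom ?C \<Phi> \<Psi> \<Longrightarrow> Ide ?C \<Psi> \<cdot>\<^bsub>?C\<^esub> f = f"
      using nt(1,3) by (auto intro!: extensionalityI[OF restrict_extensional ext])
    show "f \<in> Hom ?C \<Phi> \<Psi> \<Longrightarrow> f \<cdot>\<^bsub>?C\<^esub> Ide ?C \<Phi> = f"
      using nt(1,2) by (auto intro!: extensionalityI[OF restrict_extensional ext])
    show "f \<in> Hom ?C \<Phi> \<Psi> \<Longrightarrow> g \<in> Hom ?C \<Psi> \<Theta> \<Longrightarrow> h \<in> Hom ?C \<Theta> \<Omega> \<Longrightarrow> (h \<cdot>\<^bsub>?C\<^esub> g) \<cdot>\<^bsub>?C\<^esub> f
        = h \<cdot>\<^bsub>?C\<^esub> (g \<cdot>\<^bsub>?C\<^esub> f)"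
      using nt(1-3) by (auto intro!: restrict_ext)
  qed
qed

text \<open>A strict action: the nontrivial element acts by a functor that is an involution on
  objects and on arrows, as the passage to opposite monoids is.\<close>

locale C2_action = category D for D :: "('o, 'm, 'z) cat_scheme" (structure) +
  fixes act :: "int \<Rightarrow> ('o, 'm, 'o, 'm) func"
  assumes act_functor: "c = 1 \<or> c = -1 \<Longrightarrow> is_functor D D (act c)"
    and act_one: "X \<in> Obj D \<Longrightarrow> fob (act 1) X = X" "f \<in> Arr D \<Longrightarrow> far (act 1) f = f"
    and act_invol: "X \<in> Obj D \<Longrightarrow> fob (act (-1)) (fob (act (-1)) X) = X"
      "f \<in> Arr D \<Longrightarrow> far (act (-1)) (far (act (-1)) f) = f"
begin

lemma act_mult:
  assumes "b = 1 \<or> b = -1" "c = 1 \<or> c = -1"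
  shows "X \<in> Obj D \<Longrightarrow> fob (act b) (fob (act c) X) = fob (act (b * c)) X"
    "f \<in> Arr D \<Longrightarrow> far (act b) (far (act c) f) = far (act (b * c)) f"
  using assms act_one act_invol is_functorD(1,2)[OF act_functor] by auto

text \<open>The domain is defined through the inverse of \<open>c\<close>; every element of
  \<open>C2\<close> is its own inverse, which turns this into a condition on the domain of
  \<open>f\<close>.\<close>

lemma mem_Hom_semidirect:
  "(f, c) \<in> Hom (semidirect_C2 D act) X Y \<longleftrightarrow>
    f \<in> Arr D \<and> (c = 1 \<or> c = -1) \<and> X \<in> Obj D \<and> Dom D f = fob (act c) X \<and> Cod D f = Y"
proof (cases "f \<in> Arr D \<and> (c = 1 \<or> c = -1)")
  case True
  then have "fob (act c) (fob (act c) (Dom D f)) = Dom D f"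
    using act_mult(1)[of c c "Dom D f"] act_one by auto
  moreover have "X \<in> Obj D \<Longrightarrow> fob (act c) (fob (act c) X) = X"
    using True act_mult(1)[of c c X] act_one by auto
  moreover have "fob (act c) (Dom D f) \<in> Obj D" using True is_functorD(1)[OF act_functor] by simp
  ultimately show ?thesis using True by (auto simp: semidirect_C2_def Hom_def)
next
  case False
  then show ?thesis by (auto simp: semidirect_C2_def Hom_def)
qed

lemma category_semidirect_C2: "category (semidirect_C2 D act)"
proof -
  let ?S = "semidirect_C2 D act"
  note F = is_functorD[OF act_functor]
  note H = mem_Hom_semidirect
  have cc: "(b = 1 \<or> b = -1) \<Longrightarrow> (c = 1 \<or> c = -1) \<Longrightarrow> b * c = 1 \<or> b * c = (-1::int)" for b c by auto
  show ?thesis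
  proof (rule category.intro)
    fix X Y Z W :: 'o and f g h :: "'m \<times> int"
    obtain f' a g' b h' c where [simp]: "f = (f', a)" "g = (g', b)" "h = (h', c)"
      by (cases f, cases g, cases h) auto
    have I: "Ide ?S X = (Ide D X, 1)" "Obj ?S = Obj D" for X by (simp_all add: semidirect_C2_def)
    have c: "(g1, b1) \<cdot>\<^bsub>?S\<^esub> (f1, a1) = (g1 \<cdot> far (act b1) f1, b1 * a1)" for g1 b1 f1 a1
      by (simp add: semidirect_C2_def)
    show "f \<in> Arr ?S \<Longrightarrow> Dom ?S f \<in> Obj ?S" "f \<in> Arr ?S \<Longrightarrow> Cod ?S f \<in> Obj ?S"
      using F(1) by (auto simp: semidirect_C2_def)
    show "X \<in> Obj ?S \<Longrightarrow> Ide ?S X \<in> Hom ?S X X"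
      using act_one by (simp add: I H)
    show "f \<in> Hom ?S X Y \<Longrightarrow> g \<in> Hom ?S Y Z \<Longrightarrow> g \<cdot>\<^bsub>?S\<^esub> f \<in> Hom ?S X Z"
      using F cc act_mult by (simp add: c H)
    show "f \<in> Hom ?S X Y \<Longrightarrow> Ide ?S Y \<cdot>\<^bsub>?S\<^esub> f = f"
      using act_one by (auto simp add: c H I)
    show "f \<in> Hom ?S X Y \<Longrightarrow> f \<cdot>\<^bsub>?S\<^esub> Ide ?S X = f"
      using F by (simp add: c H I)
    show "f \<in> Hom ?S X Y \<Longrightarrow> g \<in> Hom ?S Y Z \<Longrightarrow> h \<in> Hom ?S Z W \<Longrightarrow> (h \<cdot>\<^bsub>?S\<^esub> g) \<cdot>\<^bsub>?S\<^esub> f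
        = h \<cdot>\<^bsub>?S\<^esub> (g \<cdot>\<^bsub>?S\<^esub> f)"
      using F cc act_mult by (simp add: c H)
  qed
qed

lemma is_functor_semidirect_proj: "is_functor (semidirect_C2 D act) (deloop C2) (semidirect_proj D act)"
proof -
  interpret S: category "semidirect_C2 D act" by (rule category_semidirect_C2)
  show ?thesis unfolding is_functor_def
  proof (intro conjI ballI impI)
    fix f g assume *: "f \<in> Arr (semidirect_C2 D act)" "g \<in> Arr (semidirect_C2 D act)"
      "Cod (semidirect_C2 D act) f = Dom (semidirect_C2 D act) g"
    then have "g \<cdot>\<^bsub>semidirect_C2 D act\<^esub> f \<in> Arr (semidirect_C2 D act)" by simp
    then show "far (semidirect_proj D act) (g \<cdot>\<^bsub>semidirect_C2 D act\<^esub> f)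
        = far (semidirect_proj D act) g \<cdot>\<^bsub>deloop C2\<^esub> far (semidirect_proj D act) f"
      using * by (auto simp: semidirect_proj_def deloop_def) (auto simp: semidirect_C2_def)
  next
    fix X assume "X \<in> Obj (semidirect_C2 D act)"
    then have "Ide (semidirect_C2 D act) X \<in> Arr (semidirect_C2 D act)" by simp
    then show "far (semidirect_proj D act) (Ide (semidirect_C2 D act) X)
        = Ide (deloop C2) (fob (semidirect_proj D act) X)"
      by (simp add: semidirect_proj_def deloop_def) (simp add: semidirect_C2_def)
  qed (auto simp: semidirect_proj_def deloop_def Hom_def semidirect_C2_def)
qed

end

section \<open>The isomorphism of categories\<close>

context symmetric_monoidal_category
begin

definition tw_monoid :: "int \<Rightarrow> 'o \<times> 'm \<times> 'm \<Rightarrow> 'o \<times> 'm \<times> 'm" where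
  "tw_monoid c M = (if c = 1 then M else op_monoid C M)"

lemma op_monoid_op_monoid: "is_monoid C M \<Longrightarrow> op_monoid C (op_monoid C M) = M"
  by (cases M) (auto simp: is_monoid_def op_monoid_def mem_Hom)

lemma is_monoid_op_monoid:
  assumes "is_monoid C M"
  shows "is_monoid C (op_monoid C M)"
proof -
  obtain A \<mu> \<eta> where M: "M = (A, \<mu>, \<eta>)" by (cases M) auto
  interpret internal_monoid C A \<mu> \<eta> by unfold_locales (use assms M in simp)
  let ?s = "sym A A" and ?a = "\<alpha> A A A"
  have unit_left: "(\<mu> \<cdot> ?s) \<cdot> (\<eta> \<star> ide A) = lun A"
  proof -
    have "(\<mu> \<cdot> ?s) \<cdot> (\<eta> \<star> ide A) = (\<mu> \<cdot> (ide A \<star> \<eta>)) \<cdot> sym \<I> A"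
      using symmetry_natural[of \<eta> "ide A"] by simp
    also have "\<dots> = lun A"
      unfolding mult_unit_right lunitor_symmetry[symmetric, OF monoid_simps(1)] by simp
    finally show ?thesis .
  qed
  have unit_right: "(\<mu> \<cdot> ?s) \<cdot> (ide A \<star> \<eta>) = run A"
  proof -
    have "(\<mu> \<cdot> ?s) \<cdot> (ide A \<star> \<eta>) = (\<mu> \<cdot> (\<eta> \<star> ide A)) \<cdot> sym A \<I>"
      using symmetry_natural[of "ide A" \<eta>] by simp
    then show ?thesis unfolding mult_unit_left by (simp add: lunitor_symmetry)
  qed
  \<comment> \<open>Both sides reverse three factors. The equation follows from the hexagon solved
    for \<open>sym A (A \<odot> A)\<close>, used twice, after which the adjacent symmetries
    cancel.\<close>
  have hex: "sym (A \<odot> A) A \<cdot> (?s \<star> ide A) = ?a \<cdot> (sym A (A \<odot> A) \<cdot> ((ide A \<star> ?s) \<cdot> ?a))"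
  proof (rule cancel_mono)
    show "iso_arr C (sym A (A \<odot> A))" by simp
    have s1: "sym A (A \<odot> A) \<cdot> ?a = \<alpha>' A A A \<cdot> ((ide A \<star> ?s) \<cdot> (?a \<cdot> (?s \<star> ide A)))"
      by (simp flip: hexagon')
    have ss: "(?s \<star> ide A) \<cdot> (?s \<star> ide A) = ide ((A \<odot> A) \<odot> A)"
      "(ide A \<star> ?s) \<cdot> (ide A \<star> ?s) = ide (A \<odot> (A \<odot> A))"
      by (simp_all flip: whisker_Comp)
    have "sym A (A \<odot> A) \<cdot> (?a \<cdot> (sym A (A \<odot> A) \<cdot> ((ide A \<star> ?s) \<cdot> ?a)))
        = (sym A (A \<odot> A) \<cdot> ?a) \<cdot> ((?s \<star> ide A) \<cdot> (sym A (A \<odot> A) \<cdot> ?a))"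
      using Comp2_ext[OF symmetry_natural[of "ide A" ?s]] by simp
    also have "\<dots> = ?s \<star> ide A"
      unfolding s1 using Comp2_ext[OF ss(1)] Comp2_ext[OF ss(2)] by simp
    finally show
      "sym A (A \<odot> A) \<cdot> (sym (A \<odot> A) A \<cdot> (?s \<star> ide A))
          = sym A (A \<odot> A) \<cdot> (?a \<cdot> (sym A (A \<odot> A) \<cdot> ((ide A \<star> ?s) \<cdot> ?a)))"
      by (simp add: Comp2_ext[OF symmetry_simps(4)])
  qed simp_all
  have "(\<mu> \<cdot> ?s) \<cdot> ((\<mu> \<cdot> ?s) \<star> ide A) = \<mu> \<cdot> ((ide A \<star> \<mu>) \<cdot> (sym (A \<odot> A) A \<cdot> (?s \<star> ide A)))"
    using Comp2_ext[OF symmetry_natural[of \<mu> "ide A"]] by simp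
  also have "\<dots> = (\<mu> \<cdot> ((ide A \<star> \<mu>) \<cdot> ?a)) \<cdot> (sym A (A \<odot> A) \<cdot> ((ide A \<star> ?s) \<cdot> ?a))"
    unfolding hex by simp
  also have "\<dots> = \<mu> \<cdot> ((\<mu> \<star> ide A) \<cdot> (sym A (A \<odot> A) \<cdot> ((ide A \<star> ?s) \<cdot> ?a)))"
    unfolding mult_assoc[symmetric] by simp
  also have "\<dots> = (\<mu> \<cdot> ?s) \<cdot> ((ide A \<star> (\<mu> \<cdot> ?s)) \<cdot> ?a)"
    using Comp2_ext[OF symmetry_natural[of "ide A" \<mu>]] by simp
  finally show ?thesis
    using unit_left unit_right unfolding M by (simp add: op_monoid_def is_monoid_def mem_Hom)
qed

lemma is_monoid_hom_op_monoid:
  assumes "is_monoid C M" "is_monoid C N" "is_monoid_hom C M N f"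
  shows "is_monoid_hom C (op_monoid C M) (op_monoid C N) f"
proof -
  obtain A \<mu> \<eta> B \<mu>' \<eta>' where M: "M = (A, \<mu>, \<eta>)" "N = (B, \<mu>', \<eta>')" by (cases M, cases N) auto
  have A: "\<mu> \<in> Arr C" "Dom C \<mu> = A \<odot> A" "Cod C \<mu> = A" "A \<in> Obj C"
    and B: "\<mu>' \<in> Arr C" "Dom C \<mu>' = B \<odot> B" "Cod C \<mu>' = B" "B \<in> Obj C"
    and f: "f \<in> Arr C" "Dom C f = A" "Cod C f = B" "f \<cdot> \<mu> = \<mu>' \<cdot> (f \<star> f)" "f \<cdot> \<eta> = \<eta>'"
    using assms by (auto simp: M is_monoid_def is_monoid_hom_def mem_Hom)
  have "f \<cdot> (\<mu> \<cdot> sym A A) = (\<mu>' \<cdot> sym B B) \<cdot> (f \<star> f)"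
    using A B f(1-3) symmetry_natural[of f f] Comp2_ext[OF f(4), of "sym A A"] by simp
  then show ?thesis using f by (simp add: M op_monoid_def is_monoid_hom_def mem_Hom)
qed

lemma tw_monoid_simps:
  "is_monoid C M \<Longrightarrow> is_monoid C (tw_monoid c M)"
  "is_monoid C M \<Longrightarrow> tw_monoid c (tw_monoid c M) = M"
  "is_monoid C M \<Longrightarrow> is_monoid C N \<Longrightarrow> is_monoid_hom C M N f
      \<Longrightarrow> is_monoid_hom C (tw_monoid c M) (tw_monoid c N) f"
  "fst (tw_monoid c M) = fst M"
  by (auto simp: tw_monoid_def is_monoid_op_monoid op_monoid_op_monoid is_monoid_hom_op_monoid)
    (cases M, simp add: op_monoid_def)

lemma is_monoid_hom_Ide: "is_monoid C M \<Longrightarrow> is_monoid_hom C M M (ide (fst M))"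
  by (cases M) (auto simp: is_monoid_def is_monoid_hom_def mem_Hom)

lemma is_monoid_hom_Comp:
  assumes "is_monoid C L" "is_monoid C M" "is_monoid C N" "is_monoid_hom C L M f"
    "is_monoid_hom C M N g"
  shows "is_monoid_hom C L N (g \<cdot> f)"
proof -
  obtain A1 \<mu>1 \<eta>1 A2 \<mu>2 \<eta>2 A3 \<mu>3 \<eta>3 where M: "L = (A1, \<mu>1, \<eta>1)" "M = (A2, \<mu>2, \<eta>2)"
    "N = (A3, \<mu>3, \<eta>3)"
    by (cases L, cases M, cases N) auto
  have t: "\<mu>1 \<in> Arr C" "Dom C \<mu>1 = A1 \<odot> A1" "Cod C \<mu>1 = A1" "\<eta>1 \<in> Arr C" "Cod C \<eta>1 = A1"
    "\<mu>2 \<in> Arr C" "Dom C \<mu>2 = A2 \<odot> A2" "Cod C \<mu>2 = A2"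
    "\<mu>3 \<in> Arr C" "Dom C \<mu>3 = A3 \<odot> A3" "Cod C \<mu>3 = A3"
    and f: "f \<in> Arr C" "Dom C f = A1" "Cod C f = A2" "f \<cdot> \<mu>1 = \<mu>2 \<cdot> (f \<star> f)" "f \<cdot> \<eta>1 = \<eta>2"
    and g: "g \<in> Arr C" "Dom C g = A2" "Cod C g = A3" "g \<cdot> \<mu>2 = \<mu>3 \<cdot> (g \<star> g)" "g \<cdot> \<eta>2 = \<eta>3"
    using assms by (auto simp: M is_monoid_def is_monoid_hom_def mem_Hom)
  have "(g \<cdot> f) \<cdot> \<mu>1 = (g \<cdot> \<mu>2) \<cdot> (f \<star> f)" using t f g(1-3) by simp
  also have "\<dots> = \<mu>3 \<cdot> ((g \<cdot> f) \<star> (g \<cdot> f))" unfolding g(4) using t f g(1-3)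
    by (simp add: interchange)
  finally show ?thesis using t f g by (simp add: M is_monoid_hom_def mem_Hom)
qed

lemma is_monoid_hom_Hom: "is_monoid_hom C M N f \<Longrightarrow> f \<in> Arr C \<and> Dom C f = fst M \<and> Cod C f = fst N"
  by (cases M, cases N) (simp add: is_monoid_hom_def mem_Hom)

lemma category_Mon: "category (Mon C)"
proof (rule category.intro)
  fix L M N K :: "'o \<times> 'm \<times> 'm" and f g h :: "('o \<times> 'm \<times> 'm) \<times> ('o \<times> 'm \<times> 'm) \<times> 'm"
  note [simp] = Mon_def Hom_def
  show "f \<in> Arr (Mon C) \<Longrightarrow> Dom (Mon C) f \<in> Obj (Mon C)"
    "f \<in> Arr (Mon C) \<Longrightarrow> Cod (Mon C) f \<in> Obj (Mon C)"
    by auto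
  show "M \<in> Obj (Mon C) \<Longrightarrow> Ide (Mon C) M \<in> Hom (Mon C) M M"
    by (simp add: is_monoid_hom_Ide)
  show "f \<in> Hom (Mon C) L M \<Longrightarrow> g \<in> Hom (Mon C) M N \<Longrightarrow> g \<cdot>\<^bsub>Mon C\<^esub> f \<in> Hom (Mon C) L N"
    using is_monoid_hom_Comp by auto
  show "f \<in> Hom (Mon C) L M \<Longrightarrow> Ide (Mon C) M \<cdot>\<^bsub>Mon C\<^esub> f = f"
    "f \<in> Hom (Mon C) L M \<Longrightarrow> f \<cdot>\<^bsub>Mon C\<^esub> Ide (Mon C) L = f"
    using is_monoid_hom_Hom by auto
  show "f \<in> Hom (Mon C) L M \<Longrightarrow> g \<in> Hom (Mon C) M N \<Longrightarrow> h \<in> Hom (Mon C) N K \<Longrightarrow>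
      (h \<cdot>\<^bsub>Mon C\<^esub> g) \<cdot>\<^bsub>Mon C\<^esub> f = h \<cdot>\<^bsub>Mon C\<^esub> (g \<cdot>\<^bsub>Mon C\<^esub> f)"
    using is_monoid_hom_Hom by auto
qed

lemma Mon_simps:
  "M \<in> Obj (Mon C) \<longleftrightarrow> is_monoid C M"
  "(M, N, f) \<in> Arr (Mon C) \<longleftrightarrow> is_monoid C M \<and> is_monoid C N \<and> is_monoid_hom C M N f"
  "Dom (Mon C) (M, N, f) = M" "Cod (Mon C) (M, N, f) = N" "Ide (Mon C) M = (M, M, ide (fst M))"
  "(M2, N2, g) \<cdot>\<^bsub>Mon C\<^esub> (M1, N1, f) = (M1, N2, g \<cdot> f)"
  by (simp_all add: Mon_def)

lemma Mon_C2_action_simps: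
  "is_monoid C M \<Longrightarrow> fob (Mon_C2_action C c) M = tw_monoid c M"
  "(M, N, f) \<in> Arr (Mon C) \<Longrightarrow> far (Mon_C2_action C c) (M, N, f) = (tw_monoid c M, tw_monoid c N, f)"
  by (simp_all add: Mon_C2_action_def tw_monoid_def Mon_simps)

lemma C2_action_Mon: "C2_action (Mon C) (Mon_C2_action C)"
proof -
  interpret M: category "Mon C" by (rule category_Mon)
  have arr: "(M, N, f) \<in> Arr (Mon C) \<Longrightarrow> (tw_monoid c M, tw_monoid c N, f) \<in> Arr (Mon C)" for M N f c
    by (simp add: Mon_simps tw_monoid_simps)
  show ?thesis
  proof unfold_locales
    fix c :: int
    show "is_functor (Mon C) (Mon C) (Mon_C2_action C c)"
      unfolding is_functor_def
    proof (intro conjI ballI impI)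
      show "fob (Mon_C2_action C c) \<in> Obj (Mon C) \<rightarrow>\<^sub>E Obj (Mon C)"
        by (auto simp: Mon_C2_action_def Mon_simps is_monoid_op_monoid)
      show "far (Mon_C2_action C c) \<in> extensional (Arr (Mon C))"
        by (simp add: Mon_C2_action_def)
      show "far (Mon_C2_action C c) f
          \<in> Hom (Mon C) (fob (Mon_C2_action C c) (Dom (Mon C) f)) (fob (Mon_C2_action C c) (Cod (Mon C) f))"
        if "f \<in> Arr (Mon C)" for f
        using that by (cases f) (auto simp: Mon_C2_action_simps M.mem_Hom Mon_simps tw_monoid_simps)
      show "far (Mon_C2_action C c) (Ide (Mon C) M) = Ide (Mon C) (fob (Mon_C2_action C c) M)" if
        "M \<in> Obj (Mon C)" for M
        using that by (auto simp: Mon_C2_action_simps Mon_simps tw_monoid_simps is_monoid_hom_Ide)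
      show "far (Mon_C2_action C c) (g \<cdot>\<^bsub>Mon C\<^esub> f)
          = far (Mon_C2_action C c) g \<cdot>\<^bsub>Mon C\<^esub> far (Mon_C2_action C c) f"
        if "f \<in> Arr (Mon C)" "g \<in> Arr (Mon C)" "Cod (Mon C) f = Dom (Mon C) g" for f g
        using that by (cases f, cases g)
          (auto simp: Mon_C2_action_simps Mon_simps is_monoid_hom_Comp)
    qed
  next
    fix M assume "M \<in> Obj (Mon C)"
    then show "fob (Mon_C2_action C 1) M = M"
      "fob (Mon_C2_action C (-1)) (fob (Mon_C2_action C (-1)) M) = M"
      by (simp_all add: Mon_simps Mon_C2_action_simps tw_monoid_simps) (simp add: tw_monoid_def)
  next
    fix f assume "f \<in> Arr (Mon C)"
    then show "far (Mon_C2_action C 1) f = f"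
      "far (Mon_C2_action C (-1)) (far (Mon_C2_action C (-1)) f) = f"
      using arr by
        (cases f; simp add: Mon_C2_action_simps tw_monoid_simps Mon_simps; simp add: tw_monoid_def)+
  qed
qed

abbreviation "MonS \<equiv> semidirect_C2 (Mon C) (Mon_C2_action C)"

lemma mem_Hom_MonS:
  "((N1, N2, f), c) \<in> Hom MonS M N \<longleftrightarrow> (c = 1 \<or> c = -1) \<and> is_monoid C M \<and> is_monoid C N \<and>
    N1 = tw_monoid c M \<and> N2 = N \<and> is_monoid_hom C (tw_monoid c M) N f"
  unfolding C2_action.mem_Hom_semidirect[OF C2_action_Mon]
  by (auto simp: Mon_simps Mon_C2_action_simps tw_monoid_simps)

lemma Comp_MonS:
  "(M, N, f) \<in> Arr (Mon C) \<Longrightarrow> ((M', N', g), c) \<cdot>\<^bsub>MonS\<^esub> ((M, N, f), d)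
      = ((tw_monoid c M, N', g \<cdot> f), c * d)"
  by (simp add: semidirect_C2_def Mon_C2_action_simps Mon_simps)

lemma Ide_MonS: "Ide MonS M = ((M, M, ide (fst M)), 1)"
  by (simp add: semidirect_C2_def Mon_simps)

lemma tens_arr_list_replicate:
  assumes "f \<in> Arr C" "Dom C f = A" "Cod C f = B"
  shows "tens_arr_list C (replicate n f) \<in> Arr C"
    "Dom C (tens_arr_list C (replicate n f)) = opow A n \<I>"
    "Cod C (tens_arr_list C (replicate n f)) = opow B n \<I>"
  using assms tens_arr_list_simps[of "[0..<n]" "\<lambda>_. f" A B] by (simp_all add: map_replicate_const)

lemma tens_arr_list_replicate_Comp:
  assumes "f \<in> Arr C" "g \<in> Arr C" "Dom C g = Cod C f"
  shows "tens_arr_list C (replicate n (g \<cdot> f))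
      = tens_arr_list C (replicate n g) \<cdot> tens_arr_list C (replicate n f)"
  using assms tens_arr_list_Comp[of "[0..<n]" "\<lambda>_. f" "\<lambda>_. g"] by (simp add: map_replicate_const)

lemma tens_arr_list_replicate_Ide:
  "A \<in> Obj C \<Longrightarrow> tens_arr_list C (replicate n (ide A)) = ide (opow A n \<I>)"
  by (induction n) simp_all

text \<open>Composition with the involution \<open>sym A A\<close> and its naturality exchange the
  two conditions. The left one says that \<open>t\<close> respects multiplication out of the
  opposite monoid, as in the functor description; the right one is the form used in
  \<open>twisted_monoid\<close>.\<close>

lemma antihom_iff:
  assumes "t \<in> Hom C A A" "\<mu> \<in> Hom C (A \<odot> A) A" "A \<in> Obj C"
  shows "t \<cdot> (\<mu> \<cdot> sym A A) = \<mu> \<cdot> (t \<star> t) \<longleftrightarrow> t \<cdot> \<mu> = (\<mu> \<cdot> sym A A) \<cdot> (t \<star> t)"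
proof -
  have t: "t \<in> Arr C" "Dom C t = A" "Cod C t = A" "\<mu> \<in> Arr C" "Dom C \<mu> = A \<odot> A" "Cod C \<mu> = A"
    using assms by (auto simp: mem_Hom)
  have n: "sym A A \<cdot> (t \<star> t) = (t \<star> t) \<cdot> sym A A" using symmetry_natural[of t t] t by simp
  have "(\<mu> \<cdot> sym A A) \<cdot> (t \<star> t) = (\<mu> \<cdot> (t \<star> t)) \<cdot> sym A A"
    using t assms(3) n by simp
  moreover have "t \<cdot> \<mu> = (t \<cdot> (\<mu> \<cdot> sym A A)) \<cdot> sym A A" using t assms(3) by simp
  moreover have
    "(t \<cdot> (\<mu> \<cdot> sym A A)) \<cdot> sym A A = (\<mu> \<cdot> (t \<star> t)) \<cdot> sym A A \<longleftrightarrow> t \<cdot> (\<mu> \<cdot> sym A A) = \<mu> \<cdot> (t \<star> t)"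
    using cancel_epi[of "sym A A" "t \<cdot> (\<mu> \<cdot> sym A A)" "\<mu> \<cdot> (t \<star> t)"] t assms(3)
    by (auto simp del: Comp_assoc_right)
  ultimately show ?thesis by metis
qed

lemma tw_monoid_mult:
  "is_monoid C M \<Longrightarrow> b = 1 \<or> b = -1 \<Longrightarrow> c = 1 \<or> c = -1 \<Longrightarrow> tw_monoid b (tw_monoid c M)
      = tw_monoid (b * c) M"
  by (auto simp: tw_monoid_def op_monoid_op_monoid)

end

section \<open>Twisted monoids as functors over the delooping of \<open>C2\<close>\<close>

context tensored_smc
begin

lemma \<phi>_simps:
  "g \<in> carrier G \<Longrightarrow> \<phi> g = 1 \<or> \<phi> g = -1" "g \<in> carrier G \<Longrightarrow> h \<in> carrier G \<Longrightarrow> \<phi> (g \<otimes>\<^bsub>G\<^esub> h) = \<phi> g * \<phi> h"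
  "\<phi> \<one>\<^bsub>G\<^esub> = 1"
proof -
  show *: "\<phi> g = 1 \<or> \<phi> g = -1" if "g \<in> carrier G" for g using hom_in_carrier[OF \<phi> that] by simp
  show **: "g \<in> carrier G \<Longrightarrow> h \<in> carrier G \<Longrightarrow> \<phi> (g \<otimes>\<^bsub>G\<^esub> h) = \<phi> g * \<phi> h" for g h using hom_mult[OF \<phi>]
    by simp
  show "\<phi> \<one>\<^bsub>G\<^esub> = 1" using *[OF one_closed] **[OF one_closed one_closed] by auto
qed

text \<open>A homomorphism out of the opposite monoid is an anti-homomorphism by
  \<open>antihom_iff\<close>. This version is the one that functors out of \<open>BG\<close>
  produce.\<close>

lemma twisted_monoid_iff:
  "twisted_monoid C A \<mu> \<eta> G \<phi> t \<longleftrightarrow> is_monoid C (A, \<mu>, \<eta>) \<and>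
    (\<forall>g\<in>carrier G. is_monoid_hom C (tw_monoid (\<phi> g) (A, \<mu>, \<eta>)) (A, \<mu>, \<eta>) (t g)) \<and>
    t \<one>\<^bsub>G\<^esub> = ide A \<and> (\<forall>g\<in>carrier G. \<forall>h\<in>carrier G. t (g \<otimes>\<^bsub>G\<^esub> h) = t g \<cdot> t h)"
proof (cases "is_monoid C (A, \<mu>, \<eta>)")
  case True
  then have "\<mu> \<in> Hom C (A \<odot> A) A" "A \<in> Obj C" by (auto simp: is_monoid_def)
  then have "is_monoid_hom C (tw_monoid (\<phi> g) (A, \<mu>, \<eta>)) (A, \<mu>, \<eta>) (t g) \<longleftrightarrow>
      t g \<in> Hom C A A \<and> t g \<cdot> \<eta> = \<eta> \<and> t g \<cdot> \<mu>
          = (if \<phi> g = 1 then \<mu> else \<mu> \<cdot> sym A A) \<cdot> (t g \<star> t g)" for g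
    using antihom_iff[of "t g" A \<mu>] by (auto simp: is_monoid_hom_def tw_monoid_def op_monoid_def)
  then show ?thesis
    using True \<phi> symmetric_monoidal_category_axioms group_axioms
    unfolding twisted_monoid_def twisted_monoid_axioms_def internal_monoid_def internal_monoid_axioms_def
    by blast
next
  case False
  then show ?thesis
    by (auto simp: twisted_monoid_def internal_monoid_def internal_monoid_axioms_def)
qed

abbreviation "BG \<equiv> deloop G"
abbreviation "BC2 \<equiv> deloop C2"
abbreviation "B\<phi> \<equiv> deloop_hom G \<phi>"
abbreviation "proj \<equiv> semidirect_proj (Mon C) (Mon_C2_action C)"

lemma deloop_simps [simp]:
  "Obj (deloop H) = {()}" "Arr (deloop H) = carrier H" "Ide (deloop H) u = \<one>\<^bsub>H\<^esub>"
  "g \<cdot>\<^bsub>deloop H\<^esub> h = g \<otimes>\<^bsub>H\<^esub> h"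
  by (simp_all add: deloop_def)

lemma far_proj: "f \<in> Arr MonS \<Longrightarrow> far proj f = snd f"
  by (simp add: semidirect_proj_def)

lemma far_B\<phi>: "g \<in> carrier G \<Longrightarrow> far B\<phi> g = \<phi> g"
  by (simp add: deloop_hom_def)

lemma Hom_MonS_ArrD: "f \<in> Hom MonS M N \<Longrightarrow> f \<in> Arr MonS"
  by (simp add: Hom_def)

text \<open>As an arrow of \<open>Mon C\<close>, the value at \<open>g\<close> starts at the monoid
  twisted by \<open>\<phi> g\<close>; its second component makes the functor lie over
  \<open>BC2\<close>.\<close>

definition tw_functor where
  "tw_functor M t = \<lparr>fob = (\<lambda>_\<in>{()}. M), far = (\<lambda>g\<in>carrier G. ((tw_monoid (\<phi> g) M, M, t g), \<phi> g))\<rparr>"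

lemma tw_functor_eq_iff:
  "tw_functor M t = tw_functor M' t' \<longleftrightarrow> M = M' \<and> (\<forall>g\<in>carrier G. t g = t' g)"
proof
  assume *: "tw_functor M t = tw_functor M' t'"
  have "fob (tw_functor M t) () = fob (tw_functor M' t') ()" using * by simp
  moreover have "far (tw_functor M t) g = far (tw_functor M' t') g" for g using * by simp
  ultimately show "M = M' \<and> (\<forall>g\<in>carrier G. t g = t' g)"
    unfolding tw_functor_def by (auto simp: restrict_def split: if_splits) (metis prod.inject)
qed (auto simp: tw_functor_def intro!: restrict_ext)

lemma tw_functor_in:
  assumes "twisted_monoid C A \<mu> \<eta> G \<phi> t"
  shows "tw_functor (A, \<mu>, \<eta>) t \<in> functors_over BG MonS BC2 B\<phi> proj"
proof -
  let ?M = "(A, \<mu>, \<eta>)" and ?F = "tw_functor (A, \<mu>, \<eta>) t"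
  have M: "is_monoid C ?M"
    and t: "\<And>g. g \<in> carrier G \<Longrightarrow> is_monoid_hom C (tw_monoid (\<phi> g) ?M) ?M (t g)"
    "t \<one>\<^bsub>G\<^esub> = ide A" "\<And>g h. g \<in> carrier G \<Longrightarrow> h \<in> carrier G \<Longrightarrow> t (g \<otimes>\<^bsub>G\<^esub> h) = t g \<cdot> t h"
    using assms unfolding twisted_monoid_iff by auto
  have hom: "far ?F g \<in> Hom MonS ?M ?M" if "g \<in> carrier G" for g
    using that M t \<phi>_simps by (simp add: tw_functor_def mem_Hom_MonS)
  have "is_functor BG MonS ?F"
    unfolding is_functor_def
  proof (intro conjI ballI impI)
    show "fob ?F \<in> Obj BG \<rightarrow>\<^sub>E Obj MonS" using M
      by (auto simp: tw_functor_def semidirect_C2_def Mon_simps)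
    show "far ?F \<in> extensional (Arr BG)" by (simp add: tw_functor_def)
    show "far ?F g \<in> Hom MonS (fob ?F (Dom BG g)) (fob ?F (Cod BG g))" if "g \<in> Arr BG" for g
      using hom[of g] that by (simp add: tw_functor_def)
    show "far ?F (Ide BG X) = Ide MonS (fob ?F X)" if "X \<in> Obj BG" for X
      using t(2) by (simp add: tw_functor_def Ide_MonS \<phi>_simps tw_monoid_def)
    show "far ?F (g \<cdot>\<^bsub>BG\<^esub> h) = far ?F g \<cdot>\<^bsub>MonS\<^esub> far ?F h" if "h \<in> Arr BG" "g \<in> Arr BG" for g h
    proof -
      have "(tw_monoid (\<phi> h) ?M, ?M, t h) \<in> Arr (Mon C)"
        using that M t(1) by (simp add: Mon_simps tw_monoid_simps)
      then show ?thesis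
        using that M by (simp add: tw_functor_def Comp_MonS tw_monoid_mult \<phi>_simps t(3))
    qed
  qed
  moreover have "far proj (far ?F g) = far B\<phi> g" if "g \<in> carrier G" for g
    using far_proj[OF Hom_MonS_ArrD[OF hom[OF that]]] far_B\<phi>[OF that] that
    by (simp add: tw_functor_def)
  ultimately show ?thesis by (simp add: functors_over_def)
qed

text \<open>The single object of \<open>BG\<close> gives the monoid. The condition over
  \<open>BC2\<close> forces the sign \<open>\<phi> g\<close>, so at each \<open>g\<close> just the
  underlying arrow is left to choose, and functoriality makes these arrows an action.\<close>

lemma functors_over_tw_functor:
  assumes "F \<in> functors_over BG MonS BC2 B\<phi> proj"
  shows "\<exists>A \<mu> \<eta> t. twisted_monoid C A \<mu> \<eta> G \<phi> t \<and> F = tw_functor (A, \<mu>, \<eta>) t"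
proof -
  have F: "is_functor BG MonS F" and pr: "\<And>g. g \<in> carrier G \<Longrightarrow> far proj (far F g) = far B\<phi> g"
    using assms by (auto simp: functors_over_def)
  obtain A \<mu> \<eta> where M: "fob F () = (A, \<mu>, \<eta>)" by (cases "fob F ()") auto
  let ?M = "(A, \<mu>, \<eta>)"
  define t where "t g = snd (snd (fst (far F g)))" for g
  have hom: "far F g \<in> Hom MonS ?M ?M" if "g \<in> carrier G" for g
    using F that M by (auto simp: is_functor_def)
  have mon: "is_monoid C ?M"
    using is_functorD(1)[OF F, of "()"] M by (simp add: semidirect_C2_def Mon_simps)
  have far: "far F g = ((tw_monoid (\<phi> g) ?M, ?M, t g), \<phi> g)
      \<and> is_monoid_hom C (tw_monoid (\<phi> g) ?M) ?M (t g)"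
    if g: "g \<in> carrier G" for g
  proof -
    obtain N1 N2 f c where f: "far F g = ((N1, N2, f), c)" by (metis prod.exhaust)
    have "c = \<phi> g"
      using pr[OF g] far_proj[OF Hom_MonS_ArrD[OF hom[OF g]]] far_B\<phi>[OF g] f by simp
    then show ?thesis using hom[OF g] unfolding f t_def mem_Hom_MonS by auto
  qed
  have "t \<one>\<^bsub>G\<^esub> = ide A"
    using is_functorD(5)[OF F, of "()"] far[OF one_closed] M by (simp add: Ide_MonS)
  moreover have "t (g \<otimes>\<^bsub>G\<^esub> h) = t g \<cdot> t h" if "g \<in> carrier G" "h \<in> carrier G" for g h
  proof -
    have "(tw_monoid (\<phi> h) ?M, ?M, t h) \<in> Arr (Mon C)"
      using far[OF that(2)] mon by (simp add: Mon_simps tw_monoid_simps)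
    moreover have "far F (g \<otimes>\<^bsub>G\<^esub> h) = far F g \<cdot>\<^bsub>MonS\<^esub> far F h"
      using is_functorD(6)[OF F, of h g] that by simp
    ultimately show ?thesis using far that by (simp add: Comp_MonS)
  qed
  ultimately have "twisted_monoid C A \<mu> \<eta> G \<phi> t"
    unfolding twisted_monoid_iff using mon far by blast
  moreover have "F = tw_functor ?M t"
  proof -
    have "fob F = fob (tw_functor ?M t)"
      using M by (intro ext) (simp add: tw_functor_def)
    moreover have "far F = far (tw_functor ?M t)"
      using F far
      by (intro extensionalityI[of _ "carrier G"]) (auto simp: tw_functor_def is_functor_def)
    ultimately show ?thesis by simp
  qed
  ultimately show ?thesis by blast
qed

text \<open>A component over the identity has sign \<open>1\<close> and is thus an untwisted monoid
  homomorphism; naturality at \<open>g\<close> is equivariance.\<close>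

lemma nat_trans_over_iff:
  assumes "twisted_monoid C A \<mu> \<eta> G \<phi> t" "twisted_monoid C A' \<mu>' \<eta>' G \<phi> t'"
  shows "\<tau> \<in> nat_trans_over BG MonS BC2 B\<phi> proj (tw_functor (A, \<mu>, \<eta>) t) (tw_functor (A', \<mu>', \<eta>') t') \<longleftrightarrow>
    (\<exists>f. \<tau> = (\<lambda>_\<in>{()}. (((A, \<mu>, \<eta>), (A', \<mu>', \<eta>'), f), 1))
        \<and> is_monoid_hom C (A, \<mu>, \<eta>) (A', \<mu>', \<eta>') f \<and>
      (\<forall>g\<in>carrier G. f \<cdot> t g = t' g \<cdot> f))"
proof -
  let ?M = "(A, \<mu>, \<eta>)" and ?M' = "(A', \<mu>', \<eta>')"
  let ?F = "tw_functor ?M t" and ?F' = "tw_functor ?M' t'"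
  have M: "is_monoid C ?M" "is_monoid C ?M'"
    and t: "\<And>g. g \<in> carrier G \<Longrightarrow> is_monoid_hom C (tw_monoid (\<phi> g) ?M) ?M (t g)"
    using assms unfolding twisted_monoid_iff by auto
  have fob: "fob ?F () = ?M" "fob ?F' () = ?M'" by (simp_all add: tw_functor_def)
  have hom: "((?M, ?M', f), 1) \<in> Hom MonS ?M ?M' \<longleftrightarrow> is_monoid_hom C ?M ?M' f" for f
    using M by (simp add: mem_Hom_MonS tw_monoid_def)
  have nat: "((?M, ?M', f), 1) \<cdot>\<^bsub>MonS\<^esub> far ?F g = far ?F' g \<cdot>\<^bsub>MonS\<^esub> ((?M, ?M', f), 1) \<longleftrightarrow> f \<cdot> t g
      = t' g \<cdot> f"
    if "is_monoid_hom C ?M ?M' f" "g \<in> carrier G" for f g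
  proof -
    have "(tw_monoid (\<phi> g) ?M, ?M, t g) \<in> Arr (Mon C)" "(?M, ?M', f) \<in> Arr (Mon C)"
      using that t M by (simp_all add: Mon_simps tw_monoid_simps)
    then show ?thesis using that(2) M
      by (simp add: tw_functor_def Comp_MonS) (simp add: tw_monoid_def)
  qed
  show ?thesis
  proof
    assume \<tau>: "\<tau> \<in> nat_trans_over BG MonS BC2 B\<phi> proj ?F ?F'"
    obtain N1 N2 f c where f: "\<tau> () = ((N1, N2, f), c)" by (metis prod.exhaust)
    have h: "((N1, N2, f), c) \<in> Hom MonS ?M ?M'" and "far proj ((N1, N2, f), c) = 1"
      and n: "\<And>g. g \<in> carrier G \<Longrightarrow> \<tau> () \<cdot>\<^bsub>MonS\<^esub> far ?F g = far ?F' g \<cdot>\<^bsub>MonS\<^esub> \<tau> ()"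
      using \<tau> by (auto simp: nat_trans_over_def fob f)
    then have "c = 1" using far_proj[OF Hom_MonS_ArrD[OF h]] by simp
    then have eq: "\<tau> () = ((?M, ?M', f), 1)" and f': "is_monoid_hom C ?M ?M' f"
      using h f by (auto simp: mem_Hom_MonS tw_monoid_def)
    have "\<tau> = (\<lambda>_\<in>{()}. ((?M, ?M', f), 1))" using eq by (intro ext) simp
    then show "\<exists>f. \<tau>
        = (\<lambda>_\<in>{()}. ((?M, ?M', f), 1)) \<and> is_monoid_hom C ?M ?M' f
            \<and> (\<forall>g\<in>carrier G. f \<cdot> t g = t' g \<cdot> f)"
      using n f' nat[OF f'] unfolding eq by blast
  next
    assume "\<exists>f. \<tau>
        = (\<lambda>_\<in>{()}. ((?M, ?M', f), 1)) \<and> is_monoid_hom C ?M ?M' f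
            \<and> (\<forall>g\<in>carrier G. f \<cdot> t g = t' g \<cdot> f)"
    then obtain f where f: "\<tau> = (\<lambda>_\<in>{()}. ((?M, ?M', f), 1))" "is_monoid_hom C ?M ?M' f"
      "\<forall>g\<in>carrier G. f \<cdot> t g = t' g \<cdot> f"
      by blast
    have h: "((?M, ?M', f), 1) \<in> Hom MonS ?M ?M'" using f(2) hom by simp
    have "far proj ((?M, ?M', f), 1) = 1" using far_proj[OF Hom_MonS_ArrD[OF h]] by simp
    then show "\<tau> \<in> nat_trans_over BG MonS BC2 B\<phi> proj ?F ?F'"
      using h nat[OF f(2)] f(3) by (simp add: nat_trans_over_def fob f(1))
  qed
qed

lemma category_Mon_tw: "category (Mon_tw C G \<phi>)"
  unfolding Mon_tw_def
  by (rule category_functor_category_over[OF category_deloop[OF group_axioms]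
        C2_action.category_semidirect_C2[OF C2_action_Mon] category_deloop[OF group_C2]
        C2_action.is_functor_semidirect_proj[OF C2_action_Mon]])

section \<open>The category of algebras and the comparison functor\<close>

abbreviation "Algs \<equiv> Alg C T P"

lemma is_algebraD:
  assumes "is_algebra C T P (A, \<theta>)"
  shows "A \<in> Obj C" "twisted_algebra C G \<phi> A (oact A \<theta>)" "\<theta> n \<in> Hom C (src A n) A"
    "x \<in> op_set P n \<Longrightarrow> oact A \<theta> n x \<in> Arr C \<and> Dom C (oact A \<theta> n x)
        = opow A n \<I> \<and> Cod C (oact A \<theta> n x) = A"
proof -
  show *: "twisted_algebra C G \<phi> A (oact A \<theta>)" "\<theta> n \<in> Hom C (src A n) A" using assms
    unfolding is_algebra_iff by auto
  show "A \<in> Obj C" by (rule twisted_algebra.A[OF *(1)])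
  show "x \<in> op_set P n \<Longrightarrow> oact A \<theta> n x \<in> Arr C \<and> Dom C (oact A \<theta> n x)
      = opow A n \<I> \<and> Cod C (oact A \<theta> n x) = A"
    using twisted_algebra.a_Hom[OF *(1)] by (auto simp: mem_Hom)
qed

lemma is_algebra_hom_Hom: "is_algebra_hom C T P (A, \<theta>) (B, \<theta>') f \<Longrightarrow> f \<in> Arr C \<and> Dom C f = A \<and> Cod C f
    = B"
  by (simp add: is_algebra_hom_def mem_Hom)

lemma is_algebra_hom_Ide: "is_algebra C T P X \<Longrightarrow> is_algebra_hom C T P X X (ide (fst X))"
  using is_algebraD by (cases X) (simp add: is_algebra_hom_def mem_Hom tens_arr_list_replicate_Ide)

lemma is_algebra_hom_Comp:
  assumes X: "is_algebra C T P X" and Y: "is_algebra C T P Y" and Z: "is_algebra C T P Z"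
    and f: "is_algebra_hom C T P X Y f" and g: "is_algebra_hom C T P Y Z g"
  shows "is_algebra_hom C T P X Z (g \<cdot> f)"
proof -
  obtain A1 \<theta>1 A2 \<theta>2 A3 \<theta>3 where M: "X = (A1, \<theta>1)" "Y = (A2, \<theta>2)" "Z = (A3, \<theta>3)"
    by (cases X, cases Y, cases Z) auto
  have ft: "f \<in> Arr C" "Dom C f = A1" "Cod C f = A2" and gt: "g \<in> Arr C" "Dom C g = A2"
    "Cod C g = A3"
    using is_algebra_hom_Hom f g unfolding M by blast+
  have "(g \<cdot> f) \<cdot> oact A1 \<theta>1 n x = oact A3 \<theta>3 n x \<cdot> tens_arr_list C (replicate n (g \<cdot> f))" if
    x: "x \<in> op_set P n" for n x
  proof -
    note xs = is_algebraD(4)[OF X[unfolded M] x] is_algebraD(4)[OF Y[unfolded M] x]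
      is_algebraD(4)[OF Z[unfolded M] x]
    note tf = tens_arr_list_replicate[OF ft, of n] and tg = tens_arr_list_replicate[OF gt, of n]
    have "(g \<cdot> f) \<cdot> oact A1 \<theta>1 n x = g \<cdot> (f \<cdot> oact A1 \<theta>1 n x)" using xs ft gt by simp
    also have "f \<cdot> oact A1 \<theta>1 n x = oact A2 \<theta>2 n x \<cdot> tens_arr_list C (replicate n f)"
      using f x by (simp add: M is_algebra_hom_def)
    also have "g \<cdot> (oact A2 \<theta>2 n x \<cdot> tens_arr_list C (replicate n f))
        = (g \<cdot> oact A2 \<theta>2 n x) \<cdot> tens_arr_list C (replicate n f)"
      using xs gt tf by simp
    also have "g \<cdot> oact A2 \<theta>2 n x = oact A3 \<theta>3 n x \<cdot> tens_arr_list C (replicate n g)"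
      using g x by (simp add: M is_algebra_hom_def)
    finally show ?thesis using xs tf tg ft gt by (simp add: tens_arr_list_replicate_Comp)
  qed
  then show ?thesis using ft gt by (simp add: M is_algebra_hom_def mem_Hom)
qed

lemma category_Algs: "category Algs"
proof (rule category.intro)
  fix X Y Z W :: "'o \<times> (nat \<Rightarrow> 'm)" and f g h :: "('o \<times> (nat \<Rightarrow> 'm)) \<times> ('o \<times> (nat \<Rightarrow> 'm)) \<times> 'm"
  note [simp] = Alg_def Hom_def
  show "f \<in> Arr Algs \<Longrightarrow> Dom Algs f \<in> Obj Algs" "f \<in> Arr Algs \<Longrightarrow> Cod Algs f \<in> Obj Algs"
    by auto
  show "X \<in> Obj Algs \<Longrightarrow> Ide Algs X \<in> Hom Algs X X"
    using is_algebra_hom_Ide by simp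
  show "f \<in> Hom Algs X Y \<Longrightarrow> g \<in> Hom Algs Y Z \<Longrightarrow> g \<cdot>\<^bsub>Algs\<^esub> f \<in> Hom Algs X Z"
    using is_algebra_hom_Comp by auto
  show "f \<in> Hom Algs X Y \<Longrightarrow> Ide Algs Y \<cdot>\<^bsub>Algs\<^esub> f = f" "f \<in> Hom Algs X Y \<Longrightarrow> f \<cdot>\<^bsub>Algs\<^esub> Ide Algs X = f"
    using is_algebra_hom_Hom by (cases X; cases Y; auto)+
  show "f \<in> Hom Algs X Y \<Longrightarrow> g \<in> Hom Algs Y Z \<Longrightarrow> h \<in> Hom Algs Z W \<Longrightarrow>
      (h \<cdot>\<^bsub>Algs\<^esub> g) \<cdot>\<^bsub>Algs\<^esub> f = h \<cdot>\<^bsub>Algs\<^esub> (g \<cdot>\<^bsub>Algs\<^esub> f)"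
    using is_algebra_hom_Hom by (cases X; cases Y; cases Z; cases W; auto)
qed

definition alg_monoid where
  "alg_monoid = (\<lambda>(A, \<theta>). (A, mult_of \<one>\<^bsub>G\<^esub> A (oact A \<theta>), unit_of \<one>\<^bsub>G\<^esub> (oact A \<theta>)))"

definition alg_action where
  "alg_action = (\<lambda>(A, \<theta>). act_of A (oact A \<theta>))"

definition alg_functor where
  "alg_functor X = tw_functor (alg_monoid X) (alg_action X)"

lemma twisted_monoid_alg:
  assumes "is_algebra C T P (A, \<theta>)"
  shows "twisted_monoid C A (mult_of \<one>\<^bsub>G\<^esub> A (oact A \<theta>)) (unit_of \<one>\<^bsub>G\<^esub> (oact A \<theta>)) G \<phi> (alg_action (A, \<theta>))"
  using twisted_algebra.twisted_monoid_data[OF is_algebraD(2)[OF assms]]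
  by (simp add: alg_action_def)

text \<open>In one direction the condition is evaluated on the nullary, binary and unary generators
  and right unitors are cancelled. In the other, \<open>a_eq_twop\<close> expresses every operation
  through these data and \<open>twop_hom\<close> applies.\<close>

lemma is_algebra_hom_iff:
  assumes X: "is_algebra C T P X" and Y: "is_algebra C T P Y"
  shows "is_algebra_hom C T P X Y f \<longleftrightarrow>
    is_monoid_hom C (alg_monoid X) (alg_monoid Y) f
        \<and> (\<forall>g\<in>carrier G. f \<cdot> alg_action X g = alg_action Y g \<cdot> f)"
proof -
  obtain A \<theta> B \<theta>' where XY: "X = (A, \<theta>)" "Y = (B, \<theta>')" by (cases X, cases Y) auto
  interpret X: twisted_algebra C G \<phi> A "oact A \<theta>" using is_algebraD(2) X unfolding XY .
  interpret Y: twisted_algebra C G \<phi> B "oact B \<theta>'" using is_algebraD(2) Y unfolding XY .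
  interpret MX: twisted_monoid C A X.\<mu> X.\<eta> G \<phi> X.t by (rule X.twisted_monoid_data)
  interpret MY: twisted_monoid C B Y.\<mu> Y.\<eta> G \<phi> Y.t by (rule Y.twisted_monoid_data)
  have e: "alg_monoid X = (A, X.\<mu>, X.\<eta>)" "alg_monoid Y = (B, Y.\<mu>, Y.\<eta>)" "alg_action X = X.t"
    "alg_action Y = Y.t"
    by (simp_all add: XY alg_monoid_def alg_action_def)
  show ?thesis unfolding e unfolding XY
  proof
    assume h: "is_algebra_hom C T P (A, \<theta>) (B, \<theta>') f"
    then have f: "f \<in> Arr C" "Dom C f = A" "Cod C f = B" using is_algebra_hom_Hom by auto
    have h': "f \<cdot> oact A \<theta> n x = oact B \<theta>' n x \<cdot> tens_arr_list C (replicate n f)" if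
      "x \<in> op_set P n" for n x
      using h that by (simp add: is_algebra_hom_def)
    have "f \<cdot> X.\<eta> = Y.\<eta>"
      using h'[OF X.std_op_set[of 0]] Y.unit_simps unfolding unit_of_def by (simp del: op_act_def)
    moreover have "f \<cdot> X.\<mu> = Y.\<mu> \<cdot> (f \<star> f)"
    proof (rule cancel_epi[of "ide A \<star> run A"])
      have "(f \<cdot> X.\<mu>) \<cdot> (ide A \<star> run A) = (Y.\<mu> \<cdot> (ide B \<star> run B)) \<cdot> (f \<star> (f \<star> ide \<I>))"
        using h'[OF X.std_op_set[of "Suc (Suc 0)"]] f X.mult_simps Y.mult_simps by simp
      also have "\<dots> = Y.\<mu> \<cdot> (f \<star> (run B \<cdot> (f \<star> ide \<I>)))"
        using f by (simp add: interchange)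
      also have "\<dots> = (Y.\<mu> \<cdot> (f \<star> f)) \<cdot> (ide A \<star> run A)"
        using f runitor_natural[of f] by (simp add: interchange)
      finally show "(f \<cdot> X.\<mu>) \<cdot> (ide A \<star> run A) = (Y.\<mu> \<cdot> (f \<star> f)) \<cdot> (ide A \<star> run A)" .
    qed (use f in simp_all)
    moreover have "f \<cdot> X.t g = Y.t g \<cdot> f" if g: "g \<in> carrier G" for g
    proof (rule cancel_epi[of "run A"])
      have "(f \<cdot> X.t g) \<cdot> run A = (Y.t g \<cdot> run B) \<cdot> (f \<star> ide \<I>)"
        using h'[OF X.unary_op_set[OF g]] f X.act_simps[OF g] Y.act_simps[OF g] by simp
      then show "(f \<cdot> X.t g) \<cdot> run A = (Y.t g \<cdot> f) \<cdot> run A"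
        using f g runitor_natural[of f] by simp
    qed (use f g in simp_all)
    ultimately show
      "is_monoid_hom C (A, X.\<mu>, X.\<eta>) (B, Y.\<mu>, Y.\<eta>) f \<and> (\<forall>g\<in>carrier G. f \<cdot> X.t g = Y.t g \<cdot> f)"
      using f by (simp add: is_monoid_hom_def mem_Hom)
  next
    assume h: "is_monoid_hom C (A, X.\<mu>, X.\<eta>) (B, Y.\<mu>, Y.\<eta>) f
        \<and> (\<forall>g\<in>carrier G. f \<cdot> X.t g = Y.t g \<cdot> f)"
    then have "f \<in> Hom C A B" by (simp add: is_monoid_hom_def)
    moreover have "f \<cdot> oact A \<theta> n x = oact B \<theta>' n x \<cdot> tens_arr_list C (replicate n f)" if
      x: "x \<in> op_set P n" for n x
      unfolding X.a_eq_twop[OF x] Y.a_eq_twop[OF x]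
      by (rule MX.twop_hom[OF MY.monoid_data conjunct1[OF h] MY.t_Hom bspec[OF conjunct2[OF h]] x])
    ultimately show "is_algebra_hom C T P (A, \<theta>) (B, \<theta>') f" by (simp add: is_algebra_hom_def)
  qed
qed

text \<open>Equal monoids and actions give equal operations by \<open>a_eq_twop\<close>, and
  operations determine the structure maps.\<close>

lemma alg_functor_inj:
  assumes "is_algebra C T P X" "is_algebra C T P Y" "alg_functor X = alg_functor Y"
  shows "X = Y"
proof -
  obtain A \<theta> B \<theta>' where XY: "X = (A, \<theta>)" "Y = (B, \<theta>')" by (cases X, cases Y) auto
  interpret X: twisted_algebra C G \<phi> A "oact A \<theta>" using is_algebraD(2) assms(1) unfolding XY .
  interpret Y: twisted_algebra C G \<phi> B "oact B \<theta>'" using is_algebraD(2) assms(2) unfolding XY .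
  have eq: "A = B" "X.\<mu> = Y.\<mu>" "X.\<eta> = Y.\<eta>" "\<And>g. g \<in> carrier G \<Longrightarrow> X.t g = Y.t g"
    using assms(3) unfolding alg_functor_def tw_functor_eq_iff
    by (auto simp: XY alg_monoid_def alg_action_def)
  have act: "oact A \<theta> n x = oact A \<theta>' n x" if x: "x \<in> op_set P n" for n x
  proof -
    \<comment> \<open>The actions are known to agree on \<open>carrier G\<close>, which contains all
      decorations of \<open>x\<close>.\<close>
    have "map X.t (snd x) = map Y.t (snd x)"
      using x eq(4) by (auto simp: mem_op_set_Assoc_tw)
    then have "twop A X.\<mu> X.\<eta> X.t n x = twop A Y.\<mu> Y.\<eta> Y.t n x"
      unfolding twop_def eq(2,3) by (rule arg_cong)
    then show ?thesis unfolding X.a_eq_twop[OF x] using Y.a_eq_twop[OF x] by (simp only: eq(1))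
  qed
  have "\<theta> n = \<theta>' n" for n
  proof (rule structure_unique[of A \<theta> n \<theta>', OF X.A _ _ act])
    show "\<theta> n \<in> Hom C (src A n) A" "\<theta>' n \<in> Hom C (src A n) A"
      using is_algebraD(3) assms(1,2) unfolding XY eq(1) by blast+
  qed
  then show ?thesis using eq(1) by (auto simp: XY)
qed

lemma op_perm_closed:
  assumes "x \<in> op_set P n" "bij_betw \<sigma> {..<n} {..<n}"
  shows "op_perm P n x \<sigma> \<in> op_set P n"
proof -
  obtain w gs where x: "x = (ord_of w, gs)" "perm_words [0..<n] w" "length gs = n"
    "set gs \<subseteq> carrier G"
    using assms(1) by (auto simp: mem_op_set_Assoc_tw)
  obtain v where v: "perm_words [0..<n] v"
    "op_perm P n x \<sigma> = (ord_of v, map ((!) gs) (map \<sigma> [0..<n]))"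
    using op_perm_Assoc_tw[OF assms(2) x(2)] unfolding x(1) by blast
  have "gs ! \<sigma> i \<in> carrier G" if "i < n" for i
    using bij_betwE[OF assms(2)] that x(3,4) nth_mem by blast
  then show ?thesis unfolding v(2) mem_op_set_Assoc_tw using v(1) by (intro exI conjI) auto
qed

text \<open>Structure maps obtained from the universal property realise a family on the elements of
  the operad. The axioms transfer because the unit, composites and permuted elements lie in the
  operad again.\<close>

lemma twisted_algebra_cong:
  assumes a: "twisted_algebra C G \<phi> A a" and eq: "\<And>n x. x \<in> op_set P n \<Longrightarrow> a' n x = a n x"
  shows "twisted_algebra C G \<phi> A a'"
proof -
  interpret a: twisted_algebra C G \<phi> A a by (rule a)
  have unit: "op_unit P \<in> op_set P 1"
    using a.unary_op_set[OF one_closed]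
    by (simp add: unary_def Assoc_tw_def semidirect_operad_def Assoc_def)
  show ?thesis
  proof unfold_locales
    show "a' 1 (op_unit P) = run A" using a.a_unit eq[OF unit] by simp
    fix n x assume x: "x \<in> op_set P n"
    show "a' n x \<in> Hom C (opow A n \<I>) A" using a.a_Hom[OF x] eq[OF x] by simp
    show "a' n (op_perm P n x \<sigma>) = a' n x \<cdot> f" if "perm_arr C A n \<sigma> f" for \<sigma> f
      using a.a_perm[OF x that] eq[OF x] eq[OF op_perm_closed[OF x perm_arr_can(1)[OF a.A that]]]
      by simp
  next
    fix ns x ys assume x: "x \<in> op_set P (length ns)"
      and ys: "list_all2 (\<lambda>n y. y \<in> op_set P n) ns ys"
    have m: "map2 a' ns ys = map2 a ns ys"
      using ys eq by (auto simp: list_all2_iff)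
    show "a' (sum_list ns) (op_comp P ns x ys)
        = a' (length ns) x \<cdot> blocks A (zip ns (map2 a' ns ys))"
      unfolding m eq[OF x] eq[OF op_comp_closed[OF x ys]] by (rule a.a_comp[OF x ys])
  qed (use \<phi> a.A in simp_all)
qed

text \<open>The operations \<open>twop\<close> of the twisted monoid are realised by structure maps,
  and the monoid and action read off from these are the given ones.\<close>

lemma alg_functor_surj:
  assumes "F \<in> functors_over BG MonS BC2 B\<phi> proj"
  shows "\<exists>X. is_algebra C T P X \<and> F = alg_functor X"
proof -
  obtain A \<mu> \<eta> t where M: "twisted_monoid C A \<mu> \<eta> G \<phi> t" and F: "F = tw_functor (A, \<mu>, \<eta>) t"
    using functors_over_tw_functor[OF assms] by blast
  interpret M: twisted_monoid C A \<mu> \<eta> G \<phi> t by (rule M)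
  interpret MA: twisted_algebra C G \<phi> A M.twop' by (rule M.twisted_algebra_twop)
  obtain \<theta> where \<theta>: "\<And>n. \<theta> n \<in> Hom C (src A n) A"
    "\<And>n x. x \<in> op_set P n \<Longrightarrow> oact A \<theta> n x = M.twop' n x"
    using structure_exists[of A M.twop', OF M.monoid_simps(1) MA.a_Hom] by blast
  have "is_algebra C T P (A, \<theta>)"
    unfolding is_algebra_iff using \<theta> twisted_algebra_cong[OF M.twisted_algebra_twop] by blast
  moreover have "mult_of \<one>\<^bsub>G\<^esub> A (oact A \<theta>) = \<mu>"
    using M.mult_of_twop \<theta>(2)[OF MA.std_op_set] by (simp add: mult_of_def)
  moreover have "unit_of \<one>\<^bsub>G\<^esub> (oact A \<theta>) = \<eta>"
    using M.unit_of_twop \<theta>(2)[OF MA.std_op_set] by (simp add: unit_of_def)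
  moreover have "act_of A (oact A \<theta>) g = t g" if "g \<in> carrier G" for g
    using M.act_of_twop[OF that] \<theta>(2)[OF MA.unary_op_set[OF that]] by (simp add: act_of_def)
  ultimately have "is_algebra C T P (A, \<theta>) \<and> F = alg_functor (A, \<theta>)"
    unfolding F alg_functor_def tw_functor_eq_iff by (simp add: alg_monoid_def alg_action_def)
  then show ?thesis by blast
qed

text \<open>The underlying arrow is kept; the sign \<open>1\<close> records that a morphism lies
  over the identity.\<close>

definition alg_nat where
  "alg_nat = (\<lambda>(X, Y, f). (alg_functor X, alg_functor Y, \<lambda>_\<in>{()}. ((alg_monoid X, alg_monoid Y, f), 1 :: int)))"

lemma Mon_tw_simps:
  "Obj (Mon_tw C G \<phi>) = functors_over BG MonS BC2 B\<phi> proj"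
  "(F, F', \<tau>) \<in> Arr (Mon_tw C G \<phi>) \<longleftrightarrow> F \<in> functors_over BG MonS BC2 B\<phi> proj \<and> F'
      \<in> functors_over BG MonS BC2 B\<phi> proj \<and>
     \<tau> \<in> nat_trans_over BG MonS BC2 B\<phi> proj F F'"
  "Dom (Mon_tw C G \<phi>) (F, F', \<tau>) = F" "Cod (Mon_tw C G \<phi>) (F, F', \<tau>) = F'"
  "Ide (Mon_tw C G \<phi>) F = (F, F, \<lambda>X\<in>{()}. Ide MonS (fob F X))"
  "(F1, F1', \<tau>1) \<cdot>\<^bsub>Mon_tw C G \<phi>\<^esub> (F2, F2', \<tau>2) = (F2, F1', \<lambda>X\<in>{()}. \<tau>1 X \<cdot>\<^bsub>MonS\<^esub> \<tau>2 X)"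
  by (simp_all add: Mon_tw_def functor_category_over_def)

lemma Algs_simps:
  "X \<in> Obj Algs \<longleftrightarrow> is_algebra C T P X"
  "(X, Y, f) \<in> Arr Algs \<longleftrightarrow> is_algebra C T P X \<and> is_algebra C T P Y \<and> is_algebra_hom C T P X Y f"
  "Dom Algs (X, Y, f) = X" "Cod Algs (X, Y, f) = Y" "Ide Algs X = (X, X, ide (fst X))"
  "(X1, Y1, f1) \<cdot>\<^bsub>Algs\<^esub> (X2, Y2, f2) = (X2, Y1, f1 \<cdot> f2)"
  by (simp_all add: Alg_def)

lemma alg_functor_in: "is_algebra C T P X \<Longrightarrow> alg_functor X \<in> functors_over BG MonS BC2 B\<phi> proj"
  using tw_functor_in[OF twisted_monoid_alg] by (cases X) (simp add: alg_functor_def alg_monoid_def)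

lemma alg_nat_trans_iff:
  assumes "is_algebra C T P X" "is_algebra C T P Y"
  shows "\<tau> \<in> nat_trans_over BG MonS BC2 B\<phi> proj (alg_functor X) (alg_functor Y) \<longleftrightarrow>
    (\<exists>f. \<tau> = (\<lambda>_\<in>{()}. ((alg_monoid X, alg_monoid Y, f), 1)) \<and> is_algebra_hom C T P X Y f)"
proof -
  obtain A \<theta> B \<theta>' where XY: "X = (A, \<theta>)" "Y = (B, \<theta>')" by (cases X, cases Y) auto
  show ?thesis
    using nat_trans_over_iff[OF twisted_monoid_alg twisted_monoid_alg, of A \<theta> B \<theta>' \<tau>] assms
    unfolding is_algebra_hom_iff[OF assms] alg_functor_def by (simp add: XY alg_monoid_def)
qed

lemma alg_nat_Arr: "f \<in> Arr Algs \<Longrightarrow> alg_nat f \<in> Arr (Mon_tw C G \<phi>)"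
  by (cases f) (auto simp: alg_nat_def Mon_tw_simps Algs_simps alg_functor_in alg_nat_trans_iff)

lemma alg_monoid_simps:
  assumes "is_algebra C T P X"
  shows "is_monoid C (alg_monoid X)" "fst (alg_monoid X) = fst X"
    "fob (alg_functor X) () = alg_monoid X"
  using assms twisted_monoid_alg[of "fst X" "snd X"] unfolding twisted_monoid_iff
  by (auto simp: alg_monoid_def alg_functor_def tw_functor_def split: prod.splits)

theorem isomorphic_Algs_Mon_tw: "isomorphic_categories Algs (Mon_tw C G \<phi>)"
proof (rule isomorphic_categoriesI)
  let ?F = "\<lparr>fob = restrict alg_functor (Obj Algs), far = restrict alg_nat (Arr Algs)\<rparr>"
  interpret A: category Algs by (rule category_Algs)
  interpret M: category "Mon_tw C G \<phi>" by (rule category_Mon_tw)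
  show "category Algs" "category (Mon_tw C G \<phi>)" by (rule category_Algs category_Mon_tw)+
  show "is_functor Algs (Mon_tw C G \<phi>) ?F"
    unfolding is_functor_def
  proof (intro conjI ballI impI)
    show "fob ?F \<in> Obj Algs \<rightarrow>\<^sub>E Obj (Mon_tw C G \<phi>)"
      by (auto simp: Algs_simps Mon_tw_simps alg_functor_in)
    show "far ?F \<in> extensional (Arr Algs)" by simp
    show "far ?F f \<in> Hom (Mon_tw C G \<phi>) (fob ?F (Dom Algs f)) (fob ?F (Cod Algs f))" if
      "f \<in> Arr Algs" for f
      using that alg_nat_Arr[OF that] A.Dom_Obj[OF that] A.Cod_Obj[OF that]
      by (cases f) (simp add: M.mem_Hom Algs_simps, simp add: alg_nat_def Mon_tw_simps)
    show "far ?F (Ide Algs X) = Ide (Mon_tw C G \<phi>) (fob ?F X)" if "X \<in> Obj Algs" for X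
    proof -
      have "Ide Algs X \<in> Arr Algs" using that by simp
      then show ?thesis using that
        by (auto simp: Algs_simps Mon_tw_simps alg_nat_def Ide_MonS alg_monoid_simps intro!: restrict_ext)
    qed
    show "far ?F (g \<cdot>\<^bsub>Algs\<^esub> f) = far ?F g \<cdot>\<^bsub>Mon_tw C G \<phi>\<^esub> far ?F f"
      if f: "f \<in> Arr Algs" and g: "g \<in> Arr Algs" and fg: "Cod Algs f = Dom Algs g" for f g
    proof -
      have c: "g \<cdot>\<^bsub>Algs\<^esub> f \<in> Arr Algs" using f g fg by simp
      obtain X Y Z u v where u: "f = (X, Y, u)" "g = (Y, Z, v)" using fg
        by (cases f, cases g) (auto simp: Algs_simps)
      have "(alg_monoid X, alg_monoid Y, u) \<in> Arr (Mon C)"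
        using f is_algebra_hom_iff[of X Y u] unfolding u
        by (auto simp: Algs_simps Mon_simps alg_monoid_simps)
      then have "((alg_monoid Y, alg_monoid Z, v), 1) \<cdot>\<^bsub>MonS\<^esub> ((alg_monoid X, alg_monoid Y, u), 1)
          = ((alg_monoid X, alg_monoid Z, v \<cdot> u), 1)"
        by (simp add: Comp_MonS tw_monoid_def)
      then show ?thesis using f g c unfolding u
        by (auto simp: Algs_simps Mon_tw_simps alg_nat_def intro!: restrict_ext)
    qed
  qed
  show "bij_betw (fob ?F) (Obj Algs) (Obj (Mon_tw C G \<phi>))"
    unfolding bij_betw_def
  proof
    show "inj_on (fob ?F) (Obj Algs)"
      by (rule inj_onI) (simp add: Algs_simps alg_functor_inj)
    show "fob ?F ` Obj Algs = Obj (Mon_tw C G \<phi>)"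
      using alg_functor_surj by (force simp: Algs_simps Mon_tw_simps alg_functor_in)
  qed
  show "bij_betw (far ?F) (Arr Algs) (Arr (Mon_tw C G \<phi>))"
    unfolding bij_betw_def
  proof
    show "inj_on (far ?F) (Arr Algs)"
    proof (rule inj_onI)
      fix f g assume f: "f \<in> Arr Algs" and g: "g \<in> Arr Algs" and "far ?F f = far ?F g"
      then have eq: "alg_nat f = alg_nat g" by simp
      obtain X Y u X' Y' v where u: "f = (X, Y, u)" "g = (X', Y', v)" by (cases f, cases g) auto
      have "alg_functor X = alg_functor X'" "alg_functor Y = alg_functor Y'" using eq
        by (simp_all add: u alg_nat_def)
      then have "X = X'" "Y = Y'" using f g alg_functor_inj by (auto simp: u Algs_simps)
      moreover have "u = v"
      proof -
        have "snd (snd (alg_nat f)) () = snd (snd (alg_nat g)) ()" using eq by simp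
        then show ?thesis by (simp add: u alg_nat_def)
      qed
      ultimately show "f = g" by (simp add: u)
    qed
    have "\<exists>f\<in>Arr Algs. h = alg_nat f" if "h \<in> Arr (Mon_tw C G \<phi>)" for h
    proof -
      obtain F F' \<tau> where h: "h = (F, F', \<tau>)" by (cases h) auto
      have *: "F \<in> functors_over BG MonS BC2 B\<phi> proj" "F' \<in> functors_over BG MonS BC2 B\<phi> proj"
        "\<tau> \<in> nat_trans_over BG MonS BC2 B\<phi> proj F F'"
        using that unfolding h Mon_tw_simps by simp_all
      obtain X Y where X: "is_algebra C T P X" "F = alg_functor X" and Y: "is_algebra C T P Y"
        "F' = alg_functor Y"
        using alg_functor_surj[OF *(1)] alg_functor_surj[OF *(2)] by blast
      obtain f where "\<tau> = (\<lambda>_\<in>{()}. ((alg_monoid X, alg_monoid Y, f), 1))"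
        "is_algebra_hom C T P X Y f"
        using *(3) unfolding X(2) Y(2) alg_nat_trans_iff[OF X(1) Y(1)] by blast
      then show ?thesis using X Y
        by (intro bexI[of _ "(X, Y, f)"]) (simp_all add: h alg_nat_def Algs_simps)
    qed
    then show "far ?F ` Arr Algs = Arr (Mon_tw C G \<phi>)"
      using alg_nat_Arr by (auto simp: image_iff)
  qed
qed

end

theorem proposition3p15:
  fixes C :: "('o, 'm, 'z) smc_scheme"
    and T :: "((nat \<times> nat) set \<times> 'g list, 'o, 'm) tensoring"
    and G :: "('g, 'y) monoid_scheme"
    and \<phi> :: "'g \<Rightarrow> int"
  assumes "symmetric_monoidal_category C"
    and "tensored_over_Set C T"
    and "group G"
    and "\<phi> \<in> hom G C2"
  shows "isomorphic_categories (Alg C T (Assoc_tw G \<phi>)) (Mon_tw C G \<phi>)"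
proof -
  have "tensored_smc C T G \<phi>"
    using assms by (simp add: tensored_smc_def tensored_smc_axioms_def)
  then show ?thesis by (rule tensored_smc.isomorphic_Algs_Mon_tw)
qed

end
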